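(* Let $M\in\mathbb{C}^{n\times n}$ be a positive-definite matrix (not necessarily Hermitian) and $\bm{b}\in\mathbb{C}^n$ a nonzero vector. Let $k\ge2$ be such that $Q_k$ and $H_k$ of the Arnoldi process for $M$ and $\bm{b}$ are defined. Then $$\|M^{1/2}\bm{b}-\operatorname{Arn}_k(x^{1/2};M,\bm{b})\|\le\frac{\Gamma(3/4)}{2^{1/4}\pi}\,\frac{2k}{2k-3}\,(\sigma_{\max}(M))^{3/2}\,k^{-3/4}\,\|\bm{\xi}_0^k\|,$$ where $\Gamma(\cdot)$ is the Gamma function and $\sigma_{\max}(M)$ is the largest singular value of $M$.
   Context: $\|\cdot\|$ is the Euclidean norm. A matrix $M\in\mathbb{C}^{n\times n}$ is called positive-definite if $\operatorname{Re}(\bm{x}^*M\bm{x})>0$ for every unit vector $\bm{x}\in\mathbb{C}^n$ ($M$ need not be Hermitian). For such $M$, $M^{1/2}$ denotes its unique positive-definite square root, i.e. the principal square root (the matrix function of $x^{1/2}$ with the principal branch, branch cut along the negative real axis). $H_k=Q_k^*MQ_k$ below is then also positive-definite, and $H_k^{1/2}$ is defined in the same way. Arnoldi process: given $M$ and $\bm{b}\neq \bm 0$, set $\bm{q}_1=\bm{b}/\|\bm{b}\|$. For $j=1,2,\dots,k$: start with $\bm{w}=M\bm{q}_j$; for $i=1,\dots,j$ successively put $h_{i,j}=\bm{q}_i^*\bm{w}$ and replace $\bm{w}$ by $\bm{w}-h_{i,j}\bm{q}_i$; then put $h_{j+1,j}=\|\bm{w}\|$, stop if $h_{j+1,j}=0$,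 and otherwise put $\bm{q}_{j+1}=\bm{w}/h_{j+1,j}$. It is understood that the process does not stop before step $k$ (i.e. $h_{j+1,j}\ne0$ for $1\le j<k$). Then $Q_k=[\bm{q}_1,\dots,\bm{q}_k]$ has orthonormal columns, $H_k=[h_{i,j}]_{i,j=1}^k$ is upper Hessenberg (with $h_{i,j}=0$ for $i>j+1$), and $H_k=Q_k^*MQ_k$. $\operatorname{Arn}_k(x^{1/2};M,\bm{b}):=Q_kH_k^{1/2}Q_k^*\bm{b}=\|\bm{b}\|Q_kH_k^{1/2}\bm{e}_1$, with $\bm{e}_1$ the first canonical basis vector of $\mathbb{C}^k$. $\bm{\xi}_0^k:=M^{-1}\bm{b}-Q_kH_k^{-1}\|\bm{b}\|\bm{e}_1$ is the error of the $k$-th iterate of the Full Orthogonalization Method (zero initial guess) for $M\bm{x}=\bm{b}$. *)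

theory Defs
  imports
    "HOL-Analysis.Gamma_Function"
    "Jordan_Normal_Form.Schur_Decomposition"
    "Jordan_Normal_Form.Gauss_Jordan_Elimination"
begin

hide_const (open) Finite_Cartesian_Product.vec Finite_Cartesian_Product.mat
no_notation Finite_Cartesian_Product.vec_nth (infixl \<open>$\<close> 90)

(* The product x^* y is written y \<bullet>c x: the library scalar product conjugates its second argument. *)

definition cvec_norm :: "complex vec \<Rightarrow> real" where
  "cvec_norm v = L2_set (\<lambda>i. cmod (v $ i)) {..<dim_vec v}"

(* Not assumed Hermitian. *)
definition pos_def :: "complex mat \<Rightarrow> bool" where
  "pos_def M \<longleftrightarrow> square_mat M \<and>
     (\<forall>x \<in> carrier_vec (dim_row M). cvec_norm x = 1 \<longrightarrow> Re ((M *\<^sub>v x) \<bullet>c x) > 0)"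

(* Meaningful for positive-definite M, which has exactly one positive-definite square root,
   namely the principal one. *)
definition mat_sqrt :: "complex mat \<Rightarrow> complex mat" where
  "mat_sqrt M = (THE X. X \<in> carrier_mat (dim_row M) (dim_row M) \<and> pos_def X \<and> X * X = M)"

(* Unspecified when M is singular. *)
definition mat_inv :: "complex mat \<Rightarrow> complex mat" where
  "mat_inv M = the (mat_inverse M)"

definition singular_values :: "complex mat \<Rightarrow> real set" where
  "singular_values M = {s. s \<ge> 0 \<and> eigenvalue (mat_adjoint M * M) (complex_of_real (s\<^sup>2))}"

definition sigma_max :: "complex mat \<Rightarrow> real" where
  "sigma_max M = Max (singular_values M)"

(* Indices start at 1. arnoldi_w M b j i is the vector w of step j after it has been
   orthogonalised against q_1, ..., q_i. The recursion continues past a breakdown with junk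
   values (division by zero is zero), which arnoldi_defined excludes. *)
function arnoldi_q :: "complex mat \<Rightarrow> complex vec \<Rightarrow> nat \<Rightarrow> complex vec"
  and arnoldi_w :: "complex mat \<Rightarrow> complex vec \<Rightarrow> nat \<Rightarrow> nat \<Rightarrow> complex vec"
where
  "arnoldi_q M b 0 = 0\<^sub>v (dim_vec b)"
| "arnoldi_q M b (Suc 0) = complex_of_real (1 / cvec_norm b) \<cdot>\<^sub>v b"
| "arnoldi_q M b (Suc (Suc j)) =
     complex_of_real (1 / cvec_norm (arnoldi_w M b (Suc j) (Suc j))) \<cdot>\<^sub>v arnoldi_w M b (Suc j) (Suc j)"
| "arnoldi_w M b j 0 = M *\<^sub>v arnoldi_q M b j"
| "arnoldi_w M b j (Suc i) =
     arnoldi_w M b j i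
       - (arnoldi_w M b j i \<bullet>c arnoldi_q M b (Suc i)) \<cdot>\<^sub>v arnoldi_q M b (Suc i)"
  by pat_completeness auto
termination
  by (relation "measures [case_sum (\<lambda>(M, b, j). j) (\<lambda>(M, b, j, i). max j i),
                          case_sum (\<lambda>(M, b, j). 0) (\<lambda>(M, b, j, i). Suc i)]") auto

definition arnoldi_h :: "complex mat \<Rightarrow> complex vec \<Rightarrow> nat \<Rightarrow> nat \<Rightarrow> complex" where
  "arnoldi_h M b i j =
     (if i \<le> j then arnoldi_w M b j (i - 1) \<bullet>c arnoldi_q M b i
      else if i = j + 1 then complex_of_real (cvec_norm (arnoldi_w M b j j))
      else 0)"

(* Breakdown at step k itself, i.e. a zero entry h_{k+1,k}, is permitted. *)
definition arnoldi_defined :: "complex mat \<Rightarrow> complex vec \<Rightarrow> nat \<Rightarrow> bool" where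
  "arnoldi_defined M b k \<longleftrightarrow> (\<forall>j. 1 \<le> j \<and> j < k \<longrightarrow> arnoldi_h M b (j + 1) j \<noteq> 0)"

definition arnoldi_Q :: "complex mat \<Rightarrow> complex vec \<Rightarrow> nat \<Rightarrow> complex mat" where
  "arnoldi_Q M b k = mat_of_cols (dim_vec b) (map (arnoldi_q M b) [1..<k + 1])"

definition arnoldi_H :: "complex mat \<Rightarrow> complex vec \<Rightarrow> nat \<Rightarrow> complex mat" where
  "arnoldi_H M b k = mat k k (\<lambda>(i, j). arnoldi_h M b (i + 1) (j + 1))"

definition arn_sqrt :: "complex mat \<Rightarrow> complex vec \<Rightarrow> nat \<Rightarrow> complex vec" where
  "arn_sqrt M b k =
     arnoldi_Q M b k *\<^sub>v (mat_sqrt (arnoldi_H M b k) *\<^sub>v (mat_adjoint (arnoldi_Q M b k) *\<^sub>v b))"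

definition fom_error :: "complex mat \<Rightarrow> complex vec \<Rightarrow> nat \<Rightarrow> complex vec" where
  "fom_error M b k =
     mat_inv M *\<^sub>v b
       - arnoldi_Q M b k *\<^sub>v (mat_inv (arnoldi_H M b k) *\<^sub>v
           (complex_of_real (cvec_norm b) \<cdot>\<^sub>v unit_vec k 0))"

end

theory Submission
  imports "HOL-Analysis.Change_Of_Vars" "HOL-Analysis.Lipschitz" Defs
begin

hide_const (open) Finite_Cartesian_Product.vec Finite_Cartesian_Product.mat
no_notation Finite_Cartesian_Product.vec_nth (infixl \<open>$\<close> 90)

text \<open>
  With \<open>x\<^sup>1\<^sup>/\<^sup>2 = 2/\<pi> \<integral>\<^sub>0\<^sup>\<infinity> x (s\<^sup>2 + x)\<^sup>-\<^sup>1 ds\<close> the error of the Arnoldi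
  approximation is \<open>-2/\<pi> \<integral>\<^sub>0\<^sup>\<infinity> s\<^sup>2 \<xi>(s\<^sup>2) ds\<close>, where \<open>\<xi>(t)\<close> is the FOM error for the shifted
  system \<open>(M + t) x = b\<close>. Shifts leave the Krylov spaces and the subdiagonal of \<open>H\<close> unchanged, so
  all residuals are collinear and \<open>\<xi>(t) = (det H / det (H + t)) (M + t)\<^sup>-\<^sup>1 M \<xi>(0)\<close>. Since \<open>M\<close> and \<open>H\<close>
  are positive-definite with norm at most \<open>\<sigma>\<close>, each of the \<open>k\<close> factors \<open>\<lambda> / (\<lambda> + t)\<close> of the determinant
  quotient and the norm of \<open>(M + t)\<^sup>-\<^sup>1 M\<close> is at most \<open>(1 + t\<^sup>2/\<sigma>\<^sup>2)\<^sup>-\<^sup>1\<^sup>/\<^sup>2\<close>. The remaining scalar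
  integral is a Beta value, estimated by log-convexity of the Gamma function.

  The integral formula for \<open>mat_sqrt\<close> holds for eigenvectors by direct integration, hence for matrices
  with distinct eigenvalues, and for all others by perturbing the Schur form.
\<close>

section \<open>Norms and pairings of complex vectors\<close>

text \<open>The factor s^2 in the error formula comes from x/(s^2 + x) = 1 - s^2/(s^2 + x): since b
  lies in the range of Q, the constant terms of M and of H both contribute b and cancel, and only a
  difference of resolvents remains. The determinant quotient is Cramer's rule: the residual at shift
  t is a multiple of the last Arnoldi remainder, the multiplier is up to sign the last coordinate of
  (H + t)^-1 ||b|| e_1, and its cofactor is free of t. With t = s^2, the k factors of the quotient
  and the one of the resolvent give the integrand s^2 (1 + s^4/\<sigma>^2)^(-(k+1)/2). Three
  obstacles shape the rest. \<open>mat_sqrt\<close> is a definite description, so the integral has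
  to be a positive-definite root and that root has to be unique, for M and for H. M may be
  defective, so the formula is reached through nearby matrices with distinct eigenvalues, and the
  bounds must be uniform along them. Vectors carry their dimension as data and form no single normed
  space, so only scalar pairings are integrated and norms are recovered by duality.\<close>

lemma cvec_norm_nonneg [simp]: "0 \<le> cvec_norm v"
  by (simp add: cvec_norm_def)

lemma cvec_norm_power2: "(cvec_norm v)\<^sup>2 = (\<Sum>i<dim_vec v. (cmod (v $ i))\<^sup>2)"
  by (simp add: cvec_norm_def L2_set_def sum_nonneg)

lemma cscalar_self: "v \<bullet>c v = complex_of_real ((cvec_norm v)\<^sup>2)"
  by (simp add: cvec_norm_power2 scalar_prod_def complex_norm_square lessThan_atLeast0
      conjugate_complex_def del: of_real_power)

lemma cvec_norm_zero [simp]: "cvec_norm (0\<^sub>v n) = 0"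
  by (simp add: cvec_norm_def L2_set_def)

lemma cvec_norm_eq_0_iff:
  assumes "v \<in> carrier_vec n"
  shows "cvec_norm v = 0 \<longleftrightarrow> v = 0\<^sub>v n"
proof -
  have "cvec_norm v = 0 \<longleftrightarrow> v \<bullet>c v = 0"
    by (simp add: cscalar_self)
  with conjugate_square_eq_0_vec[OF assms] show ?thesis by blast
qed

lemma cvec_norm_smult: "cvec_norm (c \<cdot>\<^sub>v v) = cmod c * cvec_norm v"
  unfolding cvec_norm_def index_smult_vec(2) L2_set_right_distrib[OF norm_ge_zero]
  by (auto intro!: L2_set_cong simp: norm_mult)

lemma cvec_norm_add_le:
  assumes "v \<in> carrier_vec n" "w \<in> carrier_vec n"
  shows "cvec_norm (v + w) \<le> cvec_norm v + cvec_norm w"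
proof -
  have "cvec_norm (v + w) \<le> L2_set (\<lambda>i. cmod (v $ i) + cmod (w $ i)) {..<n}"
    unfolding cvec_norm_def using assms by (auto intro!: L2_set_mono norm_triangle_ineq)
  also have "\<dots> \<le> cvec_norm v + cvec_norm w"
    using assms L2_set_triangle_ineq[of "\<lambda>i. cmod (v $ i)" "\<lambda>i. cmod (w $ i)" "{..<n}"]
    by (simp add: cvec_norm_def)
  finally show ?thesis .
qed

lemma cvec_norm_uminus: "cvec_norm (- v) = cvec_norm v"
  unfolding cvec_norm_def by (auto intro!: L2_set_cong)

lemma cvec_norm_diff_le:
  assumes "v \<in> carrier_vec n" "w \<in> carrier_vec n"
  shows "cvec_norm (v - w) \<le> cvec_norm v + cvec_norm w"
proof -
  have "v - w = v + (- w)" using assms by (auto intro!: eq_vecI)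
  with cvec_norm_add_le[of v n "- w"] assms show ?thesis
    by (simp add: cvec_norm_uminus)
qed

lemma cvec_norm_diff_ge:
  assumes "v \<in> carrier_vec n" "w \<in> carrier_vec n"
  shows "cvec_norm v - cvec_norm w \<le> cvec_norm (v + w)"
proof -
  have "v = (v + w) - w" using assms by (auto intro!: eq_vecI)
  with cvec_norm_diff_le[of "v + w" n w] assms show ?thesis by simp
qed

lemma cscalar_Cauchy_Schwarz:
  assumes "v \<in> carrier_vec n" "w \<in> carrier_vec n"
  shows "cmod (v \<bullet>c w) \<le> cvec_norm v * cvec_norm w"
proof -
  have "cmod (v \<bullet>c w) \<le> (\<Sum>i<n. cmod (v $ i * conjugate (w $ i)))"
    unfolding scalar_prod_def using assms by (auto simp: lessThan_atLeast0 intro: order_trans[OF norm_sum])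
  also have "\<dots> = (\<Sum>i<n. \<bar>cmod (v $ i)\<bar> * \<bar>cmod (w $ i)\<bar>)"
    by (simp add: norm_mult conjugate_complex_def)
  also have "\<dots> \<le> cvec_norm v * cvec_norm w"
    using assms L2_set_mult_ineq[of "\<lambda>i. cmod (v $ i)" "\<lambda>i. cmod (w $ i)" "{..<n}"]
    by (simp add: cvec_norm_def)
  finally show ?thesis .
qed

text \<open>Test with w = v. This turns estimates of scalar integrals of pairings into norm
  bounds.\<close>

lemma cvec_norm_le_by_pairing:
  assumes v: "v \<in> carrier_vec n" and C: "0 \<le> C"
    and le: "\<And>w. w \<in> carrier_vec n \<Longrightarrow> cmod (v \<bullet>c w) \<le> C * cvec_norm w"
  shows "cvec_norm v \<le> C"
proof (cases "cvec_norm v = 0")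
  case False
  then have pos: "cvec_norm v > 0" by (simp add: less_le)
  have "(cvec_norm v)\<^sup>2 \<le> C * cvec_norm v"
    using le[OF v] by (simp add: cscalar_self norm_power)
  with pos show ?thesis by (simp add: power2_eq_square)
qed (use C in simp)

lemma cvec_norm_unit_vec:
  assumes "i < n"
  shows "cvec_norm (unit_vec n i) = 1"
proof -
  have "(cvec_norm (unit_vec n i))\<^sup>2 = (\<Sum>l<n. if l = i then 1 else 0)"
    unfolding cvec_norm_power2 index_unit_vec(3) by (rule sum.cong) (auto simp: unit_vec_def)
  then have "(cvec_norm (unit_vec n i))\<^sup>2 = 1\<^sup>2" using assms by simp
  then show ?thesis by (subst (asm) power2_eq_iff_nonneg) auto
qed

lemma cscalar_commute:
  assumes "v \<in> carrier_vec n" "w \<in> carrier_vec n"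
  shows "w \<bullet>c v = cnj (v \<bullet>c w)"
  using assms by (auto simp: scalar_prod_def conjugate_complex_def intro!: sum.cong)

section \<open>Adjoints, norm bounds and inverses of matrices\<close>

lemma dim_mat_adjoint [simp]:
  "dim_row (mat_adjoint A) = dim_col A" "dim_col (mat_adjoint A) = dim_row A"
  by (auto simp: mat_adjoint_def)

lemma mat_adjoint_carrier [simp, intro]:
  "A \<in> carrier_mat n m \<Longrightarrow> mat_adjoint A \<in> carrier_mat m n"
  by (intro carrier_matI) auto

lemma index_mat_adjoint:
  assumes "i < dim_col A" "j < dim_row A"
  shows "mat_adjoint A $$ (i, j) = conjugate (A $$ (j, i))"
  using assms by (simp add: mat_adjoint_def mat_of_rows_index)

lemma cscalar_mat_adjoint:
  fixes A :: "complex mat"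
  assumes A: "A \<in> carrier_mat n m" and v: "v \<in> carrier_vec m" and w: "w \<in> carrier_vec n"
  shows "(A *\<^sub>v v) \<bullet>c w = v \<bullet>c (mat_adjoint A *\<^sub>v w)"
proof -
  have "(A *\<^sub>v v) \<bullet>c w = (\<Sum>i<n. \<Sum>j<m. A $$ (i, j) * v $ j * cnj (w $ i))"
    using assms by (auto simp: scalar_prod_def lessThan_atLeast0 sum_distrib_right conjugate_complex_def
        intro!: sum.cong)
  also have "\<dots> = (\<Sum>j<m. \<Sum>i<n. A $$ (i, j) * v $ j * cnj (w $ i))"
    by (rule sum.swap)
  also have "\<dots> = v \<bullet>c (mat_adjoint A *\<^sub>v w)"
    using assms by (auto simp: scalar_prod_def lessThan_atLeast0 sum_distrib_left conjugate_complex_def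
        index_mat_adjoint intro!: sum.cong)
  finally show ?thesis .
qed

text \<open>Cauchy-Schwarz in each row. Its uses ask only for some constant, so the sum of the row
  norms is good enough.\<close>

lemma mat_vec_norm_bounded:
  fixes A :: "complex mat"
  assumes A: "A \<in> carrier_mat n m"
  obtains K where "0 \<le> K" "\<And>v. v \<in> carrier_vec m \<Longrightarrow> cvec_norm (A *\<^sub>v v) \<le> K * cvec_norm v"
proof
  let ?K = "\<Sum>i<n. cvec_norm (row A i)"
  show "0 \<le> ?K" by (simp add: sum_nonneg)
  fix v :: "complex vec"
  assume v: "v \<in> carrier_vec m"
  have "cvec_norm (A *\<^sub>v v) \<le> (\<Sum>i<n. cmod ((A *\<^sub>v v) $ i))"
    unfolding cvec_norm_def using A by (intro order_trans[OF L2_set_le_sum]) auto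
  also have "\<dots> \<le> (\<Sum>i<n. cvec_norm (row A i) * cvec_norm v)"
  proof (rule sum_mono)
    fix i assume i: "i \<in> {..<n}"
    have "cmod (row A i \<bullet>c conjugate v) \<le> cvec_norm (row A i) * cvec_norm (conjugate v)"
      using A v i by (intro cscalar_Cauchy_Schwarz[of _ m]) auto
    moreover have "cvec_norm (conjugate v) = cvec_norm v"
      unfolding cvec_norm_def by (auto intro!: L2_set_cong simp: conjugate_complex_def)
    ultimately show "cmod ((A *\<^sub>v v) $ i) \<le> cvec_norm (row A i) * cvec_norm v"
      using A i by simp
  qed
  finally show "cvec_norm (A *\<^sub>v v) \<le> ?K * cvec_norm v"
    by (simp add: sum_distrib_right)
qed

text \<open>Injectivity makes the determinant nonzero, so \<open>mat_inverse\<close> returns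
  \<open>Some\<close> and the unspecified case of \<open>mat_inv\<close> does not arise.\<close>

lemma mat_inv:
  fixes A :: "complex mat"
  assumes A: "A \<in> carrier_mat n n"
    and inj: "\<And>v. v \<in> carrier_vec n \<Longrightarrow> A *\<^sub>v v = 0\<^sub>v n \<Longrightarrow> v = 0\<^sub>v n"
  shows "mat_inv A \<in> carrier_mat n n" "A * mat_inv A = 1\<^sub>m n" "mat_inv A * A = 1\<^sub>m n"
proof -
  have "det A \<noteq> 0"
    using inj det_0_iff_vec_prod_zero[OF A] by blast
  then have "A \<in> Units (ring_mat TYPE(complex) n undefined)"
    by (rule det_non_zero_imp_unit[OF A])
  then obtain B where B: "mat_inverse A = Some B"
    using mat_inverse(1)[OF A, of undefined] by (cases "mat_inverse A") auto
  with mat_inverse(2)[OF A B]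
  show "mat_inv A \<in> carrier_mat n n" "A * mat_inv A = 1\<^sub>m n" "mat_inv A * A = 1\<^sub>m n"
    by (auto simp: mat_inv_def)
qed

lemma mat_inv_mult_vec:
  fixes A :: "complex mat"
  assumes A: "A \<in> carrier_mat n n"
    and inj: "\<And>v. v \<in> carrier_vec n \<Longrightarrow> A *\<^sub>v v = 0\<^sub>v n \<Longrightarrow> v = 0\<^sub>v n"
    and v: "v \<in> carrier_vec n"
  shows "mat_inv A *\<^sub>v v \<in> carrier_vec n" "A *\<^sub>v (mat_inv A *\<^sub>v v) = v"
    "mat_inv A *\<^sub>v (A *\<^sub>v v) = v"
proof -
  note inv = mat_inv[OF A inj]
  show "mat_inv A *\<^sub>v v \<in> carrier_vec n" using inv(1) v by (rule mult_mat_vec_carrier)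
  show "A *\<^sub>v (mat_inv A *\<^sub>v v) = v"
    using assoc_mult_mat_vec[OF A inv(1) v] inv(2) v by simp
  show "mat_inv A *\<^sub>v (A *\<^sub>v v) = v"
    using assoc_mult_mat_vec[OF inv(1) A v] inv(3) v by simp
qed

lemma eq_mat_by_mult_vec:
  fixes A B :: "complex mat"
  assumes A: "A \<in> carrier_mat n m" and B: "B \<in> carrier_mat n m"
    and eq: "\<And>v. v \<in> carrier_vec m \<Longrightarrow> A *\<^sub>v v = B *\<^sub>v v"
  shows "A = B"
proof (rule eq_matI)
  fix i j assume "i < dim_row B" "j < dim_col B"
  moreover have "A *\<^sub>v unit_vec m j = B *\<^sub>v unit_vec m j" by (rule eq) auto
  ultimately have "(A *\<^sub>v unit_vec m j) $ i = (B *\<^sub>v unit_vec m j) $ i" by simp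
  with \<open>i < dim_row B\<close> \<open>j < dim_col B\<close> A B show "A $$ (i, j) = B $$ (i, j)"
    by simp
qed (use A B in auto)

lemma vec_eq_if_diff_zero:
  fixes x y :: "complex vec"
  assumes x: "x \<in> carrier_vec n" and y: "y \<in> carrier_vec n" and xy: "x - y = 0\<^sub>v n"
  shows "x = y"
proof (rule eq_vecI)
  fix i assume "i < dim_vec y"
  then have i: "i < n" using y by simp
  have "(x - y) $ i = 0" using xy i by simp
  then show "x $ i = y $ i" using i x y by simp
qed (use x y in auto)

lemma smult_zero_vec_right [simp]: "c \<cdot>\<^sub>v (0\<^sub>v n) = (0\<^sub>v n :: complex vec)"
  by (intro eq_vecI) auto

lemma mult_mat_zero_vec:
  fixes A :: "complex mat"
  assumes "A \<in> carrier_mat n m"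
  shows "A *\<^sub>v 0\<^sub>v m = 0\<^sub>v n"
  using assms by (intro eq_vecI) auto

section \<open>Scalar integrals\<close>

text \<open>Interpolates \<open>x - 1/4\<close> between \<open>x - 1/2\<close> and \<open>x + 1/2\<close>.\<close>
lemma Gamma_ratio_le:
  fixes x :: real
  assumes x: "1 \<le> x"
  shows "Gamma (x - 1/4) / Gamma (x + 1/2) \<le> x powr (- 3/4) * (x / (x - 3/4))"
proof -
  define y where "y = x - 1/2"
  have y: "0 < y" "1/2 \<le> y" using x by (auto simp: y_def)
  have G: "Gamma (y + 1) = y * Gamma y" using y by (intro Gamma_plus1) (auto elim!: nonpos_Ints_cases')
  have pos: "0 < Gamma y" "0 < Gamma (x - 1/4)" "0 < Gamma (y + 1)" using y x by (auto intro: Gamma_real_pos)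
  have "(ln \<circ> Gamma) ((1 - 1/4) *\<^sub>R y + (1/4) *\<^sub>R (y + 1))
      \<le> (1 - 1/4) * (ln \<circ> Gamma) y + (1/4) * (ln \<circ> Gamma) (y + 1)"
    by (rule convex_onD[OF log_convex_Gamma_real]) (use y in auto)
  moreover have "(1 - 1/4) *\<^sub>R y + (1/4) *\<^sub>R (y + 1) = x - 1/4"
    by (simp add: y_def field_simps)
  ultimately have "ln (Gamma (x - 1/4)) \<le> 3/4 * ln (Gamma y) + 1/4 * ln (Gamma (y + 1))"
    by simp
  also have "\<dots> = ln (Gamma (y + 1)) - 3/4 * ln y"
  proof -
    have "ln (Gamma (y + 1)) = ln y + ln (Gamma y)" unfolding G using y pos by (simp add: ln_mult_pos)
    then show ?thesis by argo
  qed
  also have "\<dots> = ln (Gamma (y + 1) * y powr (- 3/4))"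
    using y pos by (simp add: ln_mult_pos ln_powr)
  finally have "Gamma (x - 1/4) \<le> Gamma (y + 1) * y powr (- 3/4)"
    using y pos by (subst (asm) ln_le_cancel_iff) auto
  then have "Gamma (x - 1/4) / Gamma (x + 1/2) \<le> y powr (- 3/4)"
    using pos by (simp add: y_def field_simps)
  also have "\<dots> \<le> x powr (- 3/4) * (x / (x - 3/4))"
  proof -
    \<comment> \<open>Returning from y to x uses x - 3/4 \<le> y \<le> x and costs the factor x/(x -
      3/4). For x = k/2 this is the 2k/(2k - 3) of the theorem.\<close>
    have "(x - 3/4) * y powr (- 3/4) \<le> y * y powr (- 3/4)"
      by (rule mult_right_mono) (auto simp: y_def)
    also have "\<dots> = y powr (1/4)" 
      using y powr_add[of y 1 "- 3/4"] by simp
    also have "\<dots> \<le> x powr (1/4)"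
      by (rule powr_mono2) (use y in \<open>auto simp: y_def\<close>)
    also have "\<dots> = x * x powr (- 3/4)"
      using x powr_add[of x 1 "- 3/4"] by simp
    finally show ?thesis using x by (simp add: field_simps)
  qed
  finally show ?thesis .
qed

section \<open>The arctangent integral with a complex parameter\<close>

lemma has_integral_inverse_1_plus_square:
  "((\<lambda>s::real. 1 / (1 + s\<^sup>2)) has_integral pi / 2) {0..}"
proof (rule has_integral_to_inf)
  have *: "((\<lambda>s::real. 1 / (1 + s\<^sup>2)) has_integral (arctan y - arctan 0)) {0..y}" if "0 \<le> y" for y
    by (rule fundamental_theorem_of_calculus[OF that])
       (auto intro!: derivative_eq_intros DERIV_arctan[THEN DERIV_subset] simp: field_simps
         simp flip: has_real_derivative_iff_has_vector_derivative)
  show "(\<lambda>s::real. 1 / (1 + s\<^sup>2)) integrable_on {0..y}" for y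
    using *[of y] by (cases "0 \<le> y") auto
  have "((\<lambda>y. arctan y) \<longlongrightarrow> pi / 2) at_top" by (rule tendsto_arctan_at_top)
  moreover have "\<forall>\<^sub>F y in at_top. arctan y = integral {0..y} (\<lambda>s::real. 1 / (1 + s\<^sup>2))"
    using eventually_ge_at_top[of 0] by eventually_elim (use * in \<open>force simp: integral_unique\<close>)
  ultimately show "((\<lambda>y. integral {0..y} (\<lambda>s::real. 1 / (1 + s\<^sup>2))) \<longlongrightarrow> pi / 2) at_top"
    by (rule Lim_transform_eventually)
qed (auto simp: add_pos_nonneg)

text \<open>Comparison with 1/(1 + s^2), the decay shared by the scalar and the matrix kernel of the
  square root.\<close>

lemma absolutely_integrable_Ici_by_decay:
  fixes f :: "real \<Rightarrow> complex"
  assumes "continuous_on {0..} f" and "\<And>s. 0 \<le> s \<Longrightarrow> cmod (f s) \<le> C / (1 + s\<^sup>2)"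
  shows "f absolutely_integrable_on {0..}"
proof (rule measurable_bounded_by_integrable_imp_absolutely_integrable)
  show "f \<in> borel_measurable (lebesgue_on {0..})"
    using assms(1) by (intro continuous_imp_measurable_on_sets_lebesgue) auto
  show "(\<lambda>s::real. C / (1 + s\<^sup>2)) integrable_on {0..}"
    using has_integral_mult_right[OF has_integral_inverse_1_plus_square, of C] by (auto simp: has_integral_iff)
qed (use assms in auto)

text \<open>The antiderivative is m arctan(s/m), written as a difference of logarithms. As s is
  real, m + is and m - is both keep the real part Re m > 0 and never meet the branch cut. The
  parameter is the root m rather than m^2, which makes the choice of the principal branch the
  condition Re m > 0.\<close>

lemma has_integral_sqrt_resolvent:
  fixes m :: complex
  assumes m: "0 < Re m" and c: "0 < c" "\<And>s::real. 0 \<le> s \<Longrightarrow> c * (1 + s\<^sup>2) \<le> cmod (of_real (s\<^sup>2) + m\<^sup>2)"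
  shows "((\<lambda>s. m\<^sup>2 / (of_real (s\<^sup>2) + m\<^sup>2)) has_integral (m * (pi / 2))) {0..}"
proof -
  let ?f = "\<lambda>s::real. m\<^sup>2 / (of_real (s\<^sup>2) + m\<^sup>2)"
  let ?F = "\<lambda>s::real. m / (2 * \<i>) * (Ln (m + \<i> * s) - Ln (m - \<i> * s))"
  have nz: "of_real (s\<^sup>2) + m\<^sup>2 \<noteq> 0" if "0 \<le> s" for s :: real
    using c(2)[OF that] c(1) by (smt (verit) mult_pos_pos norm_zero zero_le_power2)
  have int: "?f absolutely_integrable_on {0..}"
  proof (rule absolutely_integrable_Ici_by_decay)
    show "continuous_on {0..} ?f" using nz by (intro continuous_intros) auto
    show "cmod (?f s) \<le> (cmod (m\<^sup>2) / c) / (1 + s\<^sup>2)" if "0 \<le> s" for s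
    proof -
      have "0 < c * (1 + s\<^sup>2)" using c(1) by (simp add: add_pos_nonneg)
      then have "cmod (m\<^sup>2) / cmod (of_real (s\<^sup>2) + m\<^sup>2) \<le> cmod (m\<^sup>2) / (c * (1 + s\<^sup>2))"
        using c(2)[OF that] by (intro divide_left_mono) (auto intro!: mult_pos_pos)
      then show ?thesis by (simp add: norm_divide)
    qed
  qed
  have F: "(?f has_integral (?F y - ?F 0)) {0..y}" if "0 \<le> y" for y
  proof (rule fundamental_theorem_of_calculus[OF that])
    fix s assume s: "s \<in> {0..y}"
    have nz1: "m + \<i> * s \<noteq> 0" "m - \<i> * s \<noteq> 0"
      using m by (auto simp: complex_eq_iff)
    have ni: "m + \<i> * s \<notin> \<real>\<^sub>\<le>\<^sub>0" "m - \<i> * s \<notin> \<real>\<^sub>\<le>\<^sub>0"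
      using m by (auto simp: complex_nonpos_Reals_iff)
    have "((\<lambda>z. m / (2 * \<i>) * (Ln (m + \<i> * z) - Ln (m - \<i> * z))) has_field_derivative
        m / (2 * \<i>) * (\<i> / (m + \<i> * s) - (- \<i>) / (m - \<i> * s))) (at (of_real s))"
      using ni by (auto intro!: derivative_eq_intros simp: divide_simps)
    then have "(?F has_vector_derivative (m / (2 * \<i>) * (\<i> / (m + \<i> * s) - (- \<i>) / (m - \<i> * s)))) (at s within {0..y})"
      by (intro has_vector_derivative_real_field)
    moreover have "m / (2 * \<i>) * (\<i> / (m + \<i> * s) - (- \<i>) / (m - \<i> * s)) = ?f s"
    proof -
      have e: "(m + \<i> * s) * (m - \<i> * s) = of_real (s\<^sup>2) + m\<^sup>2"
        by (simp add: algebra_simps power2_eq_square)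
      have q: "\<i> / (m + \<i> * s) - (- \<i>) / (m - \<i> * s) = 2 * \<i> * m / ((m + \<i> * s) * (m - \<i> * s))"
        using nz1 by (simp add: divide_simps) (simp add: algebra_simps)
      show ?thesis unfolding q e by (simp add: power2_eq_square mult_ac)
    qed
    ultimately show "(?F has_vector_derivative ?f s) (at s within {0..y})" by simp
  qed
  have F_lim: "(?F \<longlongrightarrow> m * (pi / 2)) at_top"
  proof -
    \<comment> \<open>Pulling the positive factor s out of both logarithms cancels their growth;
      what is left tends to Ln i - Ln(-i) = i pi.\<close>
    have lim0: "((\<lambda>s::real. m / of_real s) \<longlongrightarrow> 0) at_top"
      by (rule tendsto_divide_0[OF tendsto_const]) (rule filterlim_of_real_at_infinity)
    have "((\<lambda>s. m / (2 * \<i>) * (Ln (m / of_real s + \<i>) - Ln (m / of_real s - \<i>))) \<longlongrightarrow>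
        m / (2 * \<i>) * (Ln (0 + \<i>) - Ln (0 - \<i>))) at_top"
      by (intro tendsto_intros lim0) (auto simp: complex_nonpos_Reals_iff)
    moreover have "\<forall>\<^sub>F s in at_top. m / (2 * \<i>) * (Ln (m / of_real s + \<i>) - Ln (m / of_real s - \<i>)) = ?F s"
      using eventually_gt_at_top[of 0]
    proof eventually_elim
      case (elim s)
      have e: "m + \<i> * s = of_real s * (m / of_real s + \<i>)" "m - \<i> * s = of_real s * (m / of_real s - \<i>)"
        using elim by (auto simp: algebra_simps)
      have nz: "m / of_real s + \<i> \<noteq> 0" "m / of_real s - \<i> \<noteq> 0"
        using m elim by (auto simp: complex_eq_iff)
      show ?case unfolding e Ln_times_of_real[OF elim nz(1)] Ln_times_of_real[OF elim nz(2)] by simp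
    qed
    ultimately have "(?F \<longlongrightarrow> m / (2 * \<i>) * (Ln (0 + \<i>) - Ln (0 - \<i>))) at_top"
      by (rule Lim_transform_eventually)
    also have "m / (2 * \<i>) * (Ln (0 + \<i>) - Ln (0 - \<i>)) = m * (pi / 2)"
      by (simp add: field_simps)
    finally show ?thesis .
  qed
  \<comment> \<open>Absolute integrability identifies the integral over the half-line with the limit
    of the truncated integrals, which the antiderivative evaluates.\<close>
  have "((\<lambda>y. set_lebesgue_integral lebesgue {0..y} ?f) \<longlongrightarrow> set_lebesgue_integral lebesgue {0..} ?f) at_top"
    by (rule tendsto_set_lebesgue_integral_at_top[OF _ int]) auto
  moreover have "\<forall>\<^sub>F y in at_top. set_lebesgue_integral lebesgue {0..y} ?f = ?F y"
    using eventually_ge_at_top[of 0]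
  proof eventually_elim
    case (elim y)
    have "?f absolutely_integrable_on {0..y}"
      by (rule set_integrable_subset[OF int]) auto
    then show ?case using F[OF elim]
      by (simp add: set_lebesgue_integral_eq_integral(2) integral_unique)
  qed
  ultimately have "(?F \<longlongrightarrow> set_lebesgue_integral lebesgue {0..} ?f) at_top"
    by (rule Lim_transform_eventually)
  then have "set_lebesgue_integral lebesgue {0..} ?f = m * (pi / 2)"
    using F_lim by (rule tendsto_unique[OF trivial_limit_at_top_linorder])
  then show ?thesis
    using set_lebesgue_integral_eq_integral[OF int] by (simp add: has_integral_iff)
qed

section \<open>The Beta integral behind the constant\<close>

text \<open>Substituting \<open>u = s\<^sup>4 / (a\<^sup>2 + s\<^sup>4)\<close> turns this into the Beta integral.\<close>
lemma has_integral_decay_kernel: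
  fixes a p :: real
  assumes a: "0 < a" and p: "3/4 < p"
  shows "((\<lambda>s. s\<^sup>2 * (1 + s ^ 4 / a\<^sup>2) powr (- p)) has_integral (a powr (3/2) / 4 * Beta (3/4) (p - 3/4))) {0..}"
proof -
  let ?D = "\<lambda>s::real. 1 + s ^ 4 / a\<^sup>2"
  let ?g = "\<lambda>s::real. 1 - 1 / ?D s"
  let ?g' = "\<lambda>s::real. 4 * s ^ 3 / a\<^sup>2 / (?D s)\<^sup>2"
  let ?f = "\<lambda>u::real. u powr (3/4 - 1) * (1 - u) powr ((p - 3/4) - 1)"
  have D: "1 < ?D s" if "0 < s" for s using that a by simp
  have img: "?g ` {0<..} = {0<..<1}"
  proof (intro equalityI subsetI)
    fix u assume "u \<in> ?g ` {0<..}"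
    then obtain s where "0 < s" "u = ?g s" by auto
    then show "u \<in> {0<..<1}" using D[of s] by simp
  next
    fix u :: real assume u: "u \<in> {0<..<1}"
    \<comment> \<open>The solution of u = s^4/(a^2 + s^4).\<close>
    define s where "s = (a\<^sup>2 * (u / (1 - u))) powr (1/4)"
    have pos: "0 < a\<^sup>2 * (u / (1 - u))" using u a by auto
    then have "0 < s" unfolding s_def powr_gt_zero by (rule less_imp_neq[THEN not_sym])
    then have "s ^ 4 = s powr 4" by simp
    also have "\<dots> = (a\<^sup>2 * (u / (1 - u))) powr (1/4 * 4)"
      unfolding s_def powr_powr ..
    also have "\<dots> = a\<^sup>2 * (u / (1 - u))"
      using powr_one[OF less_imp_le[OF pos]] by simp
    finally have "?D s = 1 / (1 - u)" using a u by (simp add: field_simps)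
    then have "?g s = u" using u by simp
    with \<open>0 < s\<close> show "u \<in> ?g ` {0<..}" by force
  qed
  have "(\<lambda>s. \<bar>?g' s\<bar> * ?f (?g s)) absolutely_integrable_on {0<..} \<and>
      integral {0<..} (\<lambda>s. \<bar>?g' s\<bar> * ?f (?g s)) = Beta (3/4) (p - 3/4)"
  proof (rule has_absolute_integral_change_of_variables_1'[where g = ?g and g' = ?g' and f = ?f, THEN iffD2])
    fix s :: real assume "s \<in> {0<..}"
    then have s: "0 < s" by simp
    then have "1 + s ^ 4 / (a * a) \<noteq> 0"
      using a by (intro less_imp_neq[THEN not_sym] add_pos_pos) auto
    then show "(?g has_field_derivative ?g' s) (at s within {0<..})"
      using s a by (auto intro!: derivative_eq_intros simp: power2_eq_square)
  next
    show "inj_on ?g {0<..}"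
    proof (rule inj_onI)
      fix x y :: real assume xy: "x \<in> {0<..}" "y \<in> {0<..}" "?g x = ?g y"
      then have "x ^ 4 = y ^ 4" using a D[of x] D[of y] by (auto simp: field_simps)
      then show "x = y" using xy by (auto dest: power_eq_imp_eq_base)
    qed
    have "(?f has_integral Beta (3/4) (p - 3/4)) {0<..<1}"
      using has_integral_Beta_real[of "3/4" "p - 3/4"] p by (simp add: has_integral_Icc_iff_Ioo)
    then show "?f absolutely_integrable_on ?g ` {0<..} \<and> integral (?g ` {0<..}) ?f = Beta (3/4) (p - 3/4)"
      unfolding img by (auto simp: has_integral_iff intro!: nonnegative_absolutely_integrable_1)
  qed auto
  then have "((\<lambda>s. \<bar>?g' s\<bar> * ?f (?g s)) has_integral Beta (3/4) (p - 3/4)) {0<..}"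
    using absolutely_integrable_on_def by (auto simp: has_integral_iff)
  then have "((\<lambda>s. a powr (3/2) / 4 * (\<bar>?g' s\<bar> * ?f (?g s))) has_integral a powr (3/2) / 4 * Beta (3/4) (p - 3/4)) {0<..}"
    by (rule has_integral_mult_right)
  moreover have "a powr (3/2) / 4 * (\<bar>?g' s\<bar> * ?f (?g s)) = s\<^sup>2 * (?D s) powr (- p)" if s: "s \<in> {0<..}" for s
  proof -
    have s0: "0 < s" and D0: "0 < ?D s" using s D[of s] by auto
    have g: "?g s = (s ^ 4 / a\<^sup>2) / ?D s" using D0 by (simp add: field_simps)
    have "(s ^ 4 / a\<^sup>2) powr (3/4 - 1) = a powr (1/2) / s"
      using s0 a by (simp add: powr_divide powr_powr flip: powr_numeral) (simp add: powr_minus divide_simps)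
    then have 1: "?g s powr (3/4 - 1) = a powr (1/2) / s * ?D s powr (1/4)"
      unfolding g using D0 s0 by (simp add: powr_divide powr_minus field_simps)
    have 2: "(1 - ?g s) powr ((p - 3/4) - 1) = ?D s powr (7/4 - p)"
      using D0 by (simp add: powr_divide flip: powr_minus_divide)
    have 3: "\<bar>?g' s\<bar> = 4 * s ^ 3 / a powr 2 * ?D s powr (- 2)"
      using s0 a D0 by (simp add: powr_minus field_simps)
    have 4: "?D s powr (- 2) * ?D s powr (1/4) * ?D s powr (7/4 - p) = ?D s powr (- p)"
      using D0 by (simp flip: powr_add)
    have 5: "a powr (3/2) * a powr (1/2) = a powr 2" by (simp flip: powr_add)
    have "a powr (3/2) / 4 * (\<bar>?g' s\<bar> * ?f (?g s)) =
        (a powr (3/2) * a powr (1/2)) / a powr 2 * (s ^ 3 / s) *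
        (?D s powr (- 2) * ?D s powr (1/4) * ?D s powr (7/4 - p))"
      unfolding 1 2 3 by simp
    also have "\<dots> = s\<^sup>2 * ?D s powr (- p)"
      unfolding 4 5 using a s0 by (simp add: power2_eq_square power3_eq_cube)
    finally show ?thesis .
  qed
  ultimately have "((\<lambda>s. s\<^sup>2 * ?D s powr (- p)) has_integral (a powr (3/2) / 4 * Beta (3/4) (p - 3/4))) {0<..}"
    by (rule has_integral_eq[rotated]) auto
  \<comment> \<open>The substitution ran over the open half-line to stay away from u = 0, where the
    Beta integrand is unbounded; the missing point 0 is a null set.\<close>
  then show ?thesis
    by (rule iffD1[OF has_integral_spike_set_eq, rotated 2])
       (auto intro!: negligible_subset[OF negligible_sing[of "0::real"]])
qed

text \<open>With x = k/2 the Beta value is \<Gamma>(3/4) \<Gamma>(x - 1/4)/\<Gamma>(x + 1/2), and k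
  \<ge> 2 becomes x \<ge> 1. The constant 2^(-1/4) is the prefactor 2/4 times the 2^(3/4) released
  by x^(-3/4) = 2^(3/4) k^(-3/4).\<close>

lemma decay_kernel_constant_le:
  fixes k :: nat and a :: real
  assumes k: "2 \<le> k" and a: "0 < a"
  shows "2 / pi * (a powr (3/2) / 4 * Beta (3/4) ((real k + 1) / 2 - 3/4))
    \<le> Gamma (3/4) / (2 powr (1/4) * pi) * (2 * real k / (2 * real k - 3)) * a powr (3/2) * real k powr (- 3/4)"
proof -
  define x where "x = real k / 2"
  have x: "1 \<le> x" and kx: "real k = 2 * x" using k by (auto simp: x_def)
  have "Beta (3/4) ((real k + 1) / 2 - 3/4) = Gamma (3/4) * (Gamma (x - 1/4) / Gamma (x + 1/2))"
    by (simp add: Beta_def kx add_divide_distrib algebra_simps)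
  also have "\<dots> \<le> Gamma (3/4) * (x powr (- 3/4) * (x / (x - 3/4)))"
    by (intro mult_left_mono Gamma_ratio_le x) (simp add: Gamma_real_nonneg)
  finally have "2 / pi * (a powr (3/2) / 4 * Beta (3/4) ((real k + 1) / 2 - 3/4))
      \<le> 2 / pi * (a powr (3/2) / 4 * (Gamma (3/4) * (x powr (- 3/4) * (x / (x - 3/4)))))"
    by (intro mult_left_mono) auto
  also have "\<dots> = Gamma (3/4) / (2 powr (1/4) * pi) * (2 * real k / (2 * real k - 3)) * a powr (3/2) * real k powr (- 3/4)"
  proof -
    have k1: "real k powr (- 3/4) = 2 powr (- 3/4) * x powr (- 3/4)"
      using x by (simp add: kx powr_mult)
    have k2: "2 * 2 powr (- 3/4) = (2::real) powr (1/4)"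
      using powr_add[of "2::real" 1 "- 3/4"] by simp
    have k3: "2 * real k / (2 * real k - 3) = x / (x - 3/4)"
      using x by (simp add: kx divide_simps)
    have "2 / pi * (A / 4 * (G * (X * R))) = G / (q * pi) * R * A * (p * X)"
      if "2 * p = q" "0 < p" for A G X R p q :: real
      using that by (simp add: field_simps flip: that(1))
    note scale = this[OF k2]
    show ?thesis unfolding k1 k3 by (rule scale) simp
  qed
  finally show ?thesis .
qed

section \<open>Resolvents on the negative axis\<close>

definition shift_mat :: "complex mat \<Rightarrow> real \<Rightarrow> complex mat" where
  "shift_mat N t = N + complex_of_real t \<cdot>\<^sub>m 1\<^sub>m (dim_row N)"

lemma shift_mat_carrier [simp, intro]: "N \<in> carrier_mat n n \<Longrightarrow> shift_mat N t \<in> carrier_mat n n"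
  by (auto simp: shift_mat_def)

lemma shift_mat_mult_vec:
  assumes N: "N \<in> carrier_mat n n" and v: "v \<in> carrier_vec n"
  shows "shift_mat N t *\<^sub>v v = N *\<^sub>v v + complex_of_real t \<cdot>\<^sub>v v"
proof -
  have "shift_mat N t *\<^sub>v v = N *\<^sub>v v + (complex_of_real t \<cdot>\<^sub>m 1\<^sub>m n) *\<^sub>v v"
    using add_mult_distrib_mat_vec[of N n n "complex_of_real t \<cdot>\<^sub>m 1\<^sub>m n" v] N v
    by (simp add: shift_mat_def)
  also have "(complex_of_real t \<cdot>\<^sub>m 1\<^sub>m n) *\<^sub>v v = complex_of_real t \<cdot>\<^sub>v v"
    using v by (intro eq_vecI) auto
  finally show ?thesis .
qed

abbreviation resolvent :: "complex mat \<Rightarrow> real \<Rightarrow> complex mat" where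
  "resolvent N t \<equiv> mat_inv (shift_mat N t)"

text \<open>Implied by positive-definiteness, and, unlike it, visibly stable under small perturbations.\<close>
definition sectorial :: "nat \<Rightarrow> real \<Rightarrow> complex mat \<Rightarrow> bool" where
  "sectorial n c N \<longleftrightarrow> N \<in> carrier_mat n n \<and> 0 < c \<and>
     (\<forall>t\<ge>0. \<forall>v\<in>carrier_vec n. c * (1 + t) * cvec_norm v \<le> cvec_norm (shift_mat N t *\<^sub>v v))"

lemma sectorialD:
  assumes "sectorial n c N"
  shows "N \<in> carrier_mat n n" "0 < c"
    "0 \<le> t \<Longrightarrow> v \<in> carrier_vec n \<Longrightarrow> c * (1 + t) * cvec_norm v \<le> cvec_norm (shift_mat N t *\<^sub>v v)"
  using assms by (auto simp: sectorial_def)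

text \<open>The lower bound makes \<open>shift_mat N t\<close> injective, hence
  \<open>mat_inv\<close> a true inverse; read at the solution of the shifted system, the same bound
  is the resolvent estimate.\<close>

lemma sectorial_resolvent:
  assumes N: "sectorial n c N" and t: "0 \<le> t"
  shows "resolvent N t \<in> carrier_mat n n"
    and "v \<in> carrier_vec n \<Longrightarrow> resolvent N t *\<^sub>v v \<in> carrier_vec n"
    and "v \<in> carrier_vec n \<Longrightarrow> shift_mat N t *\<^sub>v (resolvent N t *\<^sub>v v) = v"
    and "v \<in> carrier_vec n \<Longrightarrow> resolvent N t *\<^sub>v (shift_mat N t *\<^sub>v v) = v"
    and "v \<in> carrier_vec n \<Longrightarrow> cvec_norm (resolvent N t *\<^sub>v v) \<le> cvec_norm v / (c * (1 + t))"
proof -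
  note S = sectorialD[OF N]
  have pos: "0 < c * (1 + t)" using S(2) t by simp
  have inj: "v = 0\<^sub>v n" if v: "v \<in> carrier_vec n" "shift_mat N t *\<^sub>v v = 0\<^sub>v n" for v
  proof -
    have "c * (1 + t) * cvec_norm v \<le> 0" using S(3)[OF t v(1)] v(2) by simp
    then have "cvec_norm v \<le> 0" using mult_le_cancel_left_pos[OF pos, of "cvec_norm v" 0] by simp
    then have "cvec_norm v = 0" using cvec_norm_nonneg[of v] by linarith
    then show ?thesis using v(1) cvec_norm_eq_0_iff by blast
  qed
  show "resolvent N t \<in> carrier_mat n n"
    by (rule mat_inv(1)[OF _ inj]) (use S(1) in auto)
  note inv = mat_inv_mult_vec[OF shift_mat_carrier[OF S(1)] inj]
  show R: "resolvent N t *\<^sub>v v \<in> carrier_vec n" "shift_mat N t *\<^sub>v (resolvent N t *\<^sub>v v) = v"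
    "resolvent N t *\<^sub>v (shift_mat N t *\<^sub>v v) = v" if "v \<in> carrier_vec n" for v
    using inv[OF _ _ that] by auto
  assume v: "v \<in> carrier_vec n"
  have "c * (1 + t) * cvec_norm (resolvent N t *\<^sub>v v) \<le> cvec_norm v"
    using S(3)[OF t R(1)[OF v]] R(2)[OF v] by simp
  then show "cvec_norm (resolvent N t *\<^sub>v v) \<le> cvec_norm v / (c * (1 + t))"
    using pos by (simp add: pos_le_divide_eq mult.commute)
qed

text \<open>The second resolvent identity in norms: if A x = A' y = v, then A (x - y) = (A' - A) y.
  It serves both a change of the shift, for continuity, and a change of the matrix, for
  perturbation.\<close>

lemma resolvent_diff_bound:
  assumes N: "sectorial n c N" and N': "sectorial n d N'" and t: "0 \<le> t" "0 \<le> t'"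
    and v: "v \<in> carrier_vec n"
    and diff: "\<And>y. y \<in> carrier_vec n \<Longrightarrow>
      cvec_norm (shift_mat N' t' *\<^sub>v y - shift_mat N t *\<^sub>v y) \<le> e * cvec_norm y"
    and e: "0 \<le> e"
  shows "cvec_norm (resolvent N t *\<^sub>v v - resolvent N' t' *\<^sub>v v) \<le> e * cvec_norm v / (c * (1 + t) * (d * (1 + t')))"
proof -
  note R = sectorial_resolvent[OF N t(1)] and R' = sectorial_resolvent[OF N' t(2)]
  define x y where "x = resolvent N t *\<^sub>v v" and "y = resolvent N' t' *\<^sub>v v"
  have x: "x \<in> carrier_vec n" and y: "y \<in> carrier_vec n"
    using R(2) R'(2) v by (auto simp: x_def y_def)
  have pos: "0 < c * (1 + t)" using sectorialD(2)[OF N] t by simp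
  have "c * (1 + t) * cvec_norm (x - y) \<le> cvec_norm (shift_mat N t *\<^sub>v (x - y))"
    using x y by (intro sectorialD(3)[OF N t(1)]) auto
  also have "shift_mat N t *\<^sub>v (x - y) = shift_mat N t *\<^sub>v x - shift_mat N t *\<^sub>v y"
    using x y sectorialD(1)[OF N] by (intro mult_minus_distrib_mat_vec) auto
  also have "shift_mat N t *\<^sub>v x = shift_mat N' t' *\<^sub>v y"
    unfolding x_def y_def using R(3)[OF v] R'(3)[OF v] by simp
  also have "cvec_norm (shift_mat N' t' *\<^sub>v y - shift_mat N t *\<^sub>v y) \<le> e * cvec_norm y"
    by (rule diff[OF y])
  also have "\<dots> \<le> e * (cvec_norm v / (d * (1 + t')))"
    using R'(5)[OF v] e by (intro mult_left_mono) (auto simp: y_def)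
  finally have "cvec_norm (x - y) \<le> e * (cvec_norm v / (d * (1 + t'))) / (c * (1 + t))"
    by (simp only: pos_le_divide_eq[OF pos] mult.commute)
  then show ?thesis by (simp add: x_def y_def mult_ac)
qed

text \<open>The difference bound with N' = N; the Lipschitz constant is uniform on the half-line
  because 1 + t \<ge> 1.\<close>

lemma continuous_on_resolvent:
  assumes N: "sectorial n c N" and v: "v \<in> carrier_vec n" and w: "w \<in> carrier_vec n"
  shows "continuous_on {0..} (\<lambda>t. (resolvent N t *\<^sub>v v) \<bullet>c w)"
proof (rule lipschitz_on_continuous_on, rule lipschitz_onI)
  have c: "0 < c" by (rule sectorialD(2)[OF N])
  show "0 \<le> cvec_norm v / c\<^sup>2 * cvec_norm w" by simp
  fix t t' :: real assume "t \<in> {0..}" "t' \<in> {0..}"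
  then have t: "0 \<le> t" "0 \<le> t'" by auto
  note R = sectorial_resolvent[OF N t(1)] and R' = sectorial_resolvent[OF N t(2)]
  have "cvec_norm (resolvent N t *\<^sub>v v - resolvent N t' *\<^sub>v v)
      \<le> \<bar>t - t'\<bar> * cvec_norm v / (c * (1 + t) * (c * (1 + t')))"
  proof (rule resolvent_diff_bound[OF N N t v])
    fix y :: "complex vec" assume y: "y \<in> carrier_vec n"
    have "shift_mat N t' *\<^sub>v y - shift_mat N t *\<^sub>v y = complex_of_real (t' - t) \<cdot>\<^sub>v y"
      unfolding shift_mat_mult_vec[OF sectorialD(1)[OF N] y]
      using y sectorialD(1)[OF N] by (intro eq_vecI) (auto simp: algebra_simps)
    then show "cvec_norm (shift_mat N t' *\<^sub>v y - shift_mat N t *\<^sub>v y) \<le> \<bar>t - t'\<bar> * cvec_norm y"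
      by (simp add: cvec_norm_smult abs_minus_commute flip: of_real_diff)
  qed auto
  also have "\<dots> \<le> \<bar>t - t'\<bar> * cvec_norm v / c\<^sup>2"
  proof (rule divide_left_mono)
    have "c * c \<le> (c * (1 + t)) * (c * (1 + t'))"
      using c t by (intro mult_mono) auto
    then show "c\<^sup>2 \<le> (c * (1 + t)) * (c * (1 + t'))" by (simp add: power2_eq_square)
  qed (use c t in auto)
  finally have le: "cvec_norm (resolvent N t *\<^sub>v v - resolvent N t' *\<^sub>v v) \<le> \<bar>t - t'\<bar> * cvec_norm v / c\<^sup>2" .
  have "dist ((resolvent N t *\<^sub>v v) \<bullet>c w) ((resolvent N t' *\<^sub>v v) \<bullet>c w)
      = cmod ((resolvent N t *\<^sub>v v - resolvent N t' *\<^sub>v v) \<bullet>c w)"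
    using R(2)[OF v] R'(2)[OF v] w by (subst minus_scalar_prod_distrib[of _ n]) (auto simp: dist_norm)
  also have "\<dots> \<le> cvec_norm (resolvent N t *\<^sub>v v - resolvent N t' *\<^sub>v v) * cvec_norm w"
    using R(2)[OF v] R'(2)[OF v] w by (intro cscalar_Cauchy_Schwarz) auto
  also have "\<dots> \<le> \<bar>t - t'\<bar> * cvec_norm v / c\<^sup>2 * cvec_norm w"
    using le by (intro mult_right_mono) auto
  finally show "dist ((resolvent N t *\<^sub>v v) \<bullet>c w) ((resolvent N t' *\<^sub>v v) \<bullet>c w)
      \<le> cvec_norm v / c\<^sup>2 * cvec_norm w * dist t t'"
    by (simp add: dist_real_def mult_ac)
qed

section \<open>The matrix integral for the square root, in weak form\<close>

text \<open>The substitution \<open>t = s\<^sup>2\<close> removes the singularity of the usual weight \<open>t\<^sup>-\<^sup>1\<^sup>/\<^sup>2\<close> at \<open>0\<close>.\<close>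
definition sqrt_kernel :: "complex mat \<Rightarrow> real \<Rightarrow> complex mat" where
  "sqrt_kernel N s = N * resolvent N (s\<^sup>2)"

text \<open>Integrated entry by entry to obtain an actual matrix;
  \<open>sqrt_int_has_integral\<close> recovers the integral against arbitrary pairs of vectors, and
  the later arguments use that form.\<close>

definition sqrt_int :: "complex mat \<Rightarrow> complex mat" where
  "sqrt_int N = mat (dim_row N) (dim_row N)
     (\<lambda>(i, j). complex_of_real (2 / pi) * integral {0..} (\<lambda>s. sqrt_kernel N s $$ (i, j)))"

lemma sqrt_int_carrier [simp, intro]: "N \<in> carrier_mat n n \<Longrightarrow> sqrt_int N \<in> carrier_mat n n"
  by (auto simp: sqrt_int_def)

context
  fixes n :: nat and c :: real and N :: "complex mat"
  assumes N: "sectorial n c N"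
begin

lemma sqrt_kernel_carrier: "sqrt_kernel N s \<in> carrier_mat n n"
  using sectorialD(1)[OF N] sectorial_resolvent(1)[OF N, of "s\<^sup>2"] by (simp add: sqrt_kernel_def)

text \<open>The first form shows the decay in s. In the second form v drops out of differences of
  kernels, which drives both the perturbation bound and the Arnoldi error formula.\<close>

lemma sqrt_kernel_mult_vec:
  assumes v: "v \<in> carrier_vec n"
  shows "sqrt_kernel N s *\<^sub>v v = N *\<^sub>v (resolvent N (s\<^sup>2) *\<^sub>v v)"
    and "sqrt_kernel N s *\<^sub>v v = v - complex_of_real (s\<^sup>2) \<cdot>\<^sub>v (resolvent N (s\<^sup>2) *\<^sub>v v)"
proof -
  note R = sectorial_resolvent[OF N, of "s\<^sup>2", simplified]
  show 1: "sqrt_kernel N s *\<^sub>v v = N *\<^sub>v (resolvent N (s\<^sup>2) *\<^sub>v v)"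
    unfolding sqrt_kernel_def using sectorialD(1)[OF N] R(1) v by (intro assoc_mult_mat_vec)
  have "v = N *\<^sub>v (resolvent N (s\<^sup>2) *\<^sub>v v) + complex_of_real (s\<^sup>2) \<cdot>\<^sub>v (resolvent N (s\<^sup>2) *\<^sub>v v)"
    using R(3)[OF v] unfolding shift_mat_mult_vec[OF sectorialD(1)[OF N] R(2)[OF v]] by simp
  moreover have "x = y - z" if "y = x + z" "x \<in> carrier_vec n" "z \<in> carrier_vec n" for x y z :: "complex vec"
    using that by auto
  ultimately show "sqrt_kernel N s *\<^sub>v v = v - complex_of_real (s\<^sup>2) \<cdot>\<^sub>v (resolvent N (s\<^sup>2) *\<^sub>v v)"
    unfolding 1 using sectorialD(1)[OF N] R(2)[OF v] by (metis mult_mat_vec_carrier smult_carrier_vec)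
qed

lemma sqrt_kernel_norm_le:
  assumes v: "v \<in> carrier_vec n" and K: "\<And>y. y \<in> carrier_vec n \<Longrightarrow> cvec_norm (N *\<^sub>v y) \<le> K * cvec_norm y"
    and "0 \<le> K"
  shows "cvec_norm (sqrt_kernel N s *\<^sub>v v) \<le> K * cvec_norm v / c / (1 + s\<^sup>2)"
proof -
  note R = sectorial_resolvent[OF N, of "s\<^sup>2", simplified]
  have "cvec_norm (sqrt_kernel N s *\<^sub>v v) \<le> K * cvec_norm (resolvent N (s\<^sup>2) *\<^sub>v v)"
    unfolding sqrt_kernel_mult_vec(1)[OF v] by (rule K[OF R(2)[OF v]])
  also have "\<dots> \<le> K * (cvec_norm v / (c * (1 + s\<^sup>2)))"
    using R(5)[OF v] \<open>0 \<le> K\<close> by (rule mult_left_mono)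
  finally show ?thesis by simp
qed

lemma sqrt_kernel_integrable:
  assumes v: "v \<in> carrier_vec n" and w: "w \<in> carrier_vec n"
  shows "(\<lambda>s. (sqrt_kernel N s *\<^sub>v v) \<bullet>c w) absolutely_integrable_on {0..}"
    and "continuous_on {0..} (\<lambda>s. (sqrt_kernel N s *\<^sub>v v) \<bullet>c w)"
proof -
  \<comment> \<open>Moving N to the other side of the pairing reduces continuity of the kernel to
    that of the resolvent.\<close>
  have eq: "(sqrt_kernel N s *\<^sub>v v) \<bullet>c w = (resolvent N (s\<^sup>2) *\<^sub>v v) \<bullet>c (mat_adjoint N *\<^sub>v w)" for s
    unfolding sqrt_kernel_mult_vec(1)[OF v]
    using sectorialD(1)[OF N] sectorial_resolvent(2)[OF N _ v] w by (intro cscalar_mat_adjoint) auto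
  have "mat_adjoint N *\<^sub>v w \<in> carrier_vec n"
    using sectorialD(1)[OF N] w by (intro mult_mat_vec_carrier) auto
  then have "continuous_on {0..} (\<lambda>t. (resolvent N t *\<^sub>v v) \<bullet>c (mat_adjoint N *\<^sub>v w))"
    by (rule continuous_on_resolvent[OF N v])
  then show cont: "continuous_on {0..} (\<lambda>s. (sqrt_kernel N s *\<^sub>v v) \<bullet>c w)"
    unfolding eq by (rule continuous_on_compose2) (auto intro!: continuous_intros)
  obtain K where K: "0 \<le> K" "\<And>y. y \<in> carrier_vec n \<Longrightarrow> cvec_norm (N *\<^sub>v y) \<le> K * cvec_norm y"
    using mat_vec_norm_bounded[OF sectorialD(1)[OF N]] by blast
  show "(\<lambda>s. (sqrt_kernel N s *\<^sub>v v) \<bullet>c w) absolutely_integrable_on {0..}"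
  proof (rule absolutely_integrable_Ici_by_decay[OF cont])
    fix s :: real
    have "cmod ((sqrt_kernel N s *\<^sub>v v) \<bullet>c w) \<le> cvec_norm (sqrt_kernel N s *\<^sub>v v) * cvec_norm w"
      using mult_mat_vec_carrier[OF sqrt_kernel_carrier v] w by (rule cscalar_Cauchy_Schwarz)
    also have "\<dots> \<le> (K * cvec_norm v / c / (1 + s\<^sup>2)) * cvec_norm w"
      by (intro mult_right_mono sqrt_kernel_norm_le v K) auto
    finally show "cmod ((sqrt_kernel N s *\<^sub>v v) \<bullet>c w) \<le> (K * cvec_norm v / c * cvec_norm w) / (1 + s\<^sup>2)"
      by simp
  qed
qed

lemma sqrt_int_has_integral:
  assumes v: "v \<in> carrier_vec n" and w: "w \<in> carrier_vec n"
  shows "((\<lambda>s. (sqrt_kernel N s *\<^sub>v v) \<bullet>c w) has_integral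
    complex_of_real (pi / 2) * ((sqrt_int N *\<^sub>v v) \<bullet>c w)) {0..}"
proof -
  have dbl: "(A *\<^sub>v v) \<bullet>c w = (\<Sum>i<n. \<Sum>j<n. A $$ (i, j) * (v $ j * cnj (w $ i)))"
    if "A \<in> carrier_mat n n" for A :: "complex mat"
    using that v w by (auto simp: scalar_prod_def lessThan_atLeast0 sum_distrib_right conjugate_complex_def
        mult.assoc intro!: sum.cong)
  have entry: "((\<lambda>s. sqrt_kernel N s $$ (i, j)) has_integral
      complex_of_real (pi / 2) * sqrt_int N $$ (i, j)) {0..}" if ij: "i < n" "j < n" for i j
  proof -
    have "sqrt_kernel N s $$ (i, j) = (sqrt_kernel N s *\<^sub>v unit_vec n j) \<bullet>c unit_vec n i" for s
    proof -
      have "conjugate (unit_vec n i) = (unit_vec n i :: complex vec)"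
        by (intro eq_vecI) (auto simp: unit_vec_def)
      then show ?thesis using sqrt_kernel_carrier[of s] ij by simp
    qed
    then have "(\<lambda>s. sqrt_kernel N s $$ (i, j)) integrable_on {0..}"
      using sqrt_kernel_integrable(1)[of "unit_vec n j" "unit_vec n i"]
      by (simp add: absolutely_integrable_on_def)
    then show ?thesis
      using sectorialD(1)[OF N] ij by (simp add: sqrt_int_def has_integral_integral[symmetric])
  qed
  have "((\<lambda>s. \<Sum>i<n. \<Sum>j<n. sqrt_kernel N s $$ (i, j) * (v $ j * cnj (w $ i))) has_integral
      (\<Sum>i<n. \<Sum>j<n. complex_of_real (pi / 2) * sqrt_int N $$ (i, j) * (v $ j * cnj (w $ i)))) {0..}"
    by (intro has_integral_sum has_integral_mult_left entry) auto
  then show ?thesis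
    using sectorialD(1)[OF N] by (simp add: dbl sqrt_kernel_carrier sum_distrib_left mult.assoc)
qed

end

section \<open>The square root of a positive-definite matrix\<close>

lemma cvec_norm_add_power2:
  assumes v: "v \<in> carrier_vec n" and w: "w \<in> carrier_vec n"
  shows "(cvec_norm (v + w))\<^sup>2 = (cvec_norm v)\<^sup>2 + 2 * Re (v \<bullet>c w) + (cvec_norm w)\<^sup>2"
proof -
  have "complex_of_real ((cvec_norm (v + w))\<^sup>2) = (v + w) \<bullet>c (v + w)"
    by (simp add: cscalar_self)
  also have "\<dots> = v \<bullet>c v + w \<bullet>c v + (v \<bullet>c w + w \<bullet>c w)"
    using v w by (simp add: conjugate_add_vec[OF v w] scalar_prod_add_distrib[of _ n] add_scalar_prod_distrib[of _ n])
  also have "w \<bullet>c v = cnj (v \<bullet>c w)" by (rule cscalar_commute[OF v w])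
  finally have "Re (complex_of_real ((cvec_norm (v + w))\<^sup>2)) =
      Re (v \<bullet>c v + cnj (v \<bullet>c w) + (v \<bullet>c w + w \<bullet>c w))" by simp
  then show ?thesis by (simp add: cscalar_self del: of_real_power)
qed

lemma eq_vec_by_pairing:
  fixes x y :: "complex vec"
  assumes x: "x \<in> carrier_vec n" and y: "y \<in> carrier_vec n"
    and eq: "\<And>w. w \<in> carrier_vec n \<Longrightarrow> x \<bullet>c w = y \<bullet>c w"
  shows "x = y"
proof -
  have "(x - y) \<bullet>c (x - y) = 0"
    using x y eq[of "x - y"] by (simp add: minus_scalar_prod_distrib[of _ n])
  then have "x - y = 0\<^sub>v n" using x y by (subst (asm) conjugate_square_eq_0_vec[of _ n]) auto
  then show ?thesis by (rule vec_eq_if_diff_zero[OF x y])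
qed

lemma mult_mat_vec_diff:
  fixes A :: "complex mat"
  assumes "A \<in> carrier_mat n m" "v \<in> carrier_vec m" "w \<in> carrier_vec m"
  shows "A *\<^sub>v (v - w) = A *\<^sub>v v - A *\<^sub>v w"
  using assms by (rule mult_minus_distrib_mat_vec)

lemma complex_schur:
  fixes A :: "complex mat"
  assumes A: "A \<in> carrier_mat n n"
  obtains B P Q where "B \<in> carrier_mat n n" "P \<in> carrier_mat n n" "Q \<in> carrier_mat n n"
    "P * Q = 1\<^sub>m n" "Q * P = 1\<^sub>m n" "A = P * B * Q" "upper_triangular B"
    "\<And>i. i < n \<Longrightarrow> eigenvalue A (B $$ (i, i))"
proof -
  obtain es where es: "char_poly A = (\<Prod>a\<leftarrow>es. [:- a, 1:])" "length es = n"
    using char_poly_factorized[OF A] by blast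
  obtain B P Q where s: "schur_decomposition A es = (B, P, Q)"
    by (cases "schur_decomposition A es") auto
  note S = schur_decomposition[OF A es(1) s]
  then have sim: "similar_mat_wit A B P Q" and ut: "upper_triangular B" and dm: "diag_mat B = es" by auto
  note W = similar_mat_witD2[OF A sim]
  have "eigenvalue A (B $$ (i, i))" if i: "i < n" for i
  proof -
    have "B $$ (i, i) \<in> set es"
      using i W unfolding dm[symmetric] diag_mat_def by auto
    then show ?thesis
      unfolding eigenvalue_root_char_poly[OF A] es(1) by (auto simp: poly_prod_list prod_list_zero_iff)
  qed
  with that W ut show thesis by blast
qed

section \<open>Lower bounds from positive-definiteness\<close>

text \<open>Scaling by 1/||x|| reaches the unit vectors that \<open>pos_def\<close> tests and
  multiplies the form by a positive number.\<close>

lemma pos_defD: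
  assumes M: "M \<in> carrier_mat n n" and pd: "pos_def M" and x: "x \<in> carrier_vec n" "x \<noteq> 0\<^sub>v n"
  shows "0 < Re ((M *\<^sub>v x) \<bullet>c x)"
proof -
  have pos: "0 < cvec_norm x" using x cvec_norm_eq_0_iff[OF x(1)] cvec_norm_nonneg[of x] by linarith
  define c where "c = complex_of_real (1 / cvec_norm x)"
  have cc: "c * cnj c = complex_of_real (1 / (cvec_norm x)\<^sup>2)"
    by (simp add: c_def power2_eq_square)
  have "cvec_norm (c \<cdot>\<^sub>v x) = 1" using pos by (simp add: cvec_norm_smult c_def norm_divide)
  moreover have "c \<cdot>\<^sub>v x \<in> carrier_vec (dim_row M)" using x M by auto
  ultimately have "0 < Re ((M *\<^sub>v (c \<cdot>\<^sub>v x)) \<bullet>c (c \<cdot>\<^sub>v x))"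
    using pd unfolding pos_def_def by blast
  also have "(M *\<^sub>v (c \<cdot>\<^sub>v x)) \<bullet>c (c \<cdot>\<^sub>v x) = (c * cnj c) * ((M *\<^sub>v x) \<bullet>c x)"
    using x M by (simp add: mult_mat_vec[OF M x(1)] conjugate_smult_vec conjugate_complex_def)
  finally show ?thesis using pos unfolding cc by (simp add: zero_less_divide_iff)
qed

lemma pos_def_Re_nonneg:
  assumes "M \<in> carrier_mat n n" "pos_def M" "x \<in> carrier_vec n"
  shows "0 \<le> Re ((M *\<^sub>v x) \<bullet>c x)"
proof (cases "x = 0\<^sub>v n")
  case True
  then have "conjugate x = 0\<^sub>v n" by simp
  then show ?thesis using assms by simp
qed (use pos_defD[OF assms] in simp)

text \<open>In the expanded square the cross term 2t Re(Mx, x) is nonnegative. This is where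
  positive-definiteness enters the resolvent estimates.\<close>

lemma pos_def_shift_norm:
  assumes M: "M \<in> carrier_mat n n" and pd: "pos_def M" and x: "x \<in> carrier_vec n" and t: "0 \<le> t"
  shows "(cvec_norm (M *\<^sub>v x))\<^sup>2 + t\<^sup>2 * (cvec_norm x)\<^sup>2 \<le> (cvec_norm (shift_mat M t *\<^sub>v x))\<^sup>2"
proof -
  have "(M *\<^sub>v x) \<bullet>c (complex_of_real t \<cdot>\<^sub>v x) = complex_of_real t * ((M *\<^sub>v x) \<bullet>c x)"
    using M x by (simp add: conjugate_smult_vec conjugate_complex_def)
  then have "(cvec_norm (shift_mat M t *\<^sub>v x))\<^sup>2 =
      (cvec_norm (M *\<^sub>v x))\<^sup>2 + 2 * (t * Re ((M *\<^sub>v x) \<bullet>c x)) + t\<^sup>2 * (cvec_norm x)\<^sup>2"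
    using M x cvec_norm_add_power2[of "M *\<^sub>v x" n "complex_of_real t \<cdot>\<^sub>v x"]
    by (simp add: shift_mat_mult_vec cvec_norm_smult power_mult_distrib)
  then show ?thesis using pos_def_Re_nonneg[OF M pd x] t by simp
qed

lemma pos_def_inj:
  assumes M: "M \<in> carrier_mat n n" and pd: "pos_def M" and x: "x \<in> carrier_vec n" "M *\<^sub>v x = 0\<^sub>v n"
  shows "x = 0\<^sub>v n"
proof (rule ccontr)
  assume "x \<noteq> 0\<^sub>v n"
  from pos_defD[OF M pd x(1) this] show False using x by simp
qed

text \<open>Boundedness of the inverse gives ||Mx|| \<ge> m ||x||; with
  \<open>pos_def_shift_norm\<close> the squared norm of (M + t)x is at least m^2 (1 + t^2) ||x||^2,
  and 1 + t^2 \<ge> ((1 + t)/2)^2.\<close>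

lemma pos_def_sectorial:
  assumes M: "M \<in> carrier_mat n n" and pd: "pos_def M"
  obtains c where "sectorial n c M"
proof -
  note inj = pos_def_inj[OF M pd]
  obtain K where K: "0 \<le> K" "\<And>v. v \<in> carrier_vec n \<Longrightarrow> cvec_norm (mat_inv M *\<^sub>v v) \<le> K * cvec_norm v"
    using mat_vec_norm_bounded[OF mat_inv(1)[OF M inj]] by blast
  \<comment> \<open>Capped at 1 so that m may scale the t-term as well; K + 1 keeps the quotient
    finite when K = 0.\<close>
  define m where "m = min 1 (1 / (K + 1))"
  have m: "0 < m" "m \<le> 1" "m * (K + 1) \<le> 1"
    using K(1) by (auto simp: m_def min_def field_simps)
  have "m / 2 * (1 + t) * cvec_norm x \<le> cvec_norm (shift_mat M t *\<^sub>v x)"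
    if t: "0 \<le> t" and x: "x \<in> carrier_vec n" for t x
  proof (rule power2_le_imp_le)
    have "cvec_norm x \<le> K * cvec_norm (M *\<^sub>v x)"
      using K(2)[of "M *\<^sub>v x"] mat_inv_mult_vec(3)[OF M inj x] M x by simp
    then have "m * cvec_norm x \<le> m * (K * cvec_norm (M *\<^sub>v x))"
      using m by (intro mult_left_mono) auto
    also have "\<dots> = (m * K) * cvec_norm (M *\<^sub>v x)" by simp
    also have "\<dots> \<le> 1 * cvec_norm (M *\<^sub>v x)"
      using m by (intro mult_right_mono) (auto simp: algebra_simps)
    finally have 1: "(m * cvec_norm x)\<^sup>2 \<le> (cvec_norm (M *\<^sub>v x))\<^sup>2"
      using m by (intro power_mono) auto
    have "(m * (t * cvec_norm x))\<^sup>2 \<le> (1 * (t * cvec_norm x))\<^sup>2"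
      using m t by (intro power_mono mult_right_mono) auto
    then have 2: "(m * (t * cvec_norm x))\<^sup>2 \<le> t\<^sup>2 * (cvec_norm x)\<^sup>2" by (simp add: power_mult_distrib)
    have "(m / 2 * (1 + t) * cvec_norm x)\<^sup>2 = ((m * cvec_norm x + m * (t * cvec_norm x)) / 2)\<^sup>2"
      by (simp add: algebra_simps add_divide_distrib)
    also have "\<dots> \<le> (m * cvec_norm x)\<^sup>2 + (m * (t * cvec_norm x))\<^sup>2"
    proof -
      have "((a + b) / 2)\<^sup>2 \<le> a\<^sup>2 + b\<^sup>2" for a b :: real
      proof -
        have "0 \<le> (a - b)\<^sup>2 + 2 * a\<^sup>2 + 2 * b\<^sup>2" by simp
        then show ?thesis by (simp add: power2_eq_square field_simps)
      qed
      then show ?thesis .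
    qed
    also have "\<dots> \<le> (cvec_norm (shift_mat M t *\<^sub>v x))\<^sup>2"
      using 1 2 pos_def_shift_norm[OF M pd x t] by linarith
    finally show "(m / 2 * (1 + t) * cvec_norm x)\<^sup>2 \<le> (cvec_norm (shift_mat M t *\<^sub>v x))\<^sup>2" .
  qed simp
  then have "sectorial n (m / 2) M" using M m by (auto simp: sectorial_def)
  then show thesis by (rule that)
qed

section \<open>Stability of the matrix integral under perturbation\<close>

lemma has_integral_cmod_le:
  fixes f :: "real \<Rightarrow> complex"
  assumes "(f has_integral I) S" "(g has_integral J) S" "\<And>s. s \<in> S \<Longrightarrow> cmod (f s) \<le> g s"
  shows "cmod I \<le> J"
  using assms integral_norm_bound_integral[of f S g] by (auto simp: has_integral_iff)

lemma cmod_pi_half_mult_le: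
  assumes "cmod (complex_of_real (pi / 2) * z) \<le> C * (pi / 2)"
  shows "cmod z \<le> C"
proof -
  have "pi / 2 * cmod z \<le> pi / 2 * C"
    using assms unfolding norm_mult norm_of_real by (simp add: mult.commute)
  then show ?thesis by (subst (asm) mult_le_cancel_left_pos) auto
qed

text \<open>The kernel is at most a multiple of 1/(1 + s^2), whose integral pi/2 cancels the
  prefactor 2/pi.\<close>

lemma sqrt_int_norm_le:
  assumes N: "sectorial n c N" and v: "v \<in> carrier_vec n"
    and K: "\<And>y. y \<in> carrier_vec n \<Longrightarrow> cvec_norm (N *\<^sub>v y) \<le> K * cvec_norm y" "0 \<le> K"
  shows "cvec_norm (sqrt_int N *\<^sub>v v) \<le> K / c * cvec_norm v"
proof (rule cvec_norm_le_by_pairing)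
  show X: "sqrt_int N *\<^sub>v v \<in> carrier_vec n"
    using sqrt_int_carrier[OF sectorialD(1)[OF N]] v by (rule mult_mat_vec_carrier)
  show "0 \<le> K / c * cvec_norm v" using K(2) sectorialD(2)[OF N] by simp
  fix w :: "complex vec" assume w: "w \<in> carrier_vec n"
  let ?C = "K * cvec_norm v / c * cvec_norm w"
  have "cmod (complex_of_real (pi / 2) * ((sqrt_int N *\<^sub>v v) \<bullet>c w)) \<le> ?C * (pi / 2)"
  proof (rule has_integral_cmod_le[OF sqrt_int_has_integral[OF N v w]])
    show "((\<lambda>s. ?C * (1 / (1 + s\<^sup>2))) has_integral (?C * (pi / 2))) {0..}"
      by (rule has_integral_mult_right[OF has_integral_inverse_1_plus_square])
    fix s :: real
    have "cmod ((sqrt_kernel N s *\<^sub>v v) \<bullet>c w) \<le> cvec_norm (sqrt_kernel N s *\<^sub>v v) * cvec_norm w"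
      using mult_mat_vec_carrier[OF sqrt_kernel_carrier[OF N] v] w by (rule cscalar_Cauchy_Schwarz)
    also have "\<dots> \<le> (K * cvec_norm v / c / (1 + s\<^sup>2)) * cvec_norm w"
      by (intro mult_right_mono sqrt_kernel_norm_le[OF N] v K) auto
    finally show "cmod ((sqrt_kernel N s *\<^sub>v v) \<bullet>c w) \<le> ?C * (1 / (1 + s\<^sup>2))" by simp
  qed
  from cmod_pi_half_mult_le[OF this]
  show "cmod ((sqrt_int N *\<^sub>v v) \<bullet>c w) \<le> K / c * cvec_norm v * cvec_norm w" by simp
qed

text \<open>The kernels differ by s^2 times a difference of resolvents, of size s^2/(1 + s^2)^2: one
  factor 1 + s^2 absorbs s^2, the other keeps the bound integrable. The constant depends on the two
  matrices only through their common c, as a limit argument requires.\<close>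

lemma sqrt_int_diff_norm_le:
  assumes N: "sectorial n c N" and N': "sectorial n c N'" and v: "v \<in> carrier_vec n"
    and e: "\<And>y. y \<in> carrier_vec n \<Longrightarrow> cvec_norm (N' *\<^sub>v y - N *\<^sub>v y) \<le> e * cvec_norm y" "0 \<le> e"
  shows "cvec_norm (sqrt_int N *\<^sub>v v - sqrt_int N' *\<^sub>v v) \<le> e / c\<^sup>2 * cvec_norm v"
proof (rule cvec_norm_le_by_pairing)
  have X: "sqrt_int N *\<^sub>v v \<in> carrier_vec n" "sqrt_int N' *\<^sub>v v \<in> carrier_vec n"
    using sqrt_int_carrier[OF sectorialD(1)[OF N]] sqrt_int_carrier[OF sectorialD(1)[OF N']] v
    by (auto intro: mult_mat_vec_carrier)
  then show "sqrt_int N *\<^sub>v v - sqrt_int N' *\<^sub>v v \<in> carrier_vec n" by simp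
  have c: "0 < c" by (rule sectorialD(2)[OF N])
  show "0 \<le> e / c\<^sup>2 * cvec_norm v" using e(2) by simp
  fix w :: "complex vec" assume w: "w \<in> carrier_vec n"
  let ?C = "e * cvec_norm v / c\<^sup>2 * cvec_norm w"
  have "cmod (complex_of_real (pi / 2) * ((sqrt_int N *\<^sub>v v) \<bullet>c w)
      - complex_of_real (pi / 2) * ((sqrt_int N' *\<^sub>v v) \<bullet>c w)) \<le> ?C * (pi / 2)"
  proof (rule has_integral_cmod_le[OF has_integral_diff[OF sqrt_int_has_integral[OF N v w] sqrt_int_has_integral[OF N' v w]]])
    show "((\<lambda>s. ?C * (1 / (1 + s\<^sup>2))) has_integral (?C * (pi / 2))) {0..}"
      by (rule has_integral_mult_right[OF has_integral_inverse_1_plus_square])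
    fix s :: real
    note R = sectorial_resolvent[OF N, of "s\<^sup>2", simplified] and R' = sectorial_resolvent[OF N', of "s\<^sup>2", simplified]
    let ?d = "resolvent N (s\<^sup>2) *\<^sub>v v - resolvent N' (s\<^sup>2) *\<^sub>v v"
    have diff: "(v - a \<cdot>\<^sub>v x) - (v - a \<cdot>\<^sub>v y) = - a \<cdot>\<^sub>v (x - y)"
      if "x \<in> carrier_vec n" "y \<in> carrier_vec n" for a x y
      using v that by (intro eq_vecI) (auto simp: algebra_simps)
    have "sqrt_kernel N s *\<^sub>v v - sqrt_kernel N' s *\<^sub>v v = - complex_of_real (s\<^sup>2) \<cdot>\<^sub>v ?d"
      unfolding sqrt_kernel_mult_vec(2)[OF N v] sqrt_kernel_mult_vec(2)[OF N' v]
      using R(2)[OF v] R'(2)[OF v] by (rule diff)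
    then have "cvec_norm (sqrt_kernel N s *\<^sub>v v - sqrt_kernel N' s *\<^sub>v v) = s\<^sup>2 * cvec_norm ?d"
      by (simp add: cvec_norm_smult norm_power)
    also have "\<dots> \<le> s\<^sup>2 * (e * cvec_norm v / (c * (1 + s\<^sup>2) * (c * (1 + s\<^sup>2))))"
    proof (intro mult_left_mono resolvent_diff_bound[OF N N' _ _ v])
      fix y :: "complex vec" assume y: "y \<in> carrier_vec n"
      have "shift_mat N' (s\<^sup>2) *\<^sub>v y - shift_mat N (s\<^sup>2) *\<^sub>v y = N' *\<^sub>v y - N *\<^sub>v y"
        unfolding shift_mat_mult_vec[OF sectorialD(1)[OF N] y] shift_mat_mult_vec[OF sectorialD(1)[OF N'] y]
        using y sectorialD(1)[OF N] sectorialD(1)[OF N'] by (intro eq_vecI) auto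
      then show "cvec_norm (shift_mat N' (s\<^sup>2) *\<^sub>v y - shift_mat N (s\<^sup>2) *\<^sub>v y) \<le> e * cvec_norm y"
        using e(1)[OF y] by simp
    qed (use e in auto)
    also have "\<dots> = (e * cvec_norm v / c\<^sup>2) * (s\<^sup>2 / (1 + s\<^sup>2) * (1 / (1 + s\<^sup>2)))"
      by (simp add: power2_eq_square mult_ac)
    also have "\<dots> \<le> (e * cvec_norm v / c\<^sup>2) * (1 * (1 / (1 + s\<^sup>2)))"
      using e(2) by (intro mult_left_mono mult_right_mono) (auto simp: divide_le_eq_1 add_pos_nonneg)
    finally have "cvec_norm (sqrt_kernel N s *\<^sub>v v - sqrt_kernel N' s *\<^sub>v v)
        \<le> e * cvec_norm v / c\<^sup>2 / (1 + s\<^sup>2)" by simp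
    note le = this
    have kc: "sqrt_kernel N s *\<^sub>v v \<in> carrier_vec n" "sqrt_kernel N' s *\<^sub>v v \<in> carrier_vec n"
      using mult_mat_vec_carrier[OF sqrt_kernel_carrier[OF N] v] mult_mat_vec_carrier[OF sqrt_kernel_carrier[OF N'] v] .
    have "cmod ((sqrt_kernel N s *\<^sub>v v) \<bullet>c w - (sqrt_kernel N' s *\<^sub>v v) \<bullet>c w)
        = cmod ((sqrt_kernel N s *\<^sub>v v - sqrt_kernel N' s *\<^sub>v v) \<bullet>c w)"
      using kc w by (subst minus_scalar_prod_distrib[of _ n]) auto
    also have "\<dots> \<le> cvec_norm (sqrt_kernel N s *\<^sub>v v - sqrt_kernel N' s *\<^sub>v v) * cvec_norm w"
      using kc w by (intro cscalar_Cauchy_Schwarz) auto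
    also have "\<dots> \<le> (e * cvec_norm v / c\<^sup>2 / (1 + s\<^sup>2)) * cvec_norm w"
      using le by (rule mult_right_mono) simp
    finally show "cmod ((sqrt_kernel N s *\<^sub>v v) \<bullet>c w - (sqrt_kernel N' s *\<^sub>v v) \<bullet>c w) \<le> ?C * (1 / (1 + s\<^sup>2))"
      by simp
  qed
  also have "complex_of_real (pi / 2) * ((sqrt_int N *\<^sub>v v) \<bullet>c w)
      - complex_of_real (pi / 2) * ((sqrt_int N' *\<^sub>v v) \<bullet>c w)
      = complex_of_real (pi / 2) * ((sqrt_int N *\<^sub>v v - sqrt_int N' *\<^sub>v v) \<bullet>c w)"
    using X w by (subst minus_scalar_prod_distrib[of _ n]) (auto simp: right_diff_distrib)
  finally have "cmod (complex_of_real (pi / 2) * ((sqrt_int N *\<^sub>v v - sqrt_int N' *\<^sub>v v) \<bullet>c w)) \<le> ?C * (pi / 2)" .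
  from cmod_pi_half_mult_le[OF this]
  show "cmod ((sqrt_int N *\<^sub>v v - sqrt_int N' *\<^sub>v v) \<bullet>c w) \<le> e / c\<^sup>2 * cvec_norm v * cvec_norm w" by simp
qed

text \<open>On v the resolvent is the scalar 1/(s^2 + l), so the integral reduces to the scalar one
  with m = \<open>csqrt l\<close>.\<close>

lemma sqrt_int_eigenvector:
  assumes N: "sectorial n c N" and v: "v \<in> carrier_vec n" and ev: "N *\<^sub>v v = l \<cdot>\<^sub>v v"
  shows "sqrt_int N *\<^sub>v v = csqrt l \<cdot>\<^sub>v v"
proof (cases "v = 0\<^sub>v n")
  case True
  then show ?thesis using mult_mat_zero_vec[OF sqrt_int_carrier[OF sectorialD(1)[OF N]]] by simp
next
  case False
  let ?m = "csqrt l"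
  have c: "0 < c" by (rule sectorialD(2)[OF N])
  have nv: "0 < cvec_norm v"
    using False v cvec_norm_eq_0_iff[OF v] cvec_norm_nonneg[of v] by linarith
  have sh: "shift_mat N t *\<^sub>v v = (complex_of_real t + l) \<cdot>\<^sub>v v" for t
    unfolding shift_mat_mult_vec[OF sectorialD(1)[OF N] v] ev
    using v by (intro eq_vecI) (auto simp: algebra_simps)
  have low: "c * (1 + t) \<le> cmod (complex_of_real t + l)" if "0 \<le> t" for t
  proof -
    have "c * (1 + t) * cvec_norm v \<le> cmod (complex_of_real t + l) * cvec_norm v"
      using sectorialD(3)[OF N that v] unfolding sh by (simp add: cvec_norm_smult)
    then show ?thesis using nv by simp
  qed
  \<comment> \<open>If Re m were 0, then l = -(Im m)^2, and the shift by (Im m)^2 would annihilate v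
    against the sectorial bound.\<close>
  have m: "0 < Re ?m"
  proof (rule ccontr)
    assume "\<not> 0 < Re ?m"
    then have "Re ?m = 0" using Re_csqrt[of l] by linarith
    then have "?m = \<i> * complex_of_real (Im ?m)" by (simp add: complex_eq_iff del: csqrt.sel)
    then have "?m\<^sup>2 = - complex_of_real ((Im ?m)\<^sup>2)"
      by (metis mult_minus1 of_real_power power2_i power_mult_distrib)
    then have "complex_of_real ((Im ?m)\<^sup>2) + l = 0" by (simp del: csqrt.sel add: eq_neg_iff_add_eq_0 add.commute)
    then have "c * (1 + (Im ?m)\<^sup>2) \<le> 0" using low[of "(Im ?m)\<^sup>2"] by simp
    moreover have "0 < c * (1 + (Im ?m)\<^sup>2)" using c by (simp add: add_pos_nonneg)
    ultimately show False by linarith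
  qed
  have int: "((\<lambda>s. ?m\<^sup>2 / (of_real (s\<^sup>2) + ?m\<^sup>2)) has_integral (?m * (pi / 2))) {0..}"
  proof (rule has_integral_sqrt_resolvent[OF m c])
    show "c * (1 + s\<^sup>2) \<le> cmod (of_real (s\<^sup>2) + ?m\<^sup>2)" for s :: real
      using low[of "s\<^sup>2"] by simp
  qed
  show ?thesis
  proof (rule eq_vec_by_pairing)
    show "sqrt_int N *\<^sub>v v \<in> carrier_vec n"
      using sqrt_int_carrier[OF sectorialD(1)[OF N]] v by (rule mult_mat_vec_carrier)
    fix w :: "complex vec" assume w: "w \<in> carrier_vec n"
    have "(sqrt_kernel N s *\<^sub>v v) \<bullet>c w = ?m\<^sup>2 / (of_real (s\<^sup>2) + ?m\<^sup>2) * (v \<bullet>c w)" for s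
    proof -
      note R = sectorial_resolvent[OF N, of "s\<^sup>2", simplified]
      let ?a = "complex_of_real (s\<^sup>2) + l"
      have "0 < c * (1 + s\<^sup>2)" using c by (simp add: add_pos_nonneg)
      then have nz: "?a \<noteq> 0" using low[of "s\<^sup>2"] by auto
      have "v = ?a \<cdot>\<^sub>v (resolvent N (s\<^sup>2) *\<^sub>v v)"
        using R(4)[OF v] unfolding sh mult_mat_vec[OF R(1) v] by simp
      then have "(1 / ?a) \<cdot>\<^sub>v v = (1 / ?a) \<cdot>\<^sub>v (?a \<cdot>\<^sub>v (resolvent N (s\<^sup>2) *\<^sub>v v))" by simp
      also have "\<dots> = resolvent N (s\<^sup>2) *\<^sub>v v"
        using nz R(2)[OF v] by (simp add: smult_smult_assoc)
      finally have r: "resolvent N (s\<^sup>2) *\<^sub>v v = (1 / ?a) \<cdot>\<^sub>v v" by simp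
      have "sqrt_kernel N s *\<^sub>v v = (l / ?a) \<cdot>\<^sub>v v"
        unfolding sqrt_kernel_mult_vec(1)[OF N v] r mult_mat_vec[OF sectorialD(1)[OF N] v] ev
        by (simp add: smult_smult_assoc)
      then show ?thesis using v w by simp
    qed
    then have "((\<lambda>s. (sqrt_kernel N s *\<^sub>v v) \<bullet>c w) has_integral (?m * (pi / 2) * (v \<bullet>c w))) {0..}"
      using has_integral_mult_left[OF int, of "v \<bullet>c w"] by simp
    then have "complex_of_real (pi / 2) * ((sqrt_int N *\<^sub>v v) \<bullet>c w) = ?m * (pi / 2) * (v \<bullet>c w)"
      using sqrt_int_has_integral[OF N v w] by (rule has_integral_unique[rotated])
    then have "(sqrt_int N *\<^sub>v v) \<bullet>c w = ?m * (v \<bullet>c w)" by simp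
    then show "(sqrt_int N *\<^sub>v v) \<bullet>c w = (?m \<cdot>\<^sub>v v) \<bullet>c w" using v w by simp
  qed (use v in auto)
qed

section \<open>Triangular matrices with distinct diagonal entries\<close>

text \<open>The span of the eigenvectors with eigenvalues in L, in a form where rule induction
  reduces linear claims to single eigenvectors. L is recorded so that a further diagonal entry can
  be required to lie outside it.\<close>

inductive eigen_sum :: "complex mat \<Rightarrow> nat \<Rightarrow> complex set \<Rightarrow> complex vec \<Rightarrow> bool" for B n L where
  zero: "eigen_sum B n L (0\<^sub>v n)"
| add: "eigen_sum B n L v \<Longrightarrow> x \<in> carrier_vec n \<Longrightarrow> a \<in> L \<Longrightarrow> B *\<^sub>v x = a \<cdot>\<^sub>v x \<Longrightarrow> eigen_sum B n L (v + x)"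

lemma eigen_sum_carrier: "eigen_sum B n L v \<Longrightarrow> v \<in> carrier_vec n"
  by (induction rule: eigen_sum.induct) auto

lemma eigen_sum_mono: "eigen_sum B n L v \<Longrightarrow> L \<subseteq> L' \<Longrightarrow> eigen_sum B n L' v"
  by (induction rule: eigen_sum.induct) (auto intro: eigen_sum.intros)

lemma eigen_sum_smult:
  assumes "eigen_sum B n L v" "B \<in> carrier_mat n n"
  shows "eigen_sum B n L (c \<cdot>\<^sub>v v)"
  using assms
proof (induction rule: eigen_sum.induct)
  case (add v x a)
  have "B *\<^sub>v (c \<cdot>\<^sub>v x) = a \<cdot>\<^sub>v (c \<cdot>\<^sub>v x)"
    using add by (simp add: mult_mat_vec smult_smult_assoc mult.commute)
  with add have "eigen_sum B n L (c \<cdot>\<^sub>v v + c \<cdot>\<^sub>v x)"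
    by (intro eigen_sum.add) auto
  then show ?case using add eigen_sum_carrier[OF add(1)] by (simp add: smult_add_distrib_vec)
qed (simp add: eigen_sum.zero)

lemma eigen_sum_add:
  assumes "eigen_sum B n L w" "eigen_sum B n L v"
  shows "eigen_sum B n L (v + w)"
  using assms
proof (induction rule: eigen_sum.induct)
  case (add w x a)
  have "eigen_sum B n L ((v + w) + x)"
    by (rule eigen_sum.add[OF _ add.hyps(2-4)]) (rule add.IH[OF add.prems])
  then show ?case using add eigen_sum_carrier[OF add(1)] eigen_sum_carrier[OF add.prems]
    by (simp add: assoc_add_vec[of _ n])
qed (use eigen_sum_carrier[OF assms(2)] in simp)

text \<open>Extends a spanning set of eigenvectors of a triangular matrix by one dimension.\<close>
lemma eigen_sum_solve:
  assumes "eigen_sum B n L w" and B: "B \<in> carrier_mat n n" and m: "m \<notin> L"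
  shows "\<exists>y. eigen_sum B n L y \<and> m \<cdot>\<^sub>v y = B *\<^sub>v y + w"
  using assms(1)
proof (induction rule: eigen_sum.induct)
  case zero
  have "m \<cdot>\<^sub>v 0\<^sub>v n = B *\<^sub>v 0\<^sub>v n + 0\<^sub>v n" using mult_mat_zero_vec[OF B] by simp
  then show ?case using eigen_sum.zero by blast
next
  case (add w x a)
  then obtain y where y: "eigen_sum B n L y" "m \<cdot>\<^sub>v y = B *\<^sub>v y + w" by blast
  have w: "w \<in> carrier_vec n" and yc: "y \<in> carrier_vec n"
    using add(1) y(1) by (auto intro: eigen_sum_carrier)
  \<comment> \<open>On the eigenvector x the equation (m - B) y = x is solved by x/(m - a).\<close>
  define c where "c = 1 / (m - a)"
  have "m \<noteq> a" using m add by auto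
  then have c: "m * c = a * c + 1" by (simp add: c_def field_simps)
  have Bcx: "B *\<^sub>v (c \<cdot>\<^sub>v x) = a \<cdot>\<^sub>v (c \<cdot>\<^sub>v x)"
    using add B by (simp add: mult_mat_vec smult_smult_assoc mult.commute)
  have "eigen_sum B n L (y + c \<cdot>\<^sub>v x)"
    by (rule eigen_sum.add[OF y(1) _ add(3) Bcx]) (use add in simp)
  moreover have "m \<cdot>\<^sub>v (y + c \<cdot>\<^sub>v x) = B *\<^sub>v (y + c \<cdot>\<^sub>v x) + (w + x)"
  proof -
    have "B *\<^sub>v (y + c \<cdot>\<^sub>v x) = B *\<^sub>v y + a \<cdot>\<^sub>v (c \<cdot>\<^sub>v x)"
      using B yc add(2) Bcx mult_add_distrib_mat_vec[of B n n y "c \<cdot>\<^sub>v x"] by simp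
    moreover have "m \<cdot>\<^sub>v (y + c \<cdot>\<^sub>v x) = (B *\<^sub>v y + w) + (m * c) \<cdot>\<^sub>v x"
      using yc add(2) y(2) by (simp add: smult_add_distrib_vec[of _ n] smult_smult_assoc)
    moreover have "(z + w) + (a * c + 1) \<cdot>\<^sub>v x = z + a \<cdot>\<^sub>v (c \<cdot>\<^sub>v x) + (w + x)"
      if "z \<in> carrier_vec n" for z
      using that w add(2) by (intro eq_vecI) (auto simp: algebra_simps)
    ultimately show ?thesis using B yc by (simp add: c)
  qed
  ultimately show ?case by blast
qed

lemma upper_triangular_mult_unit_vec:
  fixes B :: "complex mat"
  assumes B: "B \<in> carrier_mat n n" "upper_triangular B" and j: "j < n"
  obtains w where "w \<in> carrier_vec n" "\<And>i. j \<le> i \<Longrightarrow> i < n \<Longrightarrow> w $ i = 0"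
    "B *\<^sub>v unit_vec n j = B $$ (j, j) \<cdot>\<^sub>v unit_vec n j + w"
proof
  let ?w = "B *\<^sub>v unit_vec n j - B $$ (j, j) \<cdot>\<^sub>v unit_vec n j"
  have Bu: "(B *\<^sub>v unit_vec n j) $ i = B $$ (i, j)" if "i < n" for i
    using B j that by simp
  show "?w \<in> carrier_vec n" using B by auto
  show "?w $ i = 0" if "j \<le> i" "i < n" for i
    using that j B Bu[OF that(2)] upper_triangularD[OF B(2), of j i] by (cases "i = j") auto
  show "B *\<^sub>v unit_vec n j = B $$ (j, j) \<cdot>\<^sub>v unit_vec n j + ?w"
    using B by (intro eq_vecI) auto
qed

lemma vec_split_last:
  fixes v :: "complex vec"
  assumes v: "v \<in> carrier_vec n" and z: "\<And>i. Suc j \<le> i \<Longrightarrow> i < n \<Longrightarrow> v $ i = 0" and j: "j < n"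
  obtains v' where "v' \<in> carrier_vec n" "\<And>i. j \<le> i \<Longrightarrow> i < n \<Longrightarrow> v' $ i = 0"
    "v = v' + v $ j \<cdot>\<^sub>v unit_vec n j"
proof
  let ?v' = "v - v $ j \<cdot>\<^sub>v unit_vec n j"
  show "?v' \<in> carrier_vec n" using v by auto
  show "?v' $ i = 0" if "j \<le> i" "i < n" for i
    using that v z[of i] j by (cases "i = j") auto
  show "v = ?v' + v $ j \<cdot>\<^sub>v unit_vec n j"
    using v by (intro eq_vecI) auto
qed

text \<open>Induction along the coordinate flag. Column j reads B e_j = m e_j + w with w supported
  below j; \<open>eigen_sum_solve\<close> yields y in the earlier span with (m - B) y = w, and then
  e_j + y is an eigenvector for m.\<close>

lemma upper_triangular_eigen_sum:
  assumes B: "B \<in> carrier_mat n n" "upper_triangular B"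
    and dist: "\<And>i j. i < j \<Longrightarrow> j < n \<Longrightarrow> B $$ (i, i) \<noteq> B $$ (j, j)"
    and "j \<le> n" "v \<in> carrier_vec n" "\<And>i. j \<le> i \<Longrightarrow> i < n \<Longrightarrow> v $ i = 0"
  shows "eigen_sum B n ((\<lambda>i. B $$ (i, i)) ` {..<j}) v"
  using assms(4-6)
proof (induction j arbitrary: v)
  case 0
  then have "v = 0\<^sub>v n" by (intro eq_vecI) auto
  then show ?case by (simp add: eigen_sum.zero)
next
  case (Suc j)
  let ?L = "\<lambda>j. (\<lambda>i. B $$ (i, i)) ` {..<j}" and ?m = "B $$ (j, j)" and ?e = "unit_vec n j"
  have j: "j < n" using Suc by simp
  have mono: "?L j \<subseteq> ?L (Suc j)" by auto
  obtain w where w: "w \<in> carrier_vec n" "\<And>i. j \<le> i \<Longrightarrow> i < n \<Longrightarrow> w $ i = 0"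
    "B *\<^sub>v ?e = ?m \<cdot>\<^sub>v ?e + w"
    using upper_triangular_mult_unit_vec[OF B j] by blast
  have "eigen_sum B n (?L j) w" using Suc.IH[OF _ w(1,2)] j by simp
  moreover have "?m \<notin> ?L j" using dist j by fastforce
  ultimately obtain y where y: "eigen_sum B n (?L j) y" "?m \<cdot>\<^sub>v y = B *\<^sub>v y + w"
    using eigen_sum_solve[OF _ B(1)] by blast
  have yc: "y \<in> carrier_vec n" using y(1) by (rule eigen_sum_carrier)
  have "B *\<^sub>v (?e + y) = B *\<^sub>v ?e + B *\<^sub>v y"
    using B(1) yc by (intro mult_add_distrib_mat_vec) auto
  also have "\<dots> = ?m \<cdot>\<^sub>v ?e + (B *\<^sub>v y + w)"
    unfolding w(3) using w(1) B(1) yc by (intro eq_vecI) auto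
  also have "\<dots> = ?m \<cdot>\<^sub>v (?e + y)"
    unfolding y(2)[symmetric] using yc by (simp add: smult_add_distrib_vec[of _ n])
  finally have u: "B *\<^sub>v (?e + y) = ?m \<cdot>\<^sub>v (?e + y)" .
  have "eigen_sum B n (?L (Suc j)) ((-1) \<cdot>\<^sub>v y + (?e + y))"
    by (rule eigen_sum.add[OF eigen_sum_mono[OF eigen_sum_smult[OF y(1) B(1)] mono] _ _ u]) (use yc in auto)
  also have "(-1) \<cdot>\<^sub>v y + (?e + y) = ?e" using yc by (intro eq_vecI) auto
  finally have e: "eigen_sum B n (?L (Suc j)) ?e" .
  obtain v' where v': "v' \<in> carrier_vec n" "\<And>i. j \<le> i \<Longrightarrow> i < n \<Longrightarrow> v' $ i = 0"
    "v = v' + v $ j \<cdot>\<^sub>v ?e"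
    using vec_split_last[OF Suc.prems(2,3) j] by blast
  have "eigen_sum B n (?L (Suc j)) v'"
    using eigen_sum_mono[OF Suc.IH[OF _ v'(1,2)] mono] j by simp
  then have "eigen_sum B n (?L (Suc j)) (v' + v $ j \<cdot>\<^sub>v ?e)"
    by (intro eigen_sum_add eigen_sum_smult e B)
  then show ?case by (simp flip: v'(3))
qed

text \<open>P carries eigenvectors of B to eigenvectors of N, where \<open>sqrt_int N\<close> acts
  as a square root of the eigenvalue; by distinctness these vectors span.\<close>

lemma sqrt_int_square_distinct:
  assumes N: "sectorial n c N" and PBQ: "N = P * B * Q" "P * Q = 1\<^sub>m n" "Q * P = 1\<^sub>m n"
    and carr: "P \<in> carrier_mat n n" "B \<in> carrier_mat n n" "Q \<in> carrier_mat n n"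
    and B: "upper_triangular B" "\<And>i j. i < j \<Longrightarrow> j < n \<Longrightarrow> B $$ (i, i) \<noteq> B $$ (j, j)"
    and v: "v \<in> carrier_vec n"
  shows "sqrt_int N *\<^sub>v (sqrt_int N *\<^sub>v v) = N *\<^sub>v v"
proof -
  let ?X = "sqrt_int N"
  have X: "?X \<in> carrier_mat n n" and Nc: "N \<in> carrier_mat n n"
    using sectorialD(1)[OF N] by auto
  have NP: "N *\<^sub>v (P *\<^sub>v x) = P *\<^sub>v (B *\<^sub>v x)" if x: "x \<in> carrier_vec n" for x
  proof -
    have "N * P = P * B * (Q * P)"
      unfolding PBQ(1) using carr by (simp add: assoc_mult_mat[of _ n n _ n _ n])
    then have "N * P = P * B" using PBQ(3) carr by simp
    then have "(N * P) *\<^sub>v x = (P * B) *\<^sub>v x" by simp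
    then show ?thesis using x carr Nc by (simp add: assoc_mult_mat_vec[of _ n n _ n])
  qed
  have "?X *\<^sub>v (?X *\<^sub>v (P *\<^sub>v z)) = N *\<^sub>v (P *\<^sub>v z)" if "eigen_sum B n L z" for z L
    using that
  proof (induction rule: eigen_sum.induct)
    case zero
    show ?case using X Nc carr by (simp add: mult_mat_zero_vec[of _ n n])
  next
    case (add z x a)
    have z: "z \<in> carrier_vec n" using add(1) by (rule eigen_sum_carrier)
    have Px: "P *\<^sub>v x \<in> carrier_vec n" and Pz: "P *\<^sub>v z \<in> carrier_vec n"
      using carr add z by (auto intro: mult_mat_vec_carrier)
    have ev: "N *\<^sub>v (P *\<^sub>v x) = a \<cdot>\<^sub>v (P *\<^sub>v x)"
      using NP[OF add(2)] add(2,4) carr by (simp add: mult_mat_vec)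
    have "?X *\<^sub>v (?X *\<^sub>v (P *\<^sub>v x)) = (csqrt a * csqrt a) \<cdot>\<^sub>v (P *\<^sub>v x)"
      unfolding sqrt_int_eigenvector[OF N Px ev] mult_mat_vec[OF X Px]
      by (simp add: smult_smult_assoc)
    also have "csqrt a * csqrt a = a"
      using power2_csqrt[of a] by (simp only: power2_eq_square)
    finally have x: "?X *\<^sub>v (?X *\<^sub>v (P *\<^sub>v x)) = N *\<^sub>v (P *\<^sub>v x)" by (simp add: ev)
    have "P *\<^sub>v (z + x) = P *\<^sub>v z + P *\<^sub>v x"
      using carr z add(2) by (intro mult_add_distrib_mat_vec) auto
    then show ?case
      using X Nc Px Pz x add.IH mult_mat_vec_carrier[OF X Px] mult_mat_vec_carrier[OF X Pz]
      by (simp add: mult_add_distrib_mat_vec[of _ n n])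
  qed
  moreover have "eigen_sum B n ((\<lambda>i. B $$ (i, i)) ` {..<n}) (Q *\<^sub>v v)"
    by (rule upper_triangular_eigen_sum[OF carr(2) B order_refl]) (use carr v in auto)
  moreover have "P *\<^sub>v (Q *\<^sub>v v) = v"
    using assoc_mult_mat_vec[OF carr(1,3) v] PBQ(2) v by simp
  ultimately show ?thesis by metis
qed

section \<open>The square of the matrix integral in general\<close>

text \<open>Matrices with distinct eigenvalues come arbitrarily close to M with a common sectorial
  constant, and under such a bound both N and the square of \<open>sqrt_int N\<close> are Lipschitz
  in N.\<close>

lemma sqrt_int_square:
  assumes M: "sectorial n c M"
  shows "sqrt_int M * sqrt_int M = M"
proof -
  note Mc = sectorialD(1)[OF M] and c = sectorialD(2)[OF M]
  obtain B P Q where S: "B \<in> carrier_mat n n" "P \<in> carrier_mat n n" "Q \<in> carrier_mat n n"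
    "P * Q = 1\<^sub>m n" "Q * P = 1\<^sub>m n" "M = P * B * Q" "upper_triangular B"
    using complex_schur[OF Mc] by metis
  define E where "E = mat n n (\<lambda>(i, j). if i = j then complex_of_nat i else 0)"
  define F where "F = P * E * Q"
  have E: "E \<in> carrier_mat n n" and F: "F \<in> carrier_mat n n" using S by (auto simp: E_def F_def)
  obtain k where k: "0 \<le> k" "\<And>v. v \<in> carrier_vec n \<Longrightarrow> cvec_norm (F *\<^sub>v v) \<le> k * cvec_norm v"
    using mat_vec_norm_bounded[OF F] by blast
  obtain K where K: "0 \<le> K" "\<And>v. v \<in> carrier_vec n \<Longrightarrow> cvec_norm (M *\<^sub>v v) \<le> K * cvec_norm v"
    using mat_vec_norm_bounded[OF Mc] by blast
  \<comment> \<open>Half of the lower bound is given up to absorb the perturbation e F, so that M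
    and its neighbours share the constant d.\<close>
  define d where "d = c / 2"
  have d: "0 < d" "d \<le> c" using c by (auto simp: d_def)
  let ?X = "sqrt_int M"
  have X: "?X \<in> carrier_mat n n" using Mc by auto
  have Md: "sectorial n d M"
    unfolding sectorial_def
  proof (intro conjI allI impI ballI)
    fix t :: real and v :: "complex vec" assume t: "0 \<le> t" and v: "v \<in> carrier_vec n"
    have "d * (1 + t) * cvec_norm v \<le> c * (1 + t) * cvec_norm v"
      using d t by (intro mult_right_mono) auto
    also have "\<dots> \<le> cvec_norm (shift_mat M t *\<^sub>v v)" by (rule sectorialD(3)[OF M t v])
    finally show "d * (1 + t) * cvec_norm v \<le> cvec_norm (shift_mat M t *\<^sub>v v)" .
  qed (use Mc d in auto)
  \<comment> \<open>With X and Y the integrals for M and for the perturbed N, the three terms bound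
    X(X - Y), (X - Y)Y and N - M, each divided by e.\<close>
  define C where "C = K / d * (k / d\<^sup>2) + (k / d\<^sup>2) * ((K + d) / d) + k"
  have C: "0 \<le> C" using k K d by (auto simp: C_def)
  text \<open>Adding \<open>e diag(0, 1, \<dots>)\<close> to the Schur form separates the eigenvalues for all but finitely
    many \<open>e\<close>.\<close>
  have approx: "cvec_norm (?X *\<^sub>v (?X *\<^sub>v v) - M *\<^sub>v v) \<le> e * C * cvec_norm v"
    if v: "v \<in> carrier_vec n" and e: "0 < e" "e * k \<le> d"
      and dist: "\<And>i j. i < j \<Longrightarrow> j < n \<Longrightarrow> B $$ (i, i) + of_real e * of_nat i \<noteq> B $$ (j, j) + of_real e * of_nat j"
    for v e
  proof -
    define N where "N = M + complex_of_real e \<cdot>\<^sub>m F"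
    have Nc: "N \<in> carrier_mat n n" using Mc F by (auto simp: N_def)
    have Nv: "N *\<^sub>v y = M *\<^sub>v y + complex_of_real e \<cdot>\<^sub>v (F *\<^sub>v y)" if "y \<in> carrier_vec n" for y
    proof -
      have "N *\<^sub>v y = M *\<^sub>v y + (complex_of_real e \<cdot>\<^sub>m F) *\<^sub>v y"
        unfolding N_def using Mc F that by (intro add_mult_distrib_mat_vec) auto
      also have "(complex_of_real e \<cdot>\<^sub>m F) *\<^sub>v y = complex_of_real e \<cdot>\<^sub>v (F *\<^sub>v y)"
        using F that by (intro eq_vecI) auto
      finally show ?thesis .
    qed
    have NM: "cvec_norm (N *\<^sub>v y - M *\<^sub>v y) \<le> e * k * cvec_norm y" if y: "y \<in> carrier_vec n" for y
    proof -
      have "N *\<^sub>v y - M *\<^sub>v y = complex_of_real e \<cdot>\<^sub>v (F *\<^sub>v y)"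
        unfolding Nv[OF y] using Mc F y by (intro eq_vecI) auto
      then show ?thesis using k(2)[OF y] e by (simp add: cvec_norm_smult)
    qed
    have Nd: "sectorial n d N"
      unfolding sectorial_def
    proof (intro conjI allI impI ballI)
      fix t :: real and v :: "complex vec" assume t: "0 \<le> t" and v: "v \<in> carrier_vec n"
      have "shift_mat N t *\<^sub>v v = shift_mat M t *\<^sub>v v + complex_of_real e \<cdot>\<^sub>v (F *\<^sub>v v)"
        unfolding shift_mat_mult_vec[OF Nc v] shift_mat_mult_vec[OF Mc v] Nv[OF v]
        using Mc F v by (intro eq_vecI) auto
      then have "cvec_norm (shift_mat M t *\<^sub>v v) - e * cvec_norm (F *\<^sub>v v) \<le> cvec_norm (shift_mat N t *\<^sub>v v)"
        using cvec_norm_diff_ge[of "shift_mat M t *\<^sub>v v" n "complex_of_real e \<cdot>\<^sub>v (F *\<^sub>v v)"]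
          mult_mat_vec_carrier[OF shift_mat_carrier[OF Mc] v] mult_mat_vec_carrier[OF F v] e
        by (simp add: cvec_norm_smult)
      moreover have "e * cvec_norm (F *\<^sub>v v) \<le> d * (1 + t) * cvec_norm v"
      proof -
        have "e * cvec_norm (F *\<^sub>v v) \<le> e * (k * cvec_norm v)"
          using k(2)[OF v] e by (intro mult_left_mono) auto
        also have "\<dots> = (e * k) * cvec_norm v" by simp
        also have "\<dots> \<le> d * (1 + t) * cvec_norm v"
        proof (rule mult_right_mono)
          have "d * 1 \<le> d * (1 + t)" using d t by (intro mult_left_mono) auto
          then show "e * k \<le> d * (1 + t)" using e by simp
        qed simp
        finally show ?thesis .
      qed
      moreover have "c * (1 + t) * cvec_norm v \<le> cvec_norm (shift_mat M t *\<^sub>v v)"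
        by (rule sectorialD(3)[OF M t v])
      moreover have "c * (1 + t) * cvec_norm v = 2 * (d * (1 + t) * cvec_norm v)"
        by (simp add: d_def)
      ultimately show "d * (1 + t) * cvec_norm v \<le> cvec_norm (shift_mat N t *\<^sub>v v)" by linarith
    qed (use Nc d in auto)
    let ?Y = "sqrt_int N"
    have Y: "?Y \<in> carrier_mat n n" using Nc by auto
    have sq: "?Y *\<^sub>v (?Y *\<^sub>v v) = N *\<^sub>v v"
    proof (rule sqrt_int_square_distinct[OF Nd _ S(4,5) S(2) _ S(3) _ _ v])
      let ?B = "B + complex_of_real e \<cdot>\<^sub>m E"
      show B': "?B \<in> carrier_mat n n" using S E by auto
      have "P * ?B * Q = (P * B + P * (complex_of_real e \<cdot>\<^sub>m E)) * Q"
        using S E by (subst mult_add_distrib_mat[of _ n n _ n]) auto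
      also have "\<dots> = P * B * Q + P * (complex_of_real e \<cdot>\<^sub>m E) * Q"
        using S E by (subst add_mult_distrib_mat[of _ n n _ _ n]) auto
      also have "P * (complex_of_real e \<cdot>\<^sub>m E) = complex_of_real e \<cdot>\<^sub>m (P * E)"
        using S E by (intro mult_smult_distrib) auto
      also have "complex_of_real e \<cdot>\<^sub>m (P * E) * Q = complex_of_real e \<cdot>\<^sub>m F"
        unfolding F_def using S E by (intro mult_smult_assoc_mat) auto
      finally show "N = P * ?B * Q" by (simp add: N_def S(6))
      show "upper_triangular ?B"
        using S(1,7) E by (auto simp: upper_triangular_def E_def)
      show "?B $$ (i, i) \<noteq> ?B $$ (j, j)" if "i < j" "j < n" for i j
        using dist[OF that] that S(1) E by (simp add: E_def)
    qed
    have XY: "cvec_norm (?X *\<^sub>v u - ?Y *\<^sub>v u) \<le> e * (k / d\<^sup>2) * cvec_norm u" if "u \<in> carrier_vec n" for u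
      using sqrt_int_diff_norm_le[OF Md Nd that NM] e k by simp
    have Xn: "cvec_norm (?X *\<^sub>v u) \<le> K / d * cvec_norm u" if "u \<in> carrier_vec n" for u
      by (rule sqrt_int_norm_le[OF Md that K(2,1)])
    have Yn: "cvec_norm (?Y *\<^sub>v u) \<le> (K + d) / d * cvec_norm u" if u: "u \<in> carrier_vec n" for u
    proof (rule sqrt_int_norm_le[OF Nd u])
      fix y :: "complex vec" assume y: "y \<in> carrier_vec n"
      have "N *\<^sub>v y = M *\<^sub>v y + (N *\<^sub>v y - M *\<^sub>v y)" using Nc Mc y by (intro eq_vecI) auto
      then have "cvec_norm (N *\<^sub>v y) \<le> cvec_norm (M *\<^sub>v y) + cvec_norm (N *\<^sub>v y - M *\<^sub>v y)"
        using cvec_norm_add_le[of "M *\<^sub>v y" n "N *\<^sub>v y - M *\<^sub>v y"] mult_mat_vec_carrier[OF Mc y]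
          mult_mat_vec_carrier[OF Nc y] by simp
      also have "\<dots> \<le> K * cvec_norm y + e * k * cvec_norm y"
        by (intro add_mono K NM y)
      also have "\<dots> \<le> K * cvec_norm y + d * cvec_norm y"
        using e by (intro add_mono mult_right_mono) auto
      finally show "cvec_norm (N *\<^sub>v y) \<le> (K + d) * cvec_norm y" by (simp add: algebra_simps)
    qed (use K d in auto)
    have Xv: "?X *\<^sub>v v \<in> carrier_vec n" and Yv: "?Y *\<^sub>v v \<in> carrier_vec n"
      using X Y v by (auto intro: mult_mat_vec_carrier)
    let ?t1 = "?X *\<^sub>v (?X *\<^sub>v v - ?Y *\<^sub>v v)" and ?t2 = "?X *\<^sub>v (?Y *\<^sub>v v) - ?Y *\<^sub>v (?Y *\<^sub>v v)"
      and ?t3 = "N *\<^sub>v v - M *\<^sub>v v"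
    have carr: "?t1 \<in> carrier_vec n" "?t2 \<in> carrier_vec n" "?t3 \<in> carrier_vec n"
      using mult_mat_vec_carrier[OF X, of "?X *\<^sub>v v - ?Y *\<^sub>v v"] mult_mat_vec_carrier[OF X Yv]
        mult_mat_vec_carrier[OF Y Yv] mult_mat_vec_carrier[OF Nc v] mult_mat_vec_carrier[OF Mc v] Xv Yv by auto
    have telescope: "x - z = ((x - y) + (y - w)) + (w - z)"
      if "x \<in> carrier_vec n" "y \<in> carrier_vec n" "w \<in> carrier_vec n" "z \<in> carrier_vec n"
      for x y w z :: "complex vec"
      using that by (intro eq_vecI) auto
    have "?X *\<^sub>v (?X *\<^sub>v v) - M *\<^sub>v v = (?t1 + ?t2) + ?t3"
      unfolding mult_mat_vec_diff[OF X Xv Yv] sq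
      using mult_mat_vec_carrier[OF X Xv] mult_mat_vec_carrier[OF X Yv]
        mult_mat_vec_carrier[OF Nc v] mult_mat_vec_carrier[OF Mc v]
      by (rule telescope)
    then have "cvec_norm (?X *\<^sub>v (?X *\<^sub>v v) - M *\<^sub>v v) \<le> cvec_norm ?t1 + cvec_norm ?t2 + cvec_norm ?t3"
      using cvec_norm_add_le[of "?t1 + ?t2" n ?t3] cvec_norm_add_le[of ?t1 n ?t2] carr by simp
    also have "cvec_norm ?t1 \<le> K / d * (e * (k / d\<^sup>2) * cvec_norm v)"
    proof -
      have "cvec_norm ?t1 \<le> K / d * cvec_norm (?X *\<^sub>v v - ?Y *\<^sub>v v)" using Xv Yv by (intro Xn) auto
      also have "\<dots> \<le> K / d * (e * (k / d\<^sup>2) * cvec_norm v)"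
        using K d by (intro mult_left_mono XY v) auto
      finally show ?thesis .
    qed
    also have "cvec_norm ?t2 \<le> e * (k / d\<^sup>2) * ((K + d) / d * cvec_norm v)"
    proof -
      have "cvec_norm ?t2 \<le> e * (k / d\<^sup>2) * cvec_norm (?Y *\<^sub>v v)" by (rule XY[OF Yv])
      also have "\<dots> \<le> e * (k / d\<^sup>2) * ((K + d) / d * cvec_norm v)"
        using e k by (intro mult_left_mono Yn v) auto
      finally show ?thesis .
    qed
    also have "cvec_norm ?t3 \<le> e * k * cvec_norm v" by (rule NM[OF v])
    also have "K / d * (e * (k / d\<^sup>2) * cvec_norm v) + e * (k / d\<^sup>2) * ((K + d) / d * cvec_norm v) + e * k * cvec_norm v
        = e * C * cvec_norm v"
      unfolding C_def by (simp only: distrib_left distrib_right mult_ac)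
    finally show ?thesis by simp
  qed
  have small: "\<exists>e. 0 < e \<and> e < r \<and> (\<forall>i j. i < j \<longrightarrow> j < n \<longrightarrow>
      B $$ (i, i) + of_real e * of_nat i \<noteq> B $$ (j, j) + of_real e * of_nat j)" if r: "0 < r" for r :: real
  proof -
    \<comment> \<open>Entries i and j collide only when e equals this quotient; the real part makes
      the exceptional set one of reals.\<close>
    define bad where "bad = (\<lambda>(i, j). Re ((B $$ (i, i) - B $$ (j, j)) / (of_nat j - of_nat i))) ` ({..<n} \<times> {..<n})"
    have "finite bad" by (simp add: bad_def)
    moreover have "infinite {0<..<r}" using r by (simp add: infinite_Ioo)
    ultimately have "\<not> {0<..<r} \<subseteq> bad" using finite_subset by blast
    then obtain e where "e \<in> {0<..<r}" "e \<notin> bad" by blast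
    then have e: "0 < e" "e < r" "e \<notin> bad" by auto
    have "B $$ (i, i) + of_real e * of_nat i \<noteq> B $$ (j, j) + of_real e * of_nat j"
      if ij: "i < j" "j < n" for i j
    proof
      assume eq: "B $$ (i, i) + of_real e * of_nat i = B $$ (j, j) + of_real e * of_nat j"
      have nz: "(of_nat j - of_nat i :: complex) \<noteq> 0" using ij by simp
      have "complex_of_real e * (of_nat j - of_nat i) = B $$ (i, i) - B $$ (j, j)"
        using eq by (simp add: algebra_simps)
      then have "complex_of_real e = (B $$ (i, i) - B $$ (j, j)) / (of_nat j - of_nat i)"
        using nz by (simp add: nonzero_eq_divide_eq)
      then have "e = Re ((B $$ (i, i) - B $$ (j, j)) / (of_nat j - of_nat i))"
        by (metis Re_complex_of_real)
      then have "e \<in> bad" using ij unfolding bad_def by force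
      with e show False by simp
    qed
    then show ?thesis using e by blast
  qed
  have "?X *\<^sub>v (?X *\<^sub>v v) = M *\<^sub>v v" if v: "v \<in> carrier_vec n" for v
  proof (rule ccontr)
    let ?z = "?X *\<^sub>v (?X *\<^sub>v v) - M *\<^sub>v v"
    assume neq: "?X *\<^sub>v (?X *\<^sub>v v) \<noteq> M *\<^sub>v v"
    have cx: "?X *\<^sub>v (?X *\<^sub>v v) \<in> carrier_vec n" and cm: "M *\<^sub>v v \<in> carrier_vec n"
      using X Mc v by (auto intro!: mult_mat_vec_carrier)
    have z: "0 < cvec_norm ?z"
    proof (rule ccontr)
      assume "\<not> 0 < cvec_norm ?z"
      then have "cvec_norm ?z = 0" using cvec_norm_nonneg[of ?z] by linarith
      then have "?z = 0\<^sub>v n" using cx cm cvec_norm_eq_0_iff[of ?z n] by simp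
      then have "?X *\<^sub>v (?X *\<^sub>v v) = M *\<^sub>v v"
        by (rule vec_eq_if_diff_zero[OF cx cm])
      with neq show False ..
    qed
    \<comment> \<open>The first entry enforces e k \<le> d, the second pushes the error bound below
      ||z||, a contradiction. The added 1 excludes zero denominators.\<close>
    define r where "r = min (d / (k + 1)) (cvec_norm ?z / (C * cvec_norm v + 1))"
    have p1: "0 < k + 1" and p2: "0 < C * cvec_norm v + 1"
      using k C by (auto simp: add_nonneg_pos)
    have "0 < r" using d z p1 p2 by (simp add: r_def)
    then obtain e where e: "0 < e" "e < r" and dist: "\<forall>i j. i < j \<longrightarrow> j < n \<longrightarrow>
      B $$ (i, i) + of_real e * of_nat i \<noteq> B $$ (j, j) + of_real e * of_nat j"
      using small by blast
    have "e * (k + 1) < d" "e * (C * cvec_norm v + 1) < cvec_norm ?z"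
      using e p1 p2 by (auto simp: r_def pos_less_divide_eq)
    then have "e * k \<le> d" "e * C * cvec_norm v < cvec_norm ?z"
      using e by (auto simp: algebra_simps)
    with approx[OF v e(1)] dist show False by force
  qed
  then have "(?X * ?X) *\<^sub>v v = M *\<^sub>v v" if "v \<in> carrier_vec n" for v
    using assoc_mult_mat_vec[OF X X that] that by simp
  then show ?thesis by (intro eq_mat_by_mult_vec[OF mult_carrier_mat[OF X X] Mc])
qed

section \<open>Positive-definiteness and uniqueness of the root\<close>

text \<open>The integrand is already positive: with y = (M + s^2)^-1 x, so that x = My + s^2 y, the
  pairing of My with x has real part ||My||^2 + s^2 Re(My, y).\<close>

lemma pos_def_sqrt_int:
  assumes M: "M \<in> carrier_mat n n" and pd: "pos_def M"
  shows "pos_def (sqrt_int M)"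
proof -
  obtain c where N: "sectorial n c M" using pos_def_sectorial[OF M pd] .
  have "0 < Re ((sqrt_int M *\<^sub>v x) \<bullet>c x)" if x: "x \<in> carrier_vec n" and x1: "cvec_norm x = 1" for x
  proof -
    let ?g = "\<lambda>s. Re ((sqrt_kernel M s *\<^sub>v x) \<bullet>c x)"
    have pos: "0 < ?g s" for s
    proof -
      note R = sectorial_resolvent[OF N, of "s\<^sup>2", simplified]
      define y where "y = resolvent M (s\<^sup>2) *\<^sub>v x"
      have y: "y \<in> carrier_vec n" using R(2)[OF x] by (simp add: y_def)
      have My: "M *\<^sub>v y \<in> carrier_vec n" using M y by (rule mult_mat_vec_carrier)
      have xy: "x = M *\<^sub>v y + complex_of_real (s\<^sup>2) \<cdot>\<^sub>v y"
        using R(3)[OF x] unfolding y_def[symmetric] shift_mat_mult_vec[OF M y] by simp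
      have "M *\<^sub>v y \<noteq> 0\<^sub>v n"
      proof
        assume "M *\<^sub>v y = 0\<^sub>v n"
        with pos_def_inj[OF M pd y] have "y = 0\<^sub>v n" by simp
        with \<open>M *\<^sub>v y = 0\<^sub>v n\<close> xy have "x = 0\<^sub>v n" by simp
        with x1 show False by simp
      qed
      then have "cvec_norm (M *\<^sub>v y) \<noteq> 0" using cvec_norm_eq_0_iff[OF My] by simp
      moreover have "(M *\<^sub>v y) \<bullet>c x = (M *\<^sub>v y) \<bullet>c (M *\<^sub>v y) + complex_of_real (s\<^sup>2) * ((M *\<^sub>v y) \<bullet>c y)"
        using My y conjugate_add_vec[OF My, of "complex_of_real (s\<^sup>2) \<cdot>\<^sub>v y"]
        by (subst xy) (simp add: conjugate_smult_vec conjugate_complex_def scalar_prod_add_distrib[of _ n])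
      ultimately have "0 < Re ((M *\<^sub>v y) \<bullet>c x)"
        using pos_def_Re_nonneg[OF M pd y]
        by (simp add: cscalar_self add_pos_nonneg del: of_real_power)
      then show ?thesis unfolding sqrt_kernel_mult_vec(1)[OF N x] y_def .
    qed
    \<comment> \<open>Strictness survives integration because the integrand dominates its positive
      minimum over [0, 1], extended by zero.\<close>
    have "continuous_on {0..1} ?g"
      by (intro continuous_on_Re continuous_on_subset[OF sqrt_kernel_integrable(2)[OF N x x]]) auto
    then have "\<exists>s0\<in>{0..1}. \<forall>s\<in>{0..1}. ?g s0 \<le> ?g s"
      by (intro continuous_attains_inf) auto
    then obtain s0 where s0: "\<And>s. s \<in> {0..1} \<Longrightarrow> ?g s0 \<le> ?g s" by blast
    have int: "(?g has_integral Re (complex_of_real (pi / 2) * ((sqrt_int M *\<^sub>v x) \<bullet>c x))) {0..}"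
      using has_integral_linear[OF sqrt_int_has_integral[OF N x x] bounded_linear_Re] by (simp add: o_def)
    have "((\<lambda>s::real. if s \<in> {0..1} then ?g s0 else 0) has_integral ?g s0) {0..}"
      using has_integral_restrict[of "{0..1::real}" "{0..}" "\<lambda>_. ?g s0" "?g s0"] has_integral_const_real[of "?g s0" 0 1] by auto
    then have "?g s0 \<le> Re (complex_of_real (pi / 2) * ((sqrt_int M *\<^sub>v x) \<bullet>c x))"
      using int by (rule has_integral_le) (use s0 pos in \<open>auto simp: less_imp_le\<close>)
    with pos[of s0] have "0 < pi / 2 * Re ((sqrt_int M *\<^sub>v x) \<bullet>c x)" by simp
    then show ?thesis by (simp add: zero_less_mult_iff)
  qed
  then show ?thesis using sqrt_int_carrier[OF M] by (auto simp: pos_def_def)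
qed

text \<open>Pair the eigenvector equation with the eigenvector for the real part, and take norms in
  it for the modulus.\<close>

lemma eigenvalue_pos_def:
  assumes M: "M \<in> carrier_mat n n" and pd: "pos_def M" and ev: "eigenvalue M l"
  shows "0 < Re l"
    and "(\<And>v. v \<in> carrier_vec n \<Longrightarrow> cvec_norm (M *\<^sub>v v) \<le> a * cvec_norm v) \<Longrightarrow> cmod l \<le> a"
proof -
  obtain v where v: "v \<in> carrier_vec n" "v \<noteq> 0\<^sub>v n" "M *\<^sub>v v = l \<cdot>\<^sub>v v"
    using ev M unfolding eigenvalue_def eigenvector_def by auto
  have nv: "0 < cvec_norm v"
    using v cvec_norm_eq_0_iff[OF v(1)] cvec_norm_nonneg[of v] by linarith
  have "0 < Re (l * (v \<bullet>c v))" using pos_defD[OF M pd v(1,2)] v(1) by (simp add: v(3))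
  then have "0 < Re l * (cvec_norm v)\<^sup>2" by (simp add: cscalar_self del: of_real_power)
  then show "0 < Re l" using nv by (simp add: zero_less_mult_iff)
  assume "\<And>v. v \<in> carrier_vec n \<Longrightarrow> cvec_norm (M *\<^sub>v v) \<le> a * cvec_norm v"
  from this[OF v(1)] show "cmod l \<le> a" using nv by (simp add: v(3) cvec_norm_smult)
qed

text \<open>The difference \<open>Z = X - Y\<close> satisfies \<open>X Z + Z Y = 0\<close>, which forces \<open>Z = 0\<close>
  because \<open>X\<close> and \<open>-Y\<close> have disjoint spectra.\<close>
lemma pos_def_sqrt_unique:
  assumes X: "X \<in> carrier_mat n n" "pos_def X" and Y: "Y \<in> carrier_mat n n" "pos_def Y"
    and eq: "X * X = Y * Y"
  shows "X = Y"
proof -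
  obtain B P Q where S: "B \<in> carrier_mat n n" "P \<in> carrier_mat n n" "Q \<in> carrier_mat n n"
    "P * Q = 1\<^sub>m n" "Q * P = 1\<^sub>m n" "Y = P * B * Q" "upper_triangular B"
    "\<And>i. i < n \<Longrightarrow> eigenvalue Y (B $$ (i, i))"
    using complex_schur[OF Y(1)] by metis
  have mc: "A *\<^sub>v v \<in> carrier_vec n" if "A \<in> carrier_mat n n" "v \<in> carrier_vec n" for A :: "complex mat" and v
    using that by (rule mult_mat_vec_carrier)
  have YP: "Y *\<^sub>v (P *\<^sub>v x) = P *\<^sub>v (B *\<^sub>v x)" if x: "x \<in> carrier_vec n" for x
  proof -
    have "Y * P = P * B * (Q * P)"
      unfolding S(6) using S by (simp add: assoc_mult_mat[of _ n n _ n _ n])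
    then have "Y * P = P * B" using S by simp
    then have "(Y * P) *\<^sub>v x = (P * B) *\<^sub>v x" by simp
    then show ?thesis using x S Y by (simp add: assoc_mult_mat_vec[of _ n n _ n])
  qed
  have XXYY: "X *\<^sub>v (X *\<^sub>v x) = Y *\<^sub>v (Y *\<^sub>v x)" if "x \<in> carrier_vec n" for x
    using assoc_mult_mat_vec[OF X(1) X(1) that] assoc_mult_mat_vec[OF Y(1) Y(1) that] eq by simp
  \<comment> \<open>The disjointness of spectra is used one Schur vector of Y at a time. If X and Y
    agree on the earlier ones, then z = Xu - Yu satisfies X z = -m z for the diagonal entry m; as Re
    m > 0, positive-definiteness of X leaves only z = 0.\<close>
  have agree: "X *\<^sub>v (P *\<^sub>v v) = Y *\<^sub>v (P *\<^sub>v v)"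
    if "j \<le> n" "v \<in> carrier_vec n" "\<And>i. j \<le> i \<Longrightarrow> i < n \<Longrightarrow> v $ i = 0" for j v
    using that
  proof (induction j arbitrary: v)
    case 0
    then have "v = 0\<^sub>v n" by (intro eq_vecI) auto
    then show ?case using X Y S by (simp add: mult_mat_zero_vec[of _ n n])
  next
    case (Suc j)
    let ?e = "unit_vec n j :: complex vec" and ?m = "B $$ (j, j)"
    have j: "j < n" using Suc by simp
    obtain w where w: "w \<in> carrier_vec n" "\<And>i. j \<le> i \<Longrightarrow> i < n \<Longrightarrow> w $ i = 0"
      "B *\<^sub>v ?e = ?m \<cdot>\<^sub>v ?e + w"
      using upper_triangular_mult_unit_vec[OF S(1,7) j] by blast
    define u where "u = P *\<^sub>v ?e"
    have u: "u \<in> carrier_vec n" and Pw: "P *\<^sub>v w \<in> carrier_vec n"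
      using S w(1) by (auto simp: u_def intro!: mc)
    note uc = mc[OF X(1) u] mc[OF Y(1) u] mc[OF X(1) mc[OF X(1) u]] mc[OF X(1) mc[OF Y(1) u]]
    define z where "z = X *\<^sub>v u - Y *\<^sub>v u"
    have z: "z \<in> carrier_vec n" using uc by (simp add: z_def)
    have Yu: "Y *\<^sub>v u = ?m \<cdot>\<^sub>v u + P *\<^sub>v w"
      unfolding u_def YP[OF unit_vec_carrier] w(3)
      using S(2) w(1) mult_add_distrib_mat_vec[of P n n "?m \<cdot>\<^sub>v ?e" w] by (simp add: mult_mat_vec)
    have mult_Yu: "A *\<^sub>v (Y *\<^sub>v u) = ?m \<cdot>\<^sub>v (A *\<^sub>v u) + A *\<^sub>v (P *\<^sub>v w)" if A: "A \<in> carrier_mat n n" for A :: "complex mat"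
      unfolding Yu using A u Pw mult_add_distrib_mat_vec[of A n n "?m \<cdot>\<^sub>v u" "P *\<^sub>v w"] by (simp add: mult_mat_vec)
    have "X *\<^sub>v (P *\<^sub>v w) = Y *\<^sub>v (P *\<^sub>v w)"
      by (rule Suc.IH) (use j w in auto)
    then have "X *\<^sub>v (Y *\<^sub>v u) = ?m \<cdot>\<^sub>v (X *\<^sub>v u) + Y *\<^sub>v (P *\<^sub>v w)"
      unfolding mult_Yu[OF X(1)] by simp
    moreover have "X *\<^sub>v (X *\<^sub>v u) = ?m \<cdot>\<^sub>v (Y *\<^sub>v u) + Y *\<^sub>v (P *\<^sub>v w)"
      unfolding XXYY[OF u] by (rule mult_Yu[OF Y(1)])
    moreover have "(?m \<cdot>\<^sub>v y + q) - (?m \<cdot>\<^sub>v x + q) = - ?m \<cdot>\<^sub>v (x - y)"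
      if "x \<in> carrier_vec n" "y \<in> carrier_vec n" "q \<in> carrier_vec n" for x y q
      using that by (intro eq_vecI) (auto simp: algebra_simps)
    ultimately have "X *\<^sub>v z = - ?m \<cdot>\<^sub>v z"
      unfolding z_def mult_mat_vec_diff[OF X(1) uc(1,2)] using uc mc[OF Y(1) Pw] by simp
    then have "(X *\<^sub>v z) \<bullet>c z = - ?m * (z \<bullet>c z)" using z by simp
    then have "Re ((X *\<^sub>v z) \<bullet>c z) = - Re ?m * (cvec_norm z)\<^sup>2"
      by (simp add: cscalar_self del: of_real_power)
    moreover have "0 < Re ?m" using eigenvalue_pos_def(1)[OF Y S(8)[OF j]] .
    ultimately have "Re ((X *\<^sub>v z) \<bullet>c z) \<le> 0" by (simp add: mult_nonneg_nonneg less_imp_le)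
    then have "z = 0\<^sub>v n" using pos_defD[OF X z] by force
    then have Xu: "X *\<^sub>v u = Y *\<^sub>v u" unfolding z_def by (rule vec_eq_if_diff_zero[OF uc(1,2)])
    obtain v' where v': "v' \<in> carrier_vec n" "\<And>i. j \<le> i \<Longrightarrow> i < n \<Longrightarrow> v' $ i = 0"
      "v = v' + v $ j \<cdot>\<^sub>v ?e"
      using vec_split_last[OF Suc.prems(2,3) j] by blast
    have split: "A *\<^sub>v (P *\<^sub>v (v' + a \<cdot>\<^sub>v ?e)) = A *\<^sub>v (P *\<^sub>v v') + a \<cdot>\<^sub>v (A *\<^sub>v u)"
      if A: "A \<in> carrier_mat n n" for A :: "complex mat" and a
    proof -
      have "P *\<^sub>v (v' + a \<cdot>\<^sub>v ?e) = P *\<^sub>v v' + a \<cdot>\<^sub>v u"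
        unfolding u_def using S(2) v'(1) mult_add_distrib_mat_vec[of P n n v' "a \<cdot>\<^sub>v ?e"]
        by (simp add: mult_mat_vec)
      then show ?thesis
        using A u mc[OF S(2) v'(1)] mult_add_distrib_mat_vec[of A n n "P *\<^sub>v v'" "a \<cdot>\<^sub>v u"]
        by (simp add: mult_mat_vec)
    qed
    have "X *\<^sub>v (P *\<^sub>v v') = Y *\<^sub>v (P *\<^sub>v v')" by (rule Suc.IH) (use j v' in auto)
    then have "X *\<^sub>v (P *\<^sub>v (v' + v $ j \<cdot>\<^sub>v ?e)) = Y *\<^sub>v (P *\<^sub>v (v' + v $ j \<cdot>\<^sub>v ?e))"
      unfolding split[OF X(1)] split[OF Y(1)] Xu by simp
    then show ?case by (simp flip: v'(3))
  qed
  show ?thesis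
  proof (rule eq_mat_by_mult_vec[OF X(1) Y(1)])
    fix v :: "complex vec" assume v: "v \<in> carrier_vec n"
    have "P *\<^sub>v (Q *\<^sub>v v) = v"
      using assoc_mult_mat_vec[OF S(2,3) v] S(4) v by simp
    then show "X *\<^sub>v v = Y *\<^sub>v v"
      using agree[of n "Q *\<^sub>v v"] mc[OF S(3) v] by simp
  qed
qed

lemma mat_sqrt_eq_sqrt_int:
  assumes M: "M \<in> carrier_mat n n" and pd: "pos_def M"
  shows "mat_sqrt M = sqrt_int M"
  unfolding mat_sqrt_def
proof (rule the_equality)
  obtain c where N: "sectorial n c M" using pos_def_sectorial[OF M pd] .
  show *: "sqrt_int M \<in> carrier_mat (dim_row M) (dim_row M) \<and> pos_def (sqrt_int M) \<and> sqrt_int M * sqrt_int M = M"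
    using M pos_def_sqrt_int[OF M pd] sqrt_int_square[OF N] by auto
  fix X assume "X \<in> carrier_mat (dim_row M) (dim_row M) \<and> pos_def X \<and> X * X = M"
  with * show "X = sqrt_int M" using pos_def_sqrt_unique[of X "dim_row M" "sqrt_int M"] by simp
qed

section \<open>Determinant quotient and largest singular value\<close>

text \<open>A similarity to triangular form commutes with shifts, so one enumeration l serves every
  t; this allows det A and det(A + t) to be divided factor by factor.\<close>

lemma det_shift_mat:
  assumes A: "A \<in> carrier_mat n n"
  obtains l where "\<And>i. i < n \<Longrightarrow> eigenvalue A (l i)"
    "\<And>t. det (shift_mat A t) = (\<Prod>i<n. l i + complex_of_real t)"
proof -
  obtain B P Q where S: "B \<in> carrier_mat n n" "P \<in> carrier_mat n n" "Q \<in> carrier_mat n n"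
    "P * Q = 1\<^sub>m n" "Q * P = 1\<^sub>m n" "A = P * B * Q" "upper_triangular B"
    "\<And>i. i < n \<Longrightarrow> eigenvalue A (B $$ (i, i))"
    using complex_schur[OF A] by metis
  have "det (shift_mat A t) = (\<Prod>i<n. B $$ (i, i) + complex_of_real t)" for t
  proof -
    let ?I = "complex_of_real t \<cdot>\<^sub>m 1\<^sub>m n"
    have "P * (B + ?I) * Q = (P * B + P * ?I) * Q"
      using S by (subst mult_add_distrib_mat[of _ n n _ n]) auto
    also have "\<dots> = P * B * Q + P * ?I * Q"
      using S by (subst add_mult_distrib_mat[of _ n n _ _ n]) auto
    also have "P * ?I = complex_of_real t \<cdot>\<^sub>m P"
      using S mult_smult_distrib[of P n n "1\<^sub>m n" n "complex_of_real t"] by simp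
    also have "complex_of_real t \<cdot>\<^sub>m P * Q = ?I"
      using S mult_smult_assoc_mat[of P n n Q n "complex_of_real t"] by simp
    finally have "shift_mat A t = P * (B + ?I) * Q"
      using A by (simp add: shift_mat_def flip: S(6))
    then have "similar_mat (shift_mat A t) (B + ?I)"
      using S A unfolding similar_mat_def
      by (intro exI[of _ P] exI[of _ Q] similar_mat_witI[of _ _ n]) auto
    then have "det (shift_mat A t) = det (B + ?I)" by (rule det_similar)
    also have "\<dots> = prod_list (diag_mat (B + ?I))"
      by (rule det_upper_triangular[of _ n]) (use S(1,7) in \<open>auto simp: upper_triangular_def\<close>)
    also have "\<dots> = (\<Prod>i<n. B $$ (i, i) + complex_of_real t)"
      using S(1) by (simp add: prod_list_diag_prod lessThan_atLeast0)
    finally show ?thesis .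
  qed
  then show thesis by (intro that[of "\<lambda>i. B $$ (i, i)"] S(8))
qed

lemma powr_minus_half: "0 < x \<Longrightarrow> x powr (- 1 / 2) = 1 / sqrt x" for x :: real
  by (simp add: powr_minus_divide powr_half_sqrt)

text \<open>For each eigenvalue l, Re l > 0 gives |l + t|^2 \<ge> |l|^2 + t^2, and |l| \<le> a turns
  this into |l|^2 (1 + t^2/a^2).\<close>

lemma det_shift_mat_ratio_le:
  assumes A: "A \<in> carrier_mat n n" and pd: "pos_def A" and a: "0 < a"
    and bd: "\<And>v. v \<in> carrier_vec n \<Longrightarrow> cvec_norm (A *\<^sub>v v) \<le> a * cvec_norm v" and t: "0 \<le> t"
  shows "cmod (det A / det (shift_mat A t)) \<le> (1 + t\<^sup>2 / a\<^sup>2) powr (- real n / 2)"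
    and "det (shift_mat A t) \<noteq> 0"
proof -
  obtain l where l: "\<And>i. i < n \<Longrightarrow> eigenvalue A (l i)"
    "\<And>t. det (shift_mat A t) = (\<Prod>i<n. l i + complex_of_real t)"
    using det_shift_mat[OF A] by blast
  let ?D = "1 + t\<^sup>2 / a\<^sup>2"
  have D: "0 < ?D" using a by (simp add: add_pos_nonneg)
  have Re: "0 < Re (l i)" if "i < n" for i using eigenvalue_pos_def(1)[OF A pd l(1)[OF that]] .
  have factor: "cmod (l i / (l i + complex_of_real t)) \<le> ?D powr (- 1 / 2)" if i: "i < n" for i
  proof -
    have la: "cmod (l i) \<le> a" using eigenvalue_pos_def(2)[OF A pd l(1)[OF i] bd] .
    have l0: "0 < cmod (l i)" using Re[OF i] by auto
    have "(cmod (l i))\<^sup>2 * ?D = (cmod (l i))\<^sup>2 + t\<^sup>2 * ((cmod (l i))\<^sup>2 / a\<^sup>2)"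
      by (simp add: algebra_simps)
    also have "\<dots> \<le> (cmod (l i))\<^sup>2 + t\<^sup>2 * 1"
      using la a by (intro add_left_mono mult_left_mono) (auto simp: divide_le_eq_1 intro: power_mono)
    also have "\<dots> \<le> (cmod (l i + complex_of_real t))\<^sup>2"
      using Re[OF i] t unfolding cmod_power2 by (simp add: power2_eq_square algebra_simps)
    finally have "(cmod (l i) * sqrt ?D)\<^sup>2 \<le> (cmod (l i + complex_of_real t))\<^sup>2"
      using D by (simp add: power_mult_distrib)
    then have "cmod (l i) * sqrt ?D \<le> cmod (l i + complex_of_real t)"
      by (rule power2_le_imp_le) simp
    then have "cmod (l i) / cmod (l i + complex_of_real t) \<le> 1 / sqrt ?D"
    proof -
      have "0 < cmod (l i) * sqrt ?D" using l0 D by simp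
      then have "0 < cmod (l i + complex_of_real t)" using \<open>cmod (l i) * sqrt ?D \<le> _\<close> by linarith
      then show ?thesis using D \<open>cmod (l i) * sqrt ?D \<le> _\<close> by (simp add: pos_divide_le_eq pos_le_divide_eq)
    qed
    then show ?thesis unfolding powr_minus_half[OF D] norm_divide .
  qed
  show nz: "det (shift_mat A t) \<noteq> 0"
  proof -
    have "l i + complex_of_real t \<noteq> 0" if "i < n" for i
      using Re[OF that] t by (auto simp: complex_eq_iff)
    then show ?thesis unfolding l(2) by simp
  qed
  have "shift_mat A 0 = A" using A by (intro eq_matI) (auto simp: shift_mat_def)
  then have "det A / det (shift_mat A t) = (\<Prod>i<n. l i / (l i + complex_of_real t))"
    using l(2)[of 0] by (simp add: l(2) prod_dividef)
  then have "cmod (det A / det (shift_mat A t)) = (\<Prod>i<n. cmod (l i / (l i + complex_of_real t)))"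
    by (simp add: prod_norm)
  also have "\<dots> \<le> (\<Prod>i<n. ?D powr (- 1 / 2))"
    using factor by (intro prod_mono) auto
  also have "\<dots> = ?D powr (- real n / 2)"
    using D by (simp add: powr_powr flip: powr_realpow)
  finally show "cmod (det A / det (shift_mat A t)) \<le> ?D powr (- real n / 2)" .
qed

text \<open>The vector version of the eigenvalue factor. As M commutes with its resolvent, the left
  side is ||Mz|| for z = (M + t)^-1 x; then ||x||^2 \<ge> ||Mz||^2 + t^2 ||z||^2 and ||z|| \<ge>
  ||Mz||/a.\<close>

lemma resolvent_mult_norm_le:
  assumes M: "M \<in> carrier_mat n n" and pd: "pos_def M" and a: "0 < a"
    and bd: "\<And>v. v \<in> carrier_vec n \<Longrightarrow> cvec_norm (M *\<^sub>v v) \<le> a * cvec_norm v"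
    and t: "0 \<le> t" and x: "x \<in> carrier_vec n"
  shows "cvec_norm (resolvent M t *\<^sub>v (M *\<^sub>v x)) \<le> (1 + t\<^sup>2 / a\<^sup>2) powr (- 1 / 2) * cvec_norm x"
proof -
  obtain c where N: "sectorial n c M" using pos_def_sectorial[OF M pd] .
  note R = sectorial_resolvent[OF N t]
  let ?D = "1 + t\<^sup>2 / a\<^sup>2"
  have D: "0 < ?D" using a by (simp add: add_pos_nonneg)
  define z where "z = resolvent M t *\<^sub>v x"
  have z: "z \<in> carrier_vec n" using R(2)[OF x] by (simp add: z_def)
  have Mz: "M *\<^sub>v z \<in> carrier_vec n" using M z by (rule mult_mat_vec_carrier)
  have sx: "shift_mat M t *\<^sub>v z = x" using R(3)[OF x] by (simp add: z_def)
  have "M *\<^sub>v x = shift_mat M t *\<^sub>v (M *\<^sub>v z)"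
    unfolding sx[symmetric] shift_mat_mult_vec[OF M z] shift_mat_mult_vec[OF M Mz]
    using M z Mz mult_add_distrib_mat_vec[of M n n "M *\<^sub>v z" "complex_of_real t \<cdot>\<^sub>v z"]
    by (simp add: mult_mat_vec)
  then have y: "resolvent M t *\<^sub>v (M *\<^sub>v x) = M *\<^sub>v z" using R(4)[OF Mz] by simp
  have "(cvec_norm (M *\<^sub>v z))\<^sup>2 \<le> (a * cvec_norm z)\<^sup>2"
    by (rule power_mono[OF bd[OF z]]) simp
  then have "(cvec_norm (M *\<^sub>v z))\<^sup>2 / a\<^sup>2 \<le> (cvec_norm z)\<^sup>2"
    using a by (simp add: power_mult_distrib divide_le_eq mult.commute)
  then have "t\<^sup>2 * ((cvec_norm (M *\<^sub>v z))\<^sup>2 / a\<^sup>2) \<le> t\<^sup>2 * (cvec_norm z)\<^sup>2"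
    by (rule mult_left_mono) simp
  then have "(cvec_norm (M *\<^sub>v z))\<^sup>2 * ?D \<le> (cvec_norm (M *\<^sub>v z))\<^sup>2 + t\<^sup>2 * (cvec_norm z)\<^sup>2"
    by (simp add: algebra_simps)
  also have "\<dots> \<le> (cvec_norm x)\<^sup>2" using pos_def_shift_norm[OF M pd z t] by (simp add: sx)
  finally have "(cvec_norm (M *\<^sub>v z) * sqrt ?D)\<^sup>2 \<le> (cvec_norm x)\<^sup>2"
    using D by (simp add: power_mult_distrib)
  then have "cvec_norm (M *\<^sub>v z) * sqrt ?D \<le> cvec_norm x"
    by (rule power2_le_imp_le) simp
  then have "cvec_norm (M *\<^sub>v z) \<le> cvec_norm x / sqrt ?D"
    using D by (simp add: pos_le_divide_eq)
  then show ?thesis unfolding y powr_minus_half[OF D] by simp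
qed

section \<open>The largest singular value as operator norm\<close>

text \<open>The squares are roots of a nonzero characteristic polynomial. This is what gives
  \<open>Max\<close> in \<open>sigma_max\<close> its meaning.\<close>

lemma finite_singular_values:
  assumes M: "M \<in> carrier_mat n n"
  shows "finite (singular_values M)"
proof (rule finite_imageD)
  let ?A = "mat_adjoint M * M"
  have A: "?A \<in> carrier_mat n n" using M by auto
  have "char_poly ?A \<noteq> 0" using degree_monic_char_poly[OF A] by auto
  then have "finite {x. poly (char_poly ?A) x = 0}" by (rule poly_roots_finite)
  then show "finite ((\<lambda>s. complex_of_real (s\<^sup>2)) ` singular_values M)"
    by (rule rev_finite_subset) (auto simp: singular_values_def eigenvalue_root_char_poly[OF A])
  show "inj_on (\<lambda>s. complex_of_real (s\<^sup>2)) (singular_values M)"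
    by (rule inj_onI) (auto simp: singular_values_def power2_eq_iff_nonneg simp del: of_real_power)
qed

text \<open>The least \<open>\<mu>\<close> with \<open>\<parallel>M x\<parallel>\<^sup>2 \<le> \<mu> \<parallel>x\<parallel>\<^sup>2\<close> for all \<open>x\<close> is an eigenvalue of \<open>M\<^sup>* M\<close>: otherwise
  \<open>\<mu> - M\<^sup>* M\<close> would be bounded below and \<open>\<mu>\<close> could be decreased.\<close>
lemma sigma_max_bound:
  assumes M: "M \<in> carrier_mat n n" and n: "0 < n"
  shows "0 \<le> sigma_max M"
    and "x \<in> carrier_vec n \<Longrightarrow> cvec_norm (M *\<^sub>v x) \<le> sigma_max M * cvec_norm x"
proof -
  define S where "S = {m. \<forall>x\<in>carrier_vec n. (cvec_norm (M *\<^sub>v x))\<^sup>2 \<le> m * (cvec_norm x)\<^sup>2}"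
  obtain K where K: "0 \<le> K" "\<And>v. v \<in> carrier_vec n \<Longrightarrow> cvec_norm (M *\<^sub>v v) \<le> K * cvec_norm v"
    using mat_vec_norm_bounded[OF M] by blast
  have KS: "K\<^sup>2 \<in> S"
    unfolding S_def using power_mono[OF K(2) cvec_norm_nonneg, of _ 2] by (simp add: power_mult_distrib)
  have S0: "0 \<le> m" if "m \<in> S" for m
  proof -
    have "(cvec_norm (M *\<^sub>v unit_vec n 0))\<^sup>2 \<le> m * (cvec_norm (unit_vec n 0))\<^sup>2"
      using that unfolding S_def by auto
    then have "(cvec_norm (M *\<^sub>v unit_vec n 0))\<^sup>2 \<le> m" using cvec_norm_unit_vec[OF n] by simp
    then show ?thesis using zero_le_power2[of "cvec_norm (M *\<^sub>v unit_vec n 0)"] by linarith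
  qed
  have bdd: "bdd_below S" using S0 by (rule bdd_belowI)
  define m where "m = Inf S"
  have m0: "0 \<le> m" unfolding m_def using KS S0 by (intro cInf_greatest) auto
  \<comment> \<open>The infimum is attained: every quotient ||Mx||^2/||x||^2 is a lower bound of
    S.\<close>
  have mS: "(cvec_norm (M *\<^sub>v x))\<^sup>2 \<le> m * (cvec_norm x)\<^sup>2" if x: "x \<in> carrier_vec n" for x
  proof (cases "cvec_norm x = 0")
    case True
    then show ?thesis using K(2)[OF x] by (simp add: order.antisym[OF _ cvec_norm_nonneg])
  next
    case False
    have "(cvec_norm (M *\<^sub>v x))\<^sup>2 / (cvec_norm x)\<^sup>2 \<le> m"
      unfolding m_def using KS False x by (intro cInf_greatest) (auto simp: S_def divide_le_eq)
    then show ?thesis using False by (simp add: divide_le_eq)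
  qed
  let ?A = "mat_adjoint M * M"
  have A: "?A \<in> carrier_mat n n" using M by auto
  have Ax: "?A *\<^sub>v x = mat_adjoint M *\<^sub>v (M *\<^sub>v x)" if "x \<in> carrier_vec n" for x
    using M that by (intro assoc_mult_mat_vec) auto
  let ?T = "shift_mat ?A (- m)"
  have T: "?T \<in> carrier_mat n n" using A by auto
  have ev: "eigenvalue ?A (complex_of_real m)"
  proof (rule ccontr)
    assume no: "\<not> eigenvalue ?A (complex_of_real m)"
    have inj: "x = 0\<^sub>v n" if x: "x \<in> carrier_vec n" "?T *\<^sub>v x = 0\<^sub>v n" for x
    proof (rule ccontr)
      assume "x \<noteq> 0\<^sub>v n"
      moreover have "?A *\<^sub>v x = complex_of_real m \<cdot>\<^sub>v x"
      proof (rule eq_vecI)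
        fix i assume "i < dim_vec (complex_of_real m \<cdot>\<^sub>v x)"
        then have i: "i < n" using x by simp
        have "(?A *\<^sub>v x + complex_of_real (- m) \<cdot>\<^sub>v x) $ i = 0\<^sub>v n $ i"
          using x(2) unfolding shift_mat_mult_vec[OF A x(1)] by simp
        then show "(?A *\<^sub>v x) $ i = (complex_of_real m \<cdot>\<^sub>v x) $ i"
          using i x(1) A by simp
      qed (use A x in auto)
      ultimately have "eigenvalue ?A (complex_of_real m)"
        using x M unfolding eigenvalue_def eigenvector_def by auto
      with no show False ..
    qed
    obtain L where L: "0 \<le> L" "\<And>v. v \<in> carrier_vec n \<Longrightarrow> cvec_norm (mat_inv ?T *\<^sub>v v) \<le> L * cvec_norm v"
      using mat_vec_norm_bounded[OF mat_inv(1)[OF T inj]] by blast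
    define q where "q x = m * (cvec_norm x)\<^sup>2 - (cvec_norm (M *\<^sub>v x))\<^sup>2" for x
    \<comment> \<open>Chosen from ||x|| \<le> L ||Tx|| and ||Tx||^2 \<le> (m + 1) q(x), shown below;
      the added 1 covers L = 0.\<close>
    define d where "d = 1 / ((m + 1) * L\<^sup>2 + 1)"
    have d: "0 < d" using m0 by (simp add: d_def add_nonneg_pos)
    have "d * (cvec_norm x)\<^sup>2 \<le> q x" if x: "x \<in> carrier_vec n" for x
    proof -
      define y where "y = ?T *\<^sub>v x"
      have y: "y \<in> carrier_vec n" unfolding y_def using T x by (rule mult_mat_vec_carrier)
      have Mx: "M *\<^sub>v x \<in> carrier_vec n" and My: "M *\<^sub>v y \<in> carrier_vec n"
        using M x y by (auto intro: mult_mat_vec_carrier)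
      \<comment> \<open>A step from x along y = Tx changes q by -2s ||y||^2 + s^2 q(y). Since q
        stays nonnegative and s m \<le> 1, this forces q(x) \<ge> s ||y||^2.\<close>
      define s where "s = 1 / (m + 1)"
      have s: "0 < s" "s * m \<le> 1" using m0 by (auto simp: s_def field_simps)
      have sy: "complex_of_real s \<cdot>\<^sub>v y \<in> carrier_vec n" using y by simp
      have e1: "(cvec_norm (x + complex_of_real s \<cdot>\<^sub>v y))\<^sup>2
          = (cvec_norm x)\<^sup>2 + 2 * (s * Re (x \<bullet>c y)) + s\<^sup>2 * (cvec_norm y)\<^sup>2"
        using cvec_norm_add_power2[OF x sy] x y
        by (simp add: conjugate_smult_vec conjugate_complex_def cvec_norm_smult power_mult_distrib)
      have "M *\<^sub>v (x + complex_of_real s \<cdot>\<^sub>v y) = M *\<^sub>v x + complex_of_real s \<cdot>\<^sub>v (M *\<^sub>v y)"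
        using M x y mult_add_distrib_mat_vec[OF M x sy] by (simp add: mult_mat_vec)
      then have e2: "(cvec_norm (M *\<^sub>v (x + complex_of_real s \<cdot>\<^sub>v y)))\<^sup>2
          = (cvec_norm (M *\<^sub>v x))\<^sup>2 + 2 * (s * Re ((M *\<^sub>v x) \<bullet>c (M *\<^sub>v y))) + s\<^sup>2 * (cvec_norm (M *\<^sub>v y))\<^sup>2"
        using cvec_norm_add_power2[OF Mx, of "complex_of_real s \<cdot>\<^sub>v (M *\<^sub>v y)"] Mx My
        by (simp add: conjugate_smult_vec conjugate_complex_def cvec_norm_smult power_mult_distrib)
      have "(M *\<^sub>v x) \<bullet>c (M *\<^sub>v y) = (?A *\<^sub>v x) \<bullet>c y"
      proof -
        have "(M *\<^sub>v y) \<bullet>c (M *\<^sub>v x) = y \<bullet>c (?A *\<^sub>v x)"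
          unfolding Ax[OF x] by (rule cscalar_mat_adjoint[OF M y Mx])
        then show ?thesis
          using cscalar_commute[OF My Mx] cscalar_commute[OF y, of "?A *\<^sub>v x"] mult_mat_vec_carrier[OF A x] by simp
      qed
      moreover have "y \<bullet>c y = (?A *\<^sub>v x) \<bullet>c y - complex_of_real m * (x \<bullet>c y)"
      proof -
        have "y \<bullet>c y = (?A *\<^sub>v x + complex_of_real (- m) \<cdot>\<^sub>v x) \<bullet>c y"
          unfolding y_def shift_mat_mult_vec[OF A x] ..
        then show ?thesis
          using x y mult_mat_vec_carrier[OF A x] by (simp add: add_scalar_prod_distrib[of _ n])
      qed
      ultimately have e3: "(cvec_norm y)\<^sup>2 = Re ((M *\<^sub>v x) \<bullet>c (M *\<^sub>v y)) - m * Re (x \<bullet>c y)"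
        by (simp add: cscalar_self complex_eq_iff del: of_real_power)
      have "0 \<le> q (x + complex_of_real s \<cdot>\<^sub>v y)"
        using mS[of "x + complex_of_real s \<cdot>\<^sub>v y"] x sy by (simp add: q_def)
      also have "\<dots> = q x - 2 * (s * (cvec_norm y)\<^sup>2) + s\<^sup>2 * q y"
        unfolding q_def e1 e2 e3 by (simp add: algebra_simps)
      also have "\<dots> \<le> q x - 2 * (s * (cvec_norm y)\<^sup>2) + s\<^sup>2 * (m * (cvec_norm y)\<^sup>2)"
        by (intro add_left_mono mult_left_mono) (auto simp: q_def)
      also have "s\<^sup>2 * (m * (cvec_norm y)\<^sup>2) = (s * m) * (s * (cvec_norm y)\<^sup>2)"
        by (simp add: power2_eq_square)
      also have "\<dots> \<le> 1 * (s * (cvec_norm y)\<^sup>2)"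
        using s by (intro mult_right_mono) auto
      finally have qy: "s * (cvec_norm y)\<^sup>2 \<le> q x" by simp
      have "cvec_norm x \<le> L * cvec_norm y"
        using L(2)[OF y] mat_inv_mult_vec(3)[OF T inj x] by (simp add: y_def)
      then have "(cvec_norm x)\<^sup>2 \<le> L\<^sup>2 * (cvec_norm y)\<^sup>2"
        using power_mono[of "cvec_norm x" "L * cvec_norm y" 2] by (simp add: power_mult_distrib)
      also have "\<dots> = (m + 1) * L\<^sup>2 * (s * (cvec_norm y)\<^sup>2)" using m0 by (simp add: s_def)
      also have "\<dots> \<le> (m + 1) * L\<^sup>2 * q x" using m0 qy by (intro mult_left_mono) auto
      also have "\<dots> \<le> ((m + 1) * L\<^sup>2 + 1) * q x"
        using mS[OF x] by (simp add: distrib_right q_def)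
      finally show ?thesis
        unfolding d_def using m0 by (simp add: divide_le_eq add_nonneg_pos mult.commute)
    qed
    then have "m - d \<in> S" by (auto simp: S_def q_def algebra_simps)
    then have "m \<le> m - d" unfolding m_def by (intro cInf_lower bdd)
    with d show False by simp
  qed
  have sv: "sqrt m \<in> singular_values M"
    using ev m0 by (simp add: singular_values_def del: of_real_power)
  then have le: "sqrt m \<le> sigma_max M"
    unfolding sigma_max_def by (intro Max_ge finite_singular_values[OF M])
  then show s0: "0 \<le> sigma_max M" using m0 real_sqrt_ge_zero order_trans by blast
  assume x: "x \<in> carrier_vec n"
  show "cvec_norm (M *\<^sub>v x) \<le> sigma_max M * cvec_norm x"
  proof (rule power2_le_imp_le)
    have "m \<le> (sigma_max M)\<^sup>2" using le m0 s0 by (metis power_mono real_sqrt_ge_zero real_sqrt_pow2)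
    then have "m * (cvec_norm x)\<^sup>2 \<le> (sigma_max M * cvec_norm x)\<^sup>2"
      unfolding power_mult_distrib by (rule mult_right_mono) simp
    then show "(cvec_norm (M *\<^sub>v x))\<^sup>2 \<le> (sigma_max M * cvec_norm x)\<^sup>2"
      using mS[OF x] by linarith
  qed (use s0 in simp)
qed

section \<open>The Arnoldi process\<close>

lemma shift_mat_0: "A \<in> carrier_mat n n \<Longrightarrow> shift_mat A 0 = A"
  by (intro eq_matI) (auto simp: shift_mat_def)

lemma arnoldi_carrier:
  "M \<in> carrier_mat n n \<Longrightarrow> b \<in> carrier_vec n \<Longrightarrow> arnoldi_q M b j \<in> carrier_vec n"
  "M \<in> carrier_mat n n \<Longrightarrow> b \<in> carrier_vec n \<Longrightarrow> arnoldi_w M b j' i \<in> carrier_vec n"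
  by (induction M b j and M b j' i rule: arnoldi_q_arnoldi_w.induct) auto

context
  fixes M :: "complex mat" and b :: "complex vec" and n k :: nat
  assumes M: "M \<in> carrier_mat n n" and pd: "pos_def M"
    and b: "b \<in> carrier_vec n" "b \<noteq> 0\<^sub>v n" and k: "2 \<le> k" and df: "arnoldi_defined M b k"
begin

abbreviation (input) "q \<equiv> arnoldi_q M b"
abbreviation (input) "w \<equiv> arnoldi_w M b"
abbreviation (input) "Q \<equiv> arnoldi_Q M b k"
abbreviation (input) "H \<equiv> arnoldi_H M b k"
abbreviation (input) "be \<equiv> complex_of_real (cvec_norm b) \<cdot>\<^sub>v unit_vec k 0"

section \<open>Orthonormality of the Arnoldi basis\<close>

lemma arnoldi_q_carrier: "q j \<in> carrier_vec n" and arnoldi_w_carrier: "w j i \<in> carrier_vec n"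
  using arnoldi_carrier[OF M b(1)] by auto

lemma norm_b_pos: "0 < cvec_norm b"
  using b cvec_norm_eq_0_iff[OF b(1)] cvec_norm_nonneg[of b] by linarith

text \<open>Modified Gram-Schmidt: subtraction i removes the component along q_i and keeps the zeros
  obtained before. Orthonormality is assumed only up to m, so that the lemma can feed the induction
  that proves it.\<close>

lemma arnoldi_w_orthogonal:
  assumes on: "\<And>i j. i \<in> {1..m} \<Longrightarrow> j \<in> {1..m} \<Longrightarrow> q i \<bullet>c q j = (if i = j then 1 else 0)"
  shows "i \<le> m \<Longrightarrow> l \<in> {1..i} \<Longrightarrow> w j i \<bullet>c q l = 0"
proof (induction i)
  case (Suc i)
  have "w j (Suc i) \<bullet>c q l = w j i \<bullet>c q l - (w j i \<bullet>c q (Suc i)) * (q (Suc i) \<bullet>c q l)"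
    using arnoldi_q_carrier[of l] arnoldi_q_carrier[of "Suc i"] arnoldi_w_carrier[of j i]
    by (simp add: minus_scalar_prod_distrib[of _ n])
  also have "\<dots> = 0"
  proof (cases "l = Suc i")
    case True
    then show ?thesis using on[of "Suc i" "Suc i"] Suc.prems by simp
  next
    case False
    then show ?thesis using on[of "Suc i" l] Suc by auto
  qed
  finally show ?case .
qed simp

text \<open>Induction on the number m of vectors; \<open>arnoldi_defined\<close> makes every
  normalisation up to q_k a division by a nonzero norm.\<close>

lemma arnoldi_q_orthonormal:
  assumes "i \<in> {1..k}" "j \<in> {1..k}"
  shows "q i \<bullet>c q j = (if i = j then 1 else 0)"
proof -
  have "\<forall>i\<in>{1..m}. \<forall>j\<in>{1..m}. q i \<bullet>c q j = (if i = j then 1 else 0)" if "m \<le> k" for m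
    using that
  proof (induction m)
    case (Suc m)
    then have IH: "\<And>i j. i \<in> {1..m} \<Longrightarrow> j \<in> {1..m} \<Longrightarrow> q i \<bullet>c q j = (if i = j then 1 else 0)" by auto
    have unit: "cvec_norm (q (Suc m)) = 1"
    proof (cases m)
      case 0
      then show ?thesis using norm_b_pos by (simp add: cvec_norm_smult norm_divide)
    next
      case (Suc j)
      have "arnoldi_h M b (m + 1) m \<noteq> 0"
        using df Suc Suc.prems \<open>Suc m \<le> k\<close> unfolding arnoldi_defined_def by auto
      then have "cvec_norm (w m m) \<noteq> 0" by (simp add: arnoldi_h_def)
      then show ?thesis using Suc by (simp add: cvec_norm_smult norm_divide)
    qed
    then have self: "q (Suc m) \<bullet>c q (Suc m) = 1" by (simp add: cscalar_self)
    have orth: "q (Suc m) \<bullet>c q l = 0" if l: "l \<in> {1..m}" for l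
    proof -
      obtain j where m: "m = Suc j" using l by (cases m) auto
      have "w m m \<bullet>c q l = 0" using arnoldi_w_orthogonal[OF IH order_refl l] .
      then show ?thesis using arnoldi_q_carrier[of l] arnoldi_w_carrier[of m m] by (simp add: m)
    qed
    have orth': "q l \<bullet>c q (Suc m) = 0" if "l \<in> {1..m}" for l
      using cscalar_commute[OF arnoldi_q_carrier[of "Suc m"] arnoldi_q_carrier[of l]] orth[OF that] by simp
    show ?case
    proof (intro ballI)
      fix i j assume "i \<in> {1..Suc m}" "j \<in> {1..Suc m}"
      then consider "i = Suc m" "j = Suc m" | "i = Suc m" "j \<in> {1..m}" | "i \<in> {1..m}" "j = Suc m"
        | "i \<in> {1..m}" "j \<in> {1..m}" by (auto simp: le_Suc_eq)
      then show "q i \<bullet>c q j = (if i = j then 1 else 0)"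
        by cases (use self orth orth' IH in auto)
    qed
  qed simp
  then show ?thesis using assms by blast
qed

text \<open>The unnormalised \<open>w k k\<close> stands for h_{k+1,k} q_{k+1}. A breakdown at step
  k, where it vanishes, thus needs no separate treatment.\<close>

lemma arnoldi_w_last_orthogonal: "l \<in> {1..k} \<Longrightarrow> w k k \<bullet>c q l = 0"
  using arnoldi_w_orthogonal[OF arnoldi_q_orthonormal order_refl] by blast

lemma arnoldi_Q_carrier: "Q \<in> carrier_mat n k" and arnoldi_H_carrier: "H \<in> carrier_mat k k"
  using b by (auto simp: arnoldi_Q_def arnoldi_H_def)

lemma arnoldi_Q_index: "i < n \<Longrightarrow> j < k \<Longrightarrow> Q $$ (i, j) = q (Suc j) $ i"
  using b by (auto simp: arnoldi_Q_def mat_of_cols_index simp del: upt_Suc)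

lemma col_arnoldi_Q: "j < k \<Longrightarrow> col Q j = q (Suc j)"
  using arnoldi_Q_carrier carrier_vecD[OF arnoldi_q_carrier[of "Suc j"]] by (intro eq_vecI) (auto simp: arnoldi_Q_index)

lemma arnoldi_H_index: "i < k \<Longrightarrow> j < k \<Longrightarrow> H $$ (i, j) = arnoldi_h M b (Suc i) (Suc j)"
  by (simp add: arnoldi_H_def)

section \<open>The Arnoldi relation and the compression of M\<close>

lemma arnoldi_w_index:
  assumes r: "r < n"
  shows "w j i $ r = (M *\<^sub>v q j) $ r - (\<Sum>l<i. (w j l \<bullet>c q (Suc l)) * q (Suc l) $ r)"
proof (induction i)
  case (Suc i)
  have "w j (Suc i) $ r = w j i $ r - (w j i \<bullet>c q (Suc i)) * q (Suc i) $ r"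
    using r arnoldi_q_carrier[of "Suc i"] arnoldi_w_carrier[of j i] by simp
  then show ?case unfolding Suc.IH by simp
qed simp

text \<open>Unrolling the recursion writes M q_j as its projections plus a remainder. The remainder
  is h_{j+1,j} q_{j+1} and belongs to Q H, except in the last column, which is k - 1 because matrix
  indices start at 0.\<close>

lemma arnoldi_relation:
  "M * Q = Q * H + mat n k (\<lambda>(r, j). if j = k - 1 then w k k $ r else 0)"
proof (rule eq_matI)
  let ?W = "mat n k (\<lambda>(r, j). if j = k - 1 then w k k $ r else 0)"
  fix r j assume "r < dim_row (Q * H + ?W)" "j < dim_col (Q * H + ?W)"
  then have rj: "r < n" "j < k" by auto
  let ?f = "\<lambda>i. q (Suc i) $ r * arnoldi_h M b (Suc i) (Suc j)"
  have "(M * Q) $$ (r, j) = (M *\<^sub>v q (Suc j)) $ r"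
    using rj M arnoldi_Q_carrier by (simp add: col_arnoldi_Q)
  also have "\<dots> = (\<Sum>i<Suc j. ?f i) + w (Suc j) (Suc j) $ r"
    unfolding arnoldi_w_index[OF rj(1), of "Suc j" "Suc j"] by (simp add: arnoldi_h_def mult.commute)
  also have "\<dots> = (\<Sum>i<k. ?f i) + (if j = k - 1 then w k k $ r else 0)"
  proof (cases "j = k - 1")
    case True
    then show ?thesis using k by simp
  next
    case False
    then have j: "Suc (Suc j) \<le> k" using rj by simp
    have nz: "cvec_norm (w (Suc j) (Suc j)) \<noteq> 0"
      using df j unfolding arnoldi_defined_def by (auto simp: arnoldi_h_def dest!: spec[of _ "Suc j"])
    have "(\<Sum>i<k. ?f i) = (\<Sum>i<Suc (Suc j). ?f i)"
      using j by (intro sum.mono_neutral_right) (auto simp: arnoldi_h_def)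
    also have "\<dots> = (\<Sum>i<Suc j. ?f i) + q (Suc (Suc j)) $ r * arnoldi_h M b (Suc (Suc j)) (Suc j)"
      by simp
    also have "q (Suc (Suc j)) $ r * arnoldi_h M b (Suc (Suc j)) (Suc j) = w (Suc j) (Suc j) $ r"
    proof -
      have scale: "(complex_of_real (1 / c) \<cdot>\<^sub>v v) $ r * complex_of_real c = v $ r"
        if "c \<noteq> 0" "v \<in> carrier_vec n" for c v
        using that rj by simp
      have h: "arnoldi_h M b (Suc (Suc j)) (Suc j) = complex_of_real (cvec_norm (w (Suc j) (Suc j)))"
        by (simp add: arnoldi_h_def)
      show ?thesis unfolding h arnoldi_q.simps(3) by (rule scale[OF nz arnoldi_w_carrier])
    qed
    finally show ?thesis using False by simp
  qed
  also have "(\<Sum>i<k. ?f i) = (Q * H) $$ (r, j)"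
    using rj arnoldi_Q_carrier arnoldi_H_carrier
    by (auto simp: scalar_prod_def lessThan_atLeast0 arnoldi_Q_index arnoldi_H_index intro!: sum.cong)
  finally show "(M * Q) $$ (r, j) = (Q * H + ?W) $$ (r, j)"
    using rj arnoldi_Q_carrier arnoldi_H_carrier by simp
qed (use M arnoldi_Q_carrier arnoldi_H_carrier in auto)

lemma arnoldi_Q_mult_vec_carrier: "y \<in> carrier_vec k \<Longrightarrow> Q *\<^sub>v y \<in> carrier_vec n"
  using arnoldi_Q_carrier by (rule mult_mat_vec_carrier)

lemma arnoldi_H_mult_vec_carrier: "y \<in> carrier_vec k \<Longrightarrow> H *\<^sub>v y \<in> carrier_vec k"
  using arnoldi_H_carrier by (rule mult_mat_vec_carrier)

lemma adjoint_arnoldi_Q_mult_vec_carrier: "v \<in> carrier_vec n \<Longrightarrow> mat_adjoint Q *\<^sub>v v \<in> carrier_vec k"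
  using mat_adjoint_carrier[OF arnoldi_Q_carrier] by (rule mult_mat_vec_carrier)

lemma arnoldi_relation_mult_vec:
  assumes y: "y \<in> carrier_vec k"
  shows "M *\<^sub>v (Q *\<^sub>v y) = Q *\<^sub>v (H *\<^sub>v y) + y $ (k - 1) \<cdot>\<^sub>v w k k"
proof -
  let ?W = "mat n k (\<lambda>(r, j). if j = k - 1 then w k k $ r else 0)"
  have "M *\<^sub>v (Q *\<^sub>v y) = (M * Q) *\<^sub>v y"
    using assoc_mult_mat_vec[OF M arnoldi_Q_carrier y] by simp
  also have "\<dots> = (Q * H) *\<^sub>v y + ?W *\<^sub>v y"
    unfolding arnoldi_relation using arnoldi_Q_carrier arnoldi_H_carrier y by (intro add_mult_distrib_mat_vec[of _ n k]) auto
  also have "(Q * H) *\<^sub>v y = Q *\<^sub>v (H *\<^sub>v y)"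
    using arnoldi_Q_carrier arnoldi_H_carrier y by (rule assoc_mult_mat_vec)
  also have "?W *\<^sub>v y = y $ (k - 1) \<cdot>\<^sub>v w k k"
  proof (rule eq_vecI)
    fix r assume "r < dim_vec (y $ (k - 1) \<cdot>\<^sub>v w k k)"
    then have r: "r < n" using arnoldi_w_carrier[of k k] by simp
    have "(?W *\<^sub>v y) $ r = (\<Sum>j<k. (if j = k - 1 then w k k $ r else 0) * y $ j)"
      using r y by (auto simp: scalar_prod_def lessThan_atLeast0 intro!: sum.cong)
    also have "\<dots> = (\<Sum>j<k. if j = k - 1 then w k k $ r * y $ j else 0)"
      by (rule sum.cong) auto
    also have "\<dots> = w k k $ r * y $ (k - 1)" using k by simp
    finally show "(?W *\<^sub>v y) $ r = (y $ (k - 1) \<cdot>\<^sub>v w k k) $ r"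
      using r arnoldi_w_carrier[of k k] by simp
  qed (use arnoldi_w_carrier[of k k] in simp)
  finally show ?thesis .
qed

lemma adjoint_arnoldi_Q_index:
  assumes v: "v \<in> carrier_vec n" and i: "i < k"
  shows "(mat_adjoint Q *\<^sub>v v) $ i = v \<bullet>c q (Suc i)"
proof -
  have "(mat_adjoint Q *\<^sub>v v) $ i = (\<Sum>r<n. cnj (q (Suc i) $ r) * v $ r)"
    using assms arnoldi_Q_carrier by (auto simp: scalar_prod_def lessThan_atLeast0 index_mat_adjoint arnoldi_Q_index
        conjugate_complex_def intro!: sum.cong)
  also have "\<dots> = v \<bullet>c q (Suc i)"
    using arnoldi_q_carrier[of "Suc i"] by (auto simp: scalar_prod_def lessThan_atLeast0
        conjugate_complex_def mult.commute intro!: sum.cong)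
  finally show ?thesis .
qed

lemma adjoint_arnoldi_Q_cancel:
  assumes y: "y \<in> carrier_vec k"
  shows "mat_adjoint Q *\<^sub>v (Q *\<^sub>v y) = y"
proof -
  have "mat_adjoint Q * Q = 1\<^sub>m k"
  proof (rule eq_matI)
    fix i j assume "i < dim_row (1\<^sub>m k)" "j < dim_col (1\<^sub>m k)"
    then have ij: "i < k" "j < k" by auto
    have "(mat_adjoint Q * Q) $$ (i, j) = (mat_adjoint Q *\<^sub>v col Q j) $ i"
      using ij arnoldi_Q_carrier by simp
    also have "\<dots> = q (Suc j) \<bullet>c q (Suc i)"
      unfolding col_arnoldi_Q[OF ij(2)] by (rule adjoint_arnoldi_Q_index[OF arnoldi_q_carrier ij(1)])
    also have "\<dots> = 1\<^sub>m k $$ (i, j)" using arnoldi_q_orthonormal[of "Suc j" "Suc i"] ij by simp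
    finally show "(mat_adjoint Q * Q) $$ (i, j) = 1\<^sub>m k $$ (i, j)" .
  qed (use arnoldi_Q_carrier in auto)
  then show ?thesis
    using assoc_mult_mat_vec[OF mat_adjoint_carrier[OF arnoldi_Q_carrier] arnoldi_Q_carrier y] y by simp
qed

lemma cscalar_arnoldi_Q: "y \<in> carrier_vec k \<Longrightarrow> v \<in> carrier_vec n \<Longrightarrow> (Q *\<^sub>v y) \<bullet>c v = y \<bullet>c (mat_adjoint Q *\<^sub>v v)"
  by (rule cscalar_mat_adjoint[OF arnoldi_Q_carrier])

lemma cvec_norm_arnoldi_Q:
  assumes y: "y \<in> carrier_vec k"
  shows "cvec_norm (Q *\<^sub>v y) = cvec_norm y"
proof -
  have "(Q *\<^sub>v y) \<bullet>c (Q *\<^sub>v y) = y \<bullet>c y"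
    using cscalar_arnoldi_Q[OF y arnoldi_Q_mult_vec_carrier[OF y]] adjoint_arnoldi_Q_cancel[OF y] by simp
  then have "(cvec_norm (Q *\<^sub>v y))\<^sup>2 = (cvec_norm y)\<^sup>2"
    by (simp only: cscalar_self of_real_eq_iff)
  then show ?thesis by (simp add: power2_eq_iff_nonneg)
qed

text \<open>Dual to Q being an isometry.\<close>

lemma cvec_norm_adjoint_arnoldi_Q_le:
  assumes v: "v \<in> carrier_vec n"
  shows "cvec_norm (mat_adjoint Q *\<^sub>v v) \<le> cvec_norm v"
proof (rule cvec_norm_le_by_pairing)
  show "mat_adjoint Q *\<^sub>v v \<in> carrier_vec k" using v by (rule adjoint_arnoldi_Q_mult_vec_carrier)
  fix y :: "complex vec" assume y: "y \<in> carrier_vec k"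
  have "(mat_adjoint Q *\<^sub>v v) \<bullet>c y = cnj ((Q *\<^sub>v y) \<bullet>c v)"
    using cscalar_commute[OF y adjoint_arnoldi_Q_mult_vec_carrier[OF v]] cscalar_arnoldi_Q[OF y v] by simp
  then have "cmod ((mat_adjoint Q *\<^sub>v v) \<bullet>c y) = cmod ((Q *\<^sub>v y) \<bullet>c v)" by simp
  also have "\<dots> \<le> cvec_norm y * cvec_norm v"
    using cscalar_Cauchy_Schwarz[OF arnoldi_Q_mult_vec_carrier[OF y] v] cvec_norm_arnoldi_Q[OF y] by simp
  finally show "cmod ((mat_adjoint Q *\<^sub>v v) \<bullet>c y) \<le> cvec_norm v * cvec_norm y"
    by (simp add: mult.commute)
qed simp

text \<open>Applying the adjoint of Q to the Arnoldi relation kills the remainder. As a compression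
  of M, H inherits positive-definiteness and the norm bound.\<close>

lemma arnoldi_H_mult_vec:
  assumes y: "y \<in> carrier_vec k"
  shows "H *\<^sub>v y = mat_adjoint Q *\<^sub>v (M *\<^sub>v (Q *\<^sub>v y))"
proof -
  have "mat_adjoint Q *\<^sub>v w k k = 0\<^sub>v k"
    using arnoldi_Q_carrier by (intro eq_vecI) (auto simp: adjoint_arnoldi_Q_index[OF arnoldi_w_carrier] arnoldi_w_last_orthogonal simp del: index_mult_mat_vec)
  moreover have "y $ (k - 1) \<cdot>\<^sub>v (0\<^sub>v k) = (0\<^sub>v k :: complex vec)" by (intro eq_vecI) auto
  moreover have "mat_adjoint Q *\<^sub>v (Q *\<^sub>v (H *\<^sub>v y) + y $ (k - 1) \<cdot>\<^sub>v w k k)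
      = mat_adjoint Q *\<^sub>v (Q *\<^sub>v (H *\<^sub>v y)) + y $ (k - 1) \<cdot>\<^sub>v (mat_adjoint Q *\<^sub>v w k k)"
    using mult_add_distrib_mat_vec[OF mat_adjoint_carrier[OF arnoldi_Q_carrier]
        arnoldi_Q_mult_vec_carrier[OF arnoldi_H_mult_vec_carrier[OF y]], of "y $ (k - 1) \<cdot>\<^sub>v w k k"]
      mult_mat_vec[OF mat_adjoint_carrier[OF arnoldi_Q_carrier] arnoldi_w_carrier] arnoldi_w_carrier[of k k] by simp
  ultimately show ?thesis
    unfolding arnoldi_relation_mult_vec[OF y] using adjoint_arnoldi_Q_cancel[OF arnoldi_H_mult_vec_carrier[OF y]] arnoldi_H_mult_vec_carrier[OF y] by simp
qed

lemma arnoldi_H_pos_def: "pos_def H"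
  unfolding pos_def_def
proof (intro conjI ballI impI)
  show "square_mat H" using arnoldi_H_carrier by simp
  fix y :: "complex vec" assume "y \<in> carrier_vec (dim_row H)" and y1: "cvec_norm y = 1"
  then have y: "y \<in> carrier_vec k" using arnoldi_H_carrier by simp
  have Qy: "Q *\<^sub>v y \<in> carrier_vec n" using y by (rule arnoldi_Q_mult_vec_carrier)
  have MQy: "M *\<^sub>v (Q *\<^sub>v y) \<in> carrier_vec n" using M Qy by (rule mult_mat_vec_carrier)
  have "cvec_norm (Q *\<^sub>v y) = 1" using cvec_norm_arnoldi_Q[OF y] y1 by simp
  then have "Q *\<^sub>v y \<noteq> 0\<^sub>v n" by auto
  then have "0 < Re ((M *\<^sub>v (Q *\<^sub>v y)) \<bullet>c (Q *\<^sub>v y))" by (rule pos_defD[OF M pd Qy])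
  also have "(M *\<^sub>v (Q *\<^sub>v y)) \<bullet>c (Q *\<^sub>v y) = (H *\<^sub>v y) \<bullet>c y"
    using cscalar_commute[OF Qy MQy] cscalar_commute[OF y arnoldi_H_mult_vec_carrier[OF y]]
      cscalar_arnoldi_Q[OF y MQy] arnoldi_H_mult_vec[OF y] by simp
  finally show "0 < Re ((H *\<^sub>v y) \<bullet>c y)" .
qed

lemma arnoldi_H_norm_le:
  assumes bd: "\<And>v. v \<in> carrier_vec n \<Longrightarrow> cvec_norm (M *\<^sub>v v) \<le> a * cvec_norm v"
    and y: "y \<in> carrier_vec k"
  shows "cvec_norm (H *\<^sub>v y) \<le> a * cvec_norm y"
  unfolding arnoldi_H_mult_vec[OF y]
  using cvec_norm_adjoint_arnoldi_Q_le[OF mult_mat_vec_carrier[OF M arnoldi_Q_mult_vec_carrier[OF y]]]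
    bd[OF arnoldi_Q_mult_vec_carrier[OF y]] cvec_norm_arnoldi_Q[OF y] by simp

lemma be_carrier: "be \<in> carrier_vec k" by simp

lemma arnoldi_Q_be: "Q *\<^sub>v be = b"
proof -
  have "Q *\<^sub>v unit_vec k 0 = q (Suc 0)"
    using arnoldi_Q_carrier arnoldi_q_carrier[of "Suc 0"] k by (intro eq_vecI) (auto simp: arnoldi_Q_index)
  then show ?thesis
    using mult_mat_vec[OF arnoldi_Q_carrier unit_vec_carrier] norm_b_pos b
    by (simp add: smult_smult_assoc)
qed

lemma adjoint_arnoldi_Q_b: "mat_adjoint Q *\<^sub>v b = be"
  using adjoint_arnoldi_Q_cancel[OF be_carrier] arnoldi_Q_be by simp

section \<open>FOM errors of the shifted systems\<close>

text \<open>Deleting the first row and last column of an upper Hessenberg matrix leaves an upper triangular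
  one whose diagonal is the subdiagonal, hence insensitive to shifts.\<close>
lemma det_mat_delete_shift_arnoldi_H:
  "det (mat_delete (shift_mat H t) 0 (k - 1)) = (\<Prod>i<k - 1. arnoldi_h M b (Suc (Suc i)) (Suc i))"
proof -
  let ?D = "mat_delete (shift_mat H t) 0 (k - 1)"
  have D: "?D \<in> carrier_mat (k - 1) (k - 1)"
    using arnoldi_H_carrier by (intro mat_delete_carrier) auto
  have idx: "?D $$ (i, j) = arnoldi_h M b (Suc (Suc i)) (Suc j) + (if Suc i = j then complex_of_real t else 0)"
    if "i < k - 1" "j < k - 1" for i j
    using that arnoldi_H_carrier by (simp add: mat_delete_def shift_mat_def arnoldi_H_index)
  have "upper_triangular ?D"
    unfolding upper_triangular_def
  proof (intro allI impI)
    fix i j assume "i < dim_row ?D" and ji: "j < i"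
    then have "i < k - 1" using D by (simp only: carrier_matD)
    with ji show "?D $$ (i, j) = 0" by (simp only: idx) (simp add: arnoldi_h_def)
  qed
  then have "det ?D = prod_list (diag_mat ?D)" using D by (rule det_upper_triangular)
  also have "\<dots> = (\<Prod>i<k - 1. arnoldi_h M b (Suc (Suc i)) (Suc i))"
    unfolding prod_list_diag_prod carrier_matD(1)[OF D] lessThan_atLeast0
    by (rule prod.cong) (auto simp: idx simp del: One_nat_def)
  finally show ?thesis .
qed

text \<open>Coordinates in the Arnoldi basis of the FOM iterate for (M + t) x = b, followed by its
  error; t = 0 is the error in the theorem.\<close>

definition "fom_y t = resolvent H t *\<^sub>v be"
definition "fom_xi t = resolvent M t *\<^sub>v b - Q *\<^sub>v fom_y t"

text \<open>The third claim is Cramer's rule: the product is ||b|| times a cofactor that does not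
  see the shift. The last coordinate is singled out because it multiplies the remainder in the
  Arnoldi relation.\<close>

lemma fom_y:
  assumes t: "0 \<le> t"
  shows "fom_y t \<in> carrier_vec k" "shift_mat H t *\<^sub>v fom_y t = be"
    and "fom_y t $ (k - 1) * det (shift_mat H t) = fom_y 0 $ (k - 1) * det H"
proof -
  obtain c where N: "sectorial k c H" using pos_def_sectorial[OF arnoldi_H_carrier arnoldi_H_pos_def] .
  show "fom_y t \<in> carrier_vec k" "shift_mat H t *\<^sub>v fom_y t = be"
    unfolding fom_y_def using sectorial_resolvent(2,3)[OF N t be_carrier] .
  have last: "fom_y s $ (k - 1) * det (shift_mat H s) =
      complex_of_real (cvec_norm b) * ((-1) ^ (k - 1) * (\<Prod>i<k - 1. arnoldi_h M b (Suc (Suc i)) (Suc i)))"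
    if s: "0 \<le> s" for s
  proof -
    note R = sectorial_resolvent[OF N s]
    let ?S = "shift_mat H s"
    have S: "?S \<in> carrier_mat k k" using arnoldi_H_carrier by auto
    note adj = adj_mat[OF S]
    have "?S *\<^sub>v (adj_mat ?S *\<^sub>v be) = det ?S \<cdot>\<^sub>v be"
    proof -
      have "?S *\<^sub>v (adj_mat ?S *\<^sub>v be) = (det ?S \<cdot>\<^sub>m 1\<^sub>m k) *\<^sub>v be"
        using assoc_mult_mat_vec[OF S adj(1) be_carrier] adj(2) by simp
      also have "\<dots> = det ?S \<cdot>\<^sub>v be" by (intro eq_vecI) auto
      finally show ?thesis .
    qed
    then have "adj_mat ?S *\<^sub>v be = resolvent H s *\<^sub>v (det ?S \<cdot>\<^sub>v be)"
      using R(4)[OF mult_mat_vec_carrier[OF adj(1) be_carrier]] by simp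
    also have "\<dots> = det ?S \<cdot>\<^sub>v fom_y s"
      unfolding fom_y_def by (rule mult_mat_vec[OF R(1) be_carrier])
    finally have "(adj_mat ?S *\<^sub>v be) $ (k - 1) = (det ?S \<cdot>\<^sub>v fom_y s) $ (k - 1)" by simp
    moreover have "(adj_mat ?S *\<^sub>v be) $ (k - 1) = complex_of_real (cvec_norm b) * adj_mat ?S $$ (k - 1, 0)"
    proof -
      have "adj_mat ?S *\<^sub>v be = complex_of_real (cvec_norm b) \<cdot>\<^sub>v (adj_mat ?S *\<^sub>v unit_vec k 0)"
        by (rule mult_mat_vec[OF adj(1) unit_vec_carrier])
      then show ?thesis using adj(1) k by simp
    qed
    \<comment> \<open>The adjugate transposes, so this entry is the cofactor with row 0 and column k
      - 1 deleted.\<close>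
    moreover have "adj_mat ?S $$ (k - 1, 0) = (-1) ^ (k - 1) * (\<Prod>i<k - 1. arnoldi_h M b (Suc (Suc i)) (Suc i))"
      using S k by (simp add: adj_mat_def cofactor_def det_mat_delete_shift_arnoldi_H del: One_nat_def)
    moreover have "fom_y s \<in> carrier_vec k"
      unfolding fom_y_def using R(2)[OF be_carrier] .
    ultimately show ?thesis using k by (simp add: mult.commute)
  qed
  show "fom_y t $ (k - 1) * det (shift_mat H t) = fom_y 0 $ (k - 1) * det H"
    using last[OF t] last[of 0] shift_mat_0[OF arnoldi_H_carrier] by simp
qed

text \<open>A shift adds t Q y to both sides of the Arnoldi relation, so (M + t) Q y = b + y_{k-1}
  \<open>w k k\<close> for every t; apply the resolvent.\<close>

lemma fom_xi_eq:
  assumes t: "0 \<le> t"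
  shows "fom_xi t = - (fom_y t $ (k - 1)) \<cdot>\<^sub>v (resolvent M t *\<^sub>v w k k)"
proof -
  obtain c where N: "sectorial n c M" using pos_def_sectorial[OF M pd] .
  note R = sectorial_resolvent[OF N t] and y = fom_y[OF t]
  let ?y = "fom_y t" and ?a = "fom_y t $ (k - 1)"
  have Qy: "Q *\<^sub>v ?y \<in> carrier_vec n" using y(1) by (rule arnoldi_Q_mult_vec_carrier)
  have QHy: "Q *\<^sub>v (H *\<^sub>v ?y) \<in> carrier_vec n" using arnoldi_H_mult_vec_carrier[OF y(1)] by (rule arnoldi_Q_mult_vec_carrier)
  have "b = Q *\<^sub>v (H *\<^sub>v ?y + complex_of_real t \<cdot>\<^sub>v ?y)"
    using y(2) arnoldi_Q_be unfolding shift_mat_mult_vec[OF arnoldi_H_carrier y(1)] by simp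
  then have "b = Q *\<^sub>v (H *\<^sub>v ?y) + complex_of_real t \<cdot>\<^sub>v (Q *\<^sub>v ?y)"
    using arnoldi_Q_carrier arnoldi_H_mult_vec_carrier[OF y(1)] y(1)
      mult_add_distrib_mat_vec[OF arnoldi_Q_carrier arnoldi_H_mult_vec_carrier[OF y(1)], of "complex_of_real t \<cdot>\<^sub>v ?y"]
    by (simp add: mult_mat_vec[OF arnoldi_Q_carrier])
  then have b_eq: "Q *\<^sub>v (H *\<^sub>v ?y) + complex_of_real t \<cdot>\<^sub>v (Q *\<^sub>v ?y) = b" by (rule sym)
  have comm: "(x + a \<cdot>\<^sub>v z) + e \<cdot>\<^sub>v u = (x + e \<cdot>\<^sub>v u) + a \<cdot>\<^sub>v z"
    if "x \<in> carrier_vec n" "z \<in> carrier_vec n" "u \<in> carrier_vec n" for x z u :: "complex vec" and a e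
    using that by (intro eq_vecI) auto
  have "shift_mat M t *\<^sub>v (Q *\<^sub>v ?y) = b + ?a \<cdot>\<^sub>v w k k"
    unfolding shift_mat_mult_vec[OF M Qy] arnoldi_relation_mult_vec[OF y(1)] comm[OF QHy arnoldi_w_carrier Qy] b_eq ..
  then have "Q *\<^sub>v ?y = resolvent M t *\<^sub>v (b + ?a \<cdot>\<^sub>v w k k)"
    using R(4)[OF Qy] by simp
  also have "\<dots> = resolvent M t *\<^sub>v b + ?a \<cdot>\<^sub>v (resolvent M t *\<^sub>v w k k)"
    using mult_add_distrib_mat_vec[OF R(1) b(1), of "?a \<cdot>\<^sub>v w k k"] arnoldi_w_carrier[of k k]
      mult_mat_vec[OF R(1) arnoldi_w_carrier] by simp
  finally have Qy_eq: "Q *\<^sub>v ?y = resolvent M t *\<^sub>v b + ?a \<cdot>\<^sub>v (resolvent M t *\<^sub>v w k k)" .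
  have "x - (x + a \<cdot>\<^sub>v z) = - a \<cdot>\<^sub>v z"
    if "x \<in> carrier_vec n" "z \<in> carrier_vec n" for x z :: "complex vec" and a
    using that by (intro eq_vecI) auto
  then show ?thesis
    unfolding fom_xi_def Qy_eq using R(2)[OF b(1)] R(2)[OF arnoldi_w_carrier] by simp
qed

lemma fom_xi_0: "fom_xi 0 = fom_error M b k"
  unfolding fom_xi_def fom_y_def fom_error_def shift_mat_0[OF M] shift_mat_0[OF arnoldi_H_carrier] ..

lemma fom_xi_carrier: "0 \<le> t \<Longrightarrow> fom_xi t \<in> carrier_vec n"
proof -
  assume t: "0 \<le> t"
  obtain c where N: "sectorial n c M" using pos_def_sectorial[OF M pd] .
  show ?thesis unfolding fom_xi_eq[OF t] using sectorial_resolvent(2)[OF N t arnoldi_w_carrier] by simp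
qed

text \<open>M times the unshifted error gives back the common direction \<open>w k k\<close> of all
  residuals; between shifts only its coefficient changes, by the determinant quotient.\<close>

lemma fom_xi_shift:
  assumes t: "0 \<le> t" and nz: "det (shift_mat H t) \<noteq> 0"
  shows "fom_xi t = (det H / det (shift_mat H t)) \<cdot>\<^sub>v (resolvent M t *\<^sub>v (M *\<^sub>v fom_xi 0))"
proof -
  obtain c where N: "sectorial n c M" using pos_def_sectorial[OF M pd] .
  note R = sectorial_resolvent[OF N t] and R0 = sectorial_resolvent[OF N order_refl]
  let ?r = "det H / det (shift_mat H t)" and ?a = "fom_y 0 $ (k - 1)"
  have "M *\<^sub>v fom_xi 0 = - ?a \<cdot>\<^sub>v (M *\<^sub>v (resolvent M 0 *\<^sub>v w k k))"
    unfolding fom_xi_eq[OF order_refl] by (rule mult_mat_vec[OF M R0(2)[OF arnoldi_w_carrier]])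
  also have "M *\<^sub>v (resolvent M 0 *\<^sub>v w k k) = w k k"
    using R0(3)[OF arnoldi_w_carrier] unfolding shift_mat_0[OF M] .
  finally have "resolvent M t *\<^sub>v (M *\<^sub>v fom_xi 0) = - ?a \<cdot>\<^sub>v (resolvent M t *\<^sub>v w k k)"
    using mult_mat_vec[OF R(1) arnoldi_w_carrier] by simp
  moreover have "fom_y t $ (k - 1) = ?r * ?a"
    using fom_y(3)[OF t] nz by (simp add: field_simps)
  ultimately show ?thesis
    unfolding fom_xi_eq[OF t] by (simp add: smult_smult_assoc)
qed

text \<open>The k eigenvalues of H and the resolvent of M each contribute an exponent -1/2.\<close>

lemma fom_xi_norm_le:
  assumes t: "0 \<le> t" and a: "0 < a"
    and bd: "\<And>v. v \<in> carrier_vec n \<Longrightarrow> cvec_norm (M *\<^sub>v v) \<le> a * cvec_norm v"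
  shows "cvec_norm (fom_xi t) \<le> (1 + t\<^sup>2 / a\<^sup>2) powr (- ((real k + 1) / 2)) * cvec_norm (fom_error M b k)"
proof -
  note D = det_shift_mat_ratio_le[OF arnoldi_H_carrier arnoldi_H_pos_def a arnoldi_H_norm_le[OF bd] t]
  let ?D = "1 + t\<^sup>2 / a\<^sup>2"
  have "fom_xi t = (det H / det (shift_mat H t)) \<cdot>\<^sub>v (resolvent M t *\<^sub>v (M *\<^sub>v fom_xi 0))"
    by (rule fom_xi_shift[OF t D(2)])
  then have "cvec_norm (fom_xi t) = cmod (det H / det (shift_mat H t)) * cvec_norm (resolvent M t *\<^sub>v (M *\<^sub>v fom_xi 0))"
    by (simp only: cvec_norm_smult)
  also have "\<dots> \<le> ?D powr (- real k / 2) * (?D powr (- 1 / 2) * cvec_norm (fom_xi 0))"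
    by (intro mult_mono D(1) resolvent_mult_norm_le[OF M pd a bd t] fom_xi_carrier) auto
  also have "\<dots> = ?D powr (- ((real k + 1) / 2)) * cvec_norm (fom_xi 0)"
  proof -
    have "- real k / 2 + - 1 / 2 = - ((real k + 1) / 2)" by (simp add: field_simps)
    then show ?thesis by (simp only: mult.assoc[symmetric] powr_add[symmetric])
  qed
  finally show ?thesis unfolding fom_xi_0 .
qed

section \<open>Integration of the shifted errors\<close>

text \<open>At t = s^2 the kernels of M and H differ by -s^2 times the shifted error, whose bound
  integrates to the Beta value with p = (k + 1)/2.\<close>

lemma arnoldi_sqrt_error_bound:
  assumes a: "0 < a"
    and bd: "\<And>v. v \<in> carrier_vec n \<Longrightarrow> cvec_norm (M *\<^sub>v v) \<le> a * cvec_norm v"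
  shows "cvec_norm (mat_sqrt M *\<^sub>v b - arn_sqrt M b k)
    \<le> 2 / pi * (a powr (3/2) / 4 * Beta (3/4) ((real k + 1) / 2 - 3/4)) * cvec_norm (fom_error M b k)"
proof (rule cvec_norm_le_by_pairing)
  obtain c where N: "sectorial n c M" using pos_def_sectorial[OF M pd] .
  obtain d where NH: "sectorial k d H" using pos_def_sectorial[OF arnoldi_H_carrier arnoldi_H_pos_def] .
  let ?J = "a powr (3/2) / 4 * Beta (3/4) ((real k + 1) / 2 - 3/4)" and ?e0 = "cvec_norm (fom_error M b k)"
  have arn: "arn_sqrt M b k = Q *\<^sub>v (sqrt_int H *\<^sub>v be)"
    unfolding arn_sqrt_def adjoint_arnoldi_Q_b mat_sqrt_eq_sqrt_int[OF arnoldi_H_carrier arnoldi_H_pos_def] ..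
  have msq: "mat_sqrt M = sqrt_int M" by (rule mat_sqrt_eq_sqrt_int[OF M pd])
  have Xb: "sqrt_int M *\<^sub>v b \<in> carrier_vec n"
    using sqrt_int_carrier[OF M] b(1) by (rule mult_mat_vec_carrier)
  have Yb: "sqrt_int H *\<^sub>v be \<in> carrier_vec k"
    using sqrt_int_carrier[OF arnoldi_H_carrier] be_carrier by (rule mult_mat_vec_carrier)
  show "mat_sqrt M *\<^sub>v b - arn_sqrt M b k \<in> carrier_vec n"
    unfolding arn msq using Xb arnoldi_Q_mult_vec_carrier[OF Yb] by simp
  \<comment> \<open>The sign is read off the integral, whose integrand is visibly
    nonnegative.\<close>
  have J: "0 \<le> ?J"
  proof (rule has_integral_nonneg)
    show "((\<lambda>s. s\<^sup>2 * (1 + s ^ 4 / a\<^sup>2) powr (- ((real k + 1) / 2))) has_integral ?J) {0..}"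
      by (rule has_integral_decay_kernel[OF a]) (use k in simp)
  qed simp
  then show "0 \<le> 2 / pi * ?J * ?e0" by simp
  fix v :: "complex vec" assume v: "v \<in> carrier_vec n"
  have Qv: "mat_adjoint Q *\<^sub>v v \<in> carrier_vec k" using v by (rule adjoint_arnoldi_Q_mult_vec_carrier)
  \<comment> \<open>Q is moved onto v, so that the part from H is also an integral of pairings with
    fixed vectors.\<close>
  have "cmod (complex_of_real (pi / 2) * ((sqrt_int M *\<^sub>v b) \<bullet>c v)
      - complex_of_real (pi / 2) * ((sqrt_int H *\<^sub>v be) \<bullet>c (mat_adjoint Q *\<^sub>v v))) \<le> ?J * (?e0 * cvec_norm v)"
  proof (rule has_integral_cmod_le)
    show "((\<lambda>s. (sqrt_kernel M s *\<^sub>v b) \<bullet>c v - (sqrt_kernel H s *\<^sub>v be) \<bullet>c (mat_adjoint Q *\<^sub>v v)) has_integral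
        (complex_of_real (pi / 2) * ((sqrt_int M *\<^sub>v b) \<bullet>c v)
        - complex_of_real (pi / 2) * ((sqrt_int H *\<^sub>v be) \<bullet>c (mat_adjoint Q *\<^sub>v v)))) {0..}"
      by (intro has_integral_diff sqrt_int_has_integral[OF N] sqrt_int_has_integral[OF NH] b v be_carrier Qv)
    have "((\<lambda>s. s\<^sup>2 * (1 + s ^ 4 / a\<^sup>2) powr (- ((real k + 1) / 2))) has_integral ?J) {0..}"
      by (rule has_integral_decay_kernel[OF a]) (use k in simp)
    then show "((\<lambda>s. s\<^sup>2 * (1 + s ^ 4 / a\<^sup>2) powr (- ((real k + 1) / 2)) * (?e0 * cvec_norm v))
        has_integral (?J * (?e0 * cvec_norm v))) {0..}"
      by (rule has_integral_mult_left)
    fix s :: real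
    note xi = fom_xi_carrier[of "s\<^sup>2", simplified]
    let ?kM = "sqrt_kernel M s *\<^sub>v b" and ?kH = "sqrt_kernel H s *\<^sub>v be"
    have kM: "?kM \<in> carrier_vec n" using sqrt_kernel_carrier[OF N] b(1) by (rule mult_mat_vec_carrier)
    have kH: "?kH \<in> carrier_vec k" using sqrt_kernel_carrier[OF NH] be_carrier by (rule mult_mat_vec_carrier)
    have y: "fom_y (s\<^sup>2) \<in> carrier_vec k" using fom_y(1)[of "s\<^sup>2"] by simp
    have RM: "resolvent M (s\<^sup>2) *\<^sub>v b \<in> carrier_vec n" using sectorial_resolvent(2)[OF N _ b(1), of "s\<^sup>2"] by simp
    have "Q *\<^sub>v ?kH = b - complex_of_real (s\<^sup>2) \<cdot>\<^sub>v (Q *\<^sub>v fom_y (s\<^sup>2))"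
      unfolding sqrt_kernel_mult_vec(2)[OF NH be_carrier] fom_y_def[symmetric]
      using mult_mat_vec_diff[OF arnoldi_Q_carrier be_carrier, of "complex_of_real (s\<^sup>2) \<cdot>\<^sub>v fom_y (s\<^sup>2)"] y
        mult_mat_vec[OF arnoldi_Q_carrier y, of "complex_of_real (s\<^sup>2)"] arnoldi_Q_be by simp
    moreover have "(b - e \<cdot>\<^sub>v x) - (b - e \<cdot>\<^sub>v z) = - e \<cdot>\<^sub>v (x - z)"
      if "x \<in> carrier_vec n" "z \<in> carrier_vec n" for x z :: "complex vec" and e
      using that b(1) by (intro eq_vecI) (auto simp: algebra_simps)
    ultimately have diff: "?kM - Q *\<^sub>v ?kH = - complex_of_real (s\<^sup>2) \<cdot>\<^sub>v fom_xi (s\<^sup>2)"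
      unfolding sqrt_kernel_mult_vec(2)[OF N b(1)] fom_xi_def using RM arnoldi_Q_mult_vec_carrier[OF y] by metis
    have "?kM \<bullet>c v - ?kH \<bullet>c (mat_adjoint Q *\<^sub>v v) = (?kM - Q *\<^sub>v ?kH) \<bullet>c v"
      unfolding cscalar_arnoldi_Q[OF kH v, symmetric]
      using kM arnoldi_Q_mult_vec_carrier[OF kH] v by (subst minus_scalar_prod_distrib[of _ n]) auto
    also have "cmod \<dots> \<le> cvec_norm (?kM - Q *\<^sub>v ?kH) * cvec_norm v"
      using kM arnoldi_Q_mult_vec_carrier[OF kH] v by (intro cscalar_Cauchy_Schwarz) auto
    also have "cvec_norm (?kM - Q *\<^sub>v ?kH) = s\<^sup>2 * cvec_norm (fom_xi (s\<^sup>2))"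
      unfolding diff by (simp add: cvec_norm_smult norm_power)
    also have "\<dots> \<le> s\<^sup>2 * ((1 + (s\<^sup>2)\<^sup>2 / a\<^sup>2) powr (- ((real k + 1) / 2)) * ?e0)"
      by (intro mult_left_mono fom_xi_norm_le[OF _ a bd]) auto
    also have "(s\<^sup>2)\<^sup>2 = s ^ 4" by simp
    finally show "cmod (?kM \<bullet>c v - ?kH \<bullet>c (mat_adjoint Q *\<^sub>v v))
        \<le> s\<^sup>2 * (1 + s ^ 4 / a\<^sup>2) powr (- ((real k + 1) / 2)) * (?e0 * cvec_norm v)"
      by (simp add: mult_right_mono mult.assoc)
  qed
  also have "complex_of_real (pi / 2) * ((sqrt_int M *\<^sub>v b) \<bullet>c v)
      - complex_of_real (pi / 2) * ((sqrt_int H *\<^sub>v be) \<bullet>c (mat_adjoint Q *\<^sub>v v))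
      = complex_of_real (pi / 2) * ((mat_sqrt M *\<^sub>v b - arn_sqrt M b k) \<bullet>c v)"
    unfolding arn msq cscalar_arnoldi_Q[OF Yb v, symmetric]
    using Xb arnoldi_Q_mult_vec_carrier[OF Yb] v by (subst minus_scalar_prod_distrib[of _ n]) (auto simp: right_diff_distrib)
  also have "?J * (?e0 * cvec_norm v) = (2 / pi * ?J * ?e0 * cvec_norm v) * (pi / 2)" by simp
  finally show "cmod ((mat_sqrt M *\<^sub>v b - arn_sqrt M b k) \<bullet>c v) \<le> 2 / pi * ?J * ?e0 * cvec_norm v"
    by (rule cmod_pi_half_mult_le)
qed

end

theorem theorem3p7:
  fixes M :: "complex mat" and b :: "complex vec" and n k :: nat
  assumes "M \<in> carrier_mat n n"
    and "pos_def M"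
    and "b \<in> carrier_vec n"
    and "b \<noteq> 0\<^sub>v n"
    and "k \<ge> 2"
    and "arnoldi_defined M b k"
  shows "cvec_norm (mat_sqrt M *\<^sub>v b - arn_sqrt M b k)
    \<le> Gamma (3 / 4) / (2 powr (1 / 4) * pi) * (2 * real k / (2 * real k - 3))
        * sigma_max M powr (3 / 2) * real k powr (- 3 / 4) * cvec_norm (fom_error M b k)"
proof -
  have n: "0 < n"
  proof (rule ccontr)
    assume "\<not> 0 < n"
    then have "b = 0\<^sub>v n" using assms(3) by (intro eq_vecI) auto
    with assms(4) show False ..
  qed
  note sigma = sigma_max_bound[OF assms(1) n]
  \<comment> \<open>A positive bound is required since the decay factor divides by its square;
    injectivity of M on b excludes \<open>sigma_max M\<close> = 0.\<close>
  have "M *\<^sub>v b \<noteq> 0\<^sub>v n" using pos_def_inj[OF assms(1-3)] assms(4) by blast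
  then have "cvec_norm (M *\<^sub>v b) \<noteq> 0"
    using cvec_norm_eq_0_iff[OF mult_mat_vec_carrier[OF assms(1,3)]] by simp
  then have "0 < cvec_norm (M *\<^sub>v b)" using cvec_norm_nonneg[of "M *\<^sub>v b"] by linarith
  then have "sigma_max M \<noteq> 0" using sigma(2)[OF assms(3)] by auto
  then have pos: "0 < sigma_max M" using sigma(1) by simp
  have "cvec_norm (mat_sqrt M *\<^sub>v b - arn_sqrt M b k)
    \<le> 2 / pi * (sigma_max M powr (3/2) / 4 * Beta (3/4) ((real k + 1) / 2 - 3/4)) * cvec_norm (fom_error M b k)"
    by (rule arnoldi_sqrt_error_bound[OF assms pos sigma(2)])
  also have "\<dots> \<le> Gamma (3 / 4) / (2 powr (1 / 4) * pi) * (2 * real k / (2 * real k - 3))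
        * sigma_max M powr (3 / 2) * real k powr (- 3 / 4) * cvec_norm (fom_error M b k)"
    by (rule mult_right_mono[OF decay_kernel_constant_le[OF assms(5) pos]]) simp
  finally show ?thesis .
qed

end
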